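(* Let $\alpha,\beta\ge0$ satisfy $\alpha+\beta=1$. Let $F:\Gamma\to\mathbb{R}$ and $\Psi:\mathbb{R}^N\to\mathbb{R}$ be two bounded Borel functions such that $\Psi\le F$ in $\Gamma$. Define $G:X\to\mathbb{R}$ by $G=\chi_\Gamma F+\chi_\Omega\Psi$, where $\chi_A$ is the characteristic function of a set $A\subset X$. Define the two value functions $$u_I(x_0)=\sup_{\tau,\sigma_I}\ \inf_{\sigma_{II}}\ \mathbb{E}^{x_0}_{\tau,\sigma_I,\sigma_{II}}[G\circ x_\tau],\qquad u_{II}(x_0)=\inf_{\sigma_{II}}\ \sup_{\tau,\sigma_I}\ \mathbb{E}^{x_0}_{\tau,\sigma_I,\sigma_{II}}[G\circ x_\tau],$$ where $\sup$ and $\inf$ are taken over all strategies $\sigma_I$, $\sigma_{II}$ and all stopping times $\tau\le\tau_0$ that do not exceed the exit time $\tau_0$ from $\Omega$. Then $$u_I=u=u_{II}\quad\text{in }\Omega,$$ where $u:X\to\mathbb{R}$ is a bounded Borel function satisfying $$u(x)=\begin{cases}\displaystyle \max\Big\{\Psi(x),\ \frac{\alpha}{2}\sup_{B_\epsilon(x)}u+\frac{\alpha}{2}\inf_{B_\epsilon(x)}u+\beta\,\frac{1}{|B_\epsilon(x)|}\int_{B_\epsilon(x)}u(y)\,dy\Big\} & \text{for } x\in\Omega,\\[2mm] F(x) & \text{for } x\in\Gamma.\end{cases}$$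
   Context: $\Omega\subset\mathbb{R}^N$ is an open, bounded set with Lipschitz boundary. A small constant $0<\epsilon_0\ll1$ is fixed, $\Gamma=\{x\in\mathbb{R}^N\setminus\Omega:\ \mathrm{dist}(x,\Omega)<\epsilon_0\}$, $X=\Omega\cup\Gamma$, and $\epsilon\in(0,\epsilon_0]$ is fixed. $B_\epsilon(x)$ is the open ball of radius $\epsilon$ centered at $x$. Path space. For $x_0\in X$ let $X^{\infty,x_0}=\{\omega=(x_0,x_1,x_2,\ldots):\ x_n\in X \text{ for all } n\ge1\}$. For $n\ge1$, $\mathcal{F}^{x_0}_n$ is the $\sigma$-algebra of subsets of $X^{\infty,x_0}$ generated by the sets $A_1\times\cdots\times A_n:=\{\omega:\ x_i\in A_i \text{ for } i=1,\ldots,n\}$ with $A_1,\ldots,A_n\subset X$ Borel; $\mathcal{F}_0^{x_0}$ is trivial; $\mathcal{F}^{x_0}$ is the smallest $\sigma$-algebra containing $\bigcup_{n\ge1}\mathcal{F}^{x_0}_n$. The coordinate maps are $x_n(\omega)=x_n$. Stopping times. The exit time is $\tau_0(\omega)=\min\{n\ge0:\ x_n\in\Gamma\}$, with the convention $\min\emptyset=+\infty$. A stopping time is a map $\tau:X^{\infty,x_0}\to\mathbb{N}\cup\{+\infty\}$ with $\{\tau\le n\}\in\mathcal{F}_n^{x_0}$ for all $n\ge0$; only stopping times with $\tau\le\tau_0$ are considered. Put $A_n^\tau=\{(x_0,x_1,\ldots,x_n):\ \exists\,\omega=(x_0,\ldots,x_n,x_{n+1},\ldots)\in X^{\infty,x_0},\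 \tau(\omega)\le n\}$. The random variable $x_\tau$ is $\omega\mapsto x_{\tau(\omega)}$. Strategies. A strategy $\sigma_I=\{\sigma_I^n\}_{n\ge0}$ of Player I (respectively $\sigma_{II}=\{\sigma_{II}^n\}_{n\ge0}$ of Player II) is a sequence of Borel functions $X^{n+1}\to X$ with $\sigma_I^n(x_0,\ldots,x_n)\in B_\epsilon(x_n)\cap X$ (respectively $\sigma_{II}^n(x_0,\ldots,x_n)\in B_\epsilon(x_n)\cap X$). Probability measure. Given $\tau,\sigma_I,\sigma_{II}$, define for $n\ge0$ the Borel probability measures on $X$ $$\gamma_n[x_0,\ldots,x_n]=\begin{cases}\displaystyle\frac{\alpha}{2}\delta_{\sigma_I^n(x_0,\ldots,x_n)}+\frac{\alpha}{2}\delta_{\sigma_{II}^n(x_0,\ldots,x_n)}+\beta\,\frac{\mathcal{L}_N\lfloor B_\epsilon(x_n)}{|B_\epsilon(x_n)|} & \text{if }(x_0,\ldots,x_n)\notin A_n^\tau,\\ \delta_{x_n} & \text{otherwise,}\end{cases}$$ where $\delta_y$ is the Dirac measure at $y$ and $\mathcal{L}_N\lfloor B_\epsilon(x_n)$ is $N$-dimensional Lebesgue measure restricted to the ball. $\mathbb{P}^{x_0}_{\tau,\sigma_I,\sigma_{II}}$ is the unique probability measure on $(X^{\infty,x_0},\mathcal{F}^{x_0})$ such that for every $n\ge1$ and all Borel $A_1,\ldots,A_n\subset X$, $$\mathbb{P}^{x_0}_{\tau,\sigma_I,\sigma_{II}}(A_1\times\cdots\times A_n)=\int_{A_1}\cdots\int_{A_n}1\,d\gamma_{n-1}[x_0,\ldots,x_{n-1}]\cdots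 d\gamma_0[x_0].$$ $\mathbb{E}^{x_0}_{\tau,\sigma_I,\sigma_{II}}$ denotes the corresponding expectation. *)

theory Defs
  imports "HOL-Probability.Probability"
begin

text \<open>
  Near each boundary point the set is the strict subgraph of a Lipschitz function over the
  hyperplane orthogonal to some unit vector \<open>e\<close>.
\<close>

definition lipschitz_boundary :: "'a::euclidean_space set \<Rightarrow> bool" where
  "lipschitz_boundary S \<longleftrightarrow>
    (\<forall>p\<in>frontier S. \<exists>U e L g.
       open U \<and> p \<in> U \<and> norm e = 1 \<and>
       L-lipschitz_on {z. z \<bullet> e = 0} (g :: 'a \<Rightarrow> real) \<and>
       S \<inter> U = {y \<in> U. y \<bullet> e < g (y - (y \<bullet> e) *\<^sub>R e)} \<and>
       frontier S \<inter> U = {y \<in> U. y \<bullet> e = g (y - (y \<bullet> e) *\<^sub>R e)})"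

definition outer_strip :: "'a::euclidean_space set \<Rightarrow> real \<Rightarrow> 'a set" where
  "outer_strip \<Omega> \<epsilon>\<^sub>0 = {x. x \<notin> \<Omega> \<and> infdist x \<Omega> < \<epsilon>\<^sub>0}"

definition arena :: "'a::euclidean_space set \<Rightarrow> real \<Rightarrow> 'a set" where
  "arena \<Omega> \<epsilon>\<^sub>0 = \<Omega> \<union> outer_strip \<Omega> \<epsilon>\<^sub>0"

abbreviation borel_on :: "'a::topological_space set \<Rightarrow> 'a measure" where
  "borel_on X \<equiv> restrict_space borel X"

definition paths :: "'a set \<Rightarrow> 'a \<Rightarrow> (nat \<Rightarrow> 'a) set" where
  "paths X x\<^sub>0 = {\<omega>. \<omega> 0 = x\<^sub>0 \<and> (\<forall>n\<ge>1. \<omega> n \<in> X)}"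

definition cylinder :: "'a set \<Rightarrow> 'a \<Rightarrow> nat \<Rightarrow> (nat \<Rightarrow> 'a set) \<Rightarrow> (nat \<Rightarrow> 'a) set" where
  "cylinder X x\<^sub>0 n A = {\<omega> \<in> paths X x\<^sub>0. \<forall>i\<in>{1..n}. \<omega> i \<in> A i}"

text \<open>
  The \<open>\<sigma>\<close>-algebras are represented as measure spaces of which only the space and the measurable
  sets matter. For \<open>n = 0\<close> the only cylinder is the whole path space, so \<open>path_filtration X x\<^sub>0 0\<close>
  is trivial.
\<close>

definition path_filtration :: "'a::topological_space set \<Rightarrow> 'a \<Rightarrow> nat \<Rightarrow> (nat \<Rightarrow> 'a) measure" where
  "path_filtration X x\<^sub>0 n =
    sigma (paths X x\<^sub>0) {cylinder X x\<^sub>0 n A | A. \<forall>i\<in>{1..n}. A i \<in> sets (borel_on X)}"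

definition path_algebra :: "'a::topological_space set \<Rightarrow> 'a \<Rightarrow> (nat \<Rightarrow> 'a) measure" where
  "path_algebra X x\<^sub>0 = sigma (paths X x\<^sub>0) (\<Union>n\<in>{1..}. sets (path_filtration X x\<^sub>0 n))"

text \<open>The infimum of the empty set in \<^typ>\<open>enat\<close> is \<open>\<infinity>\<close>.\<close>

definition hitting_time :: "'a set \<Rightarrow> (nat \<Rightarrow> 'a) \<Rightarrow> enat" where
  "hitting_time \<Gamma> \<omega> = (INF n\<in>{n. \<omega> n \<in> \<Gamma>}. enat n)"

text \<open>
  The library's \<open>stopping_time\<close> takes its values in the index set of the filtration, so it
  does not cover \<open>\<nat> \<union> {\<infinity>}\<close>-valued times over a filtration indexed by \<open>\<nat>\<close>. The values of a
  stopping time outside the path space are irrelevant.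
\<close>

definition path_stopping_time ::
    "'a::topological_space set \<Rightarrow> 'a \<Rightarrow> ((nat \<Rightarrow> 'a) \<Rightarrow> enat) \<Rightarrow> bool" where
  "path_stopping_time X x\<^sub>0 \<tau> \<longleftrightarrow>
    (\<forall>n. {\<omega> \<in> paths X x\<^sub>0. \<tau> \<omega> \<le> enat n} \<in> sets (path_filtration X x\<^sub>0 n))"

definition admissible_times ::
    "'a::euclidean_space set \<Rightarrow> real \<Rightarrow> 'a \<Rightarrow> ((nat \<Rightarrow> 'a) \<Rightarrow> enat) set" where
  "admissible_times \<Omega> \<epsilon>\<^sub>0 x\<^sub>0 =
    {\<tau>. path_stopping_time (arena \<Omega> \<epsilon>\<^sub>0) x\<^sub>0 \<tau> \<and>
        (\<forall>\<omega>\<in>paths (arena \<Omega> \<epsilon>\<^sub>0) x\<^sub>0. \<tau> \<omega> \<le> hitting_time (outer_strip \<Omega> \<epsilon>\<^sub>0) \<omega>)}"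

text \<open>
  A history \<open>(x\<^sub>0, \<dots>, x\<^sub>n) \<in> X\<^sup>n\<^sup>+\<^sup>1\<close> is an extensional function on \<open>{..n}\<close>.
\<close>

definition strategies ::
    "'a::euclidean_space set \<Rightarrow> real \<Rightarrow> (nat \<Rightarrow> (nat \<Rightarrow> 'a) \<Rightarrow> 'a) set" where
  "strategies X \<epsilon> =
    {\<sigma>. \<forall>n. \<sigma> n \<in> (\<Pi>\<^sub>M i\<in>{..n}. borel_on X) \<rightarrow>\<^sub>M borel_on X \<and>
            (\<forall>h\<in>{..n} \<rightarrow>\<^sub>E X. \<sigma> n h \<in> ball (h n) \<epsilon> \<inter> X)}"

text \<open>The set \<open>A\<^sub>n\<^sup>\<tau>\<close> of histories at which the game has stopped.\<close>

definition stopped_histories ::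
    "'a set \<Rightarrow> 'a \<Rightarrow> ((nat \<Rightarrow> 'a) \<Rightarrow> enat) \<Rightarrow> nat \<Rightarrow> (nat \<Rightarrow> 'a) set" where
  "stopped_histories X x\<^sub>0 \<tau> n = {restrict \<omega> {..n} | \<omega>. \<omega> \<in> paths X x\<^sub>0 \<and> \<tau> \<omega> \<le> enat n}"

definition transition ::
    "'a::euclidean_space set \<Rightarrow> real \<Rightarrow> real \<Rightarrow> real \<Rightarrow> 'a \<Rightarrow> ((nat \<Rightarrow> 'a) \<Rightarrow> enat) \<Rightarrow>
     (nat \<Rightarrow> (nat \<Rightarrow> 'a) \<Rightarrow> 'a) \<Rightarrow> (nat \<Rightarrow> (nat \<Rightarrow> 'a) \<Rightarrow> 'a) \<Rightarrow> nat \<Rightarrow> (nat \<Rightarrow> 'a) \<Rightarrow> 'a measure" where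
  "transition X \<epsilon> \<alpha> \<beta> x\<^sub>0 \<tau> \<sigma>\<^sub>I \<sigma>\<^sub>I\<^sub>I n h =
    (if h \<notin> stopped_histories X x\<^sub>0 \<tau> n
     then measure_of X (sets (borel_on X))
       (\<lambda>A. ennreal (\<alpha> / 2) * emeasure (return (borel_on X) (\<sigma>\<^sub>I n h)) A +
            ennreal (\<alpha> / 2) * emeasure (return (borel_on X) (\<sigma>\<^sub>I\<^sub>I n h)) A +
            ennreal \<beta> * emeasure (uniform_measure lborel (ball (h n) \<epsilon>)) A)
     else return (borel_on X) (h n))"

text \<open>
  \<open>iterated_integral \<gamma> A m k h\<close> is
  \<open>\<integral>\<^bsub>A\<^bsub>k+1\<^esub>\<^esub> \<dots> \<integral>\<^bsub>A\<^bsub>k+m\<^esub>\<^esub> 1 d\<gamma>\<^bsub>k+m-1\<^esub>[x\<^sub>0, \<dots>, x\<^bsub>k+m-1\<^esub>] \<dots> d\<gamma>\<^sub>k[x\<^sub>0, \<dots>, x\<^sub>k]\<close>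
  for the history \<open>h = (x\<^sub>0, \<dots>, x\<^sub>k)\<close>.
\<close>

primrec iterated_integral ::
    "(nat \<Rightarrow> (nat \<Rightarrow> 'a) \<Rightarrow> 'a measure) \<Rightarrow> (nat \<Rightarrow> 'a set) \<Rightarrow> nat \<Rightarrow> nat \<Rightarrow> (nat \<Rightarrow> 'a) \<Rightarrow> ennreal"
where
  "iterated_integral \<gamma> A 0 k h = 1"
| "iterated_integral \<gamma> A (Suc m) k h =
    (\<integral>\<^sup>+y\<in>A (Suc k). iterated_integral \<gamma> A m (Suc k) (h(Suc k := y)) \<partial>\<gamma> k h)"

definition game_measure ::
    "'a::euclidean_space set \<Rightarrow> real \<Rightarrow> real \<Rightarrow> real \<Rightarrow> 'a \<Rightarrow> ((nat \<Rightarrow> 'a) \<Rightarrow> enat) \<Rightarrow>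
     (nat \<Rightarrow> (nat \<Rightarrow> 'a) \<Rightarrow> 'a) \<Rightarrow> (nat \<Rightarrow> (nat \<Rightarrow> 'a) \<Rightarrow> 'a) \<Rightarrow> (nat \<Rightarrow> 'a) measure" where
  "game_measure X \<epsilon> \<alpha> \<beta> x\<^sub>0 \<tau> \<sigma>\<^sub>I \<sigma>\<^sub>I\<^sub>I =
    (THE P. prob_space P \<and> space P = paths X x\<^sub>0 \<and> sets P = sets (path_algebra X x\<^sub>0) \<and>
       (\<forall>n\<ge>1. \<forall>A. (\<forall>i\<in>{1..n}. A i \<in> sets (borel_on X)) \<longrightarrow>
          emeasure P (cylinder X x\<^sub>0 n A) =
          iterated_integral (transition X \<epsilon> \<alpha> \<beta> x\<^sub>0 \<tau> \<sigma>\<^sub>I \<sigma>\<^sub>I\<^sub>I) A n 0 (restrict (\<lambda>_. x\<^sub>0) {..0})))"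

text \<open>
  The payoff \<open>G \<circ> x\<^sub>\<tau>\<close>, set to \<open>0\<close> where \<open>\<tau> = \<infinity>\<close> and \<open>x\<^sub>\<tau>\<close> is undefined. If \<open>\<beta> > 0\<close>, this
  happens with probability zero.
\<close>

definition stopped_payoff ::
    "('a \<Rightarrow> real) \<Rightarrow> ((nat \<Rightarrow> 'a) \<Rightarrow> enat) \<Rightarrow> (nat \<Rightarrow> 'a) \<Rightarrow> real" where
  "stopped_payoff G \<tau> \<omega> = (case \<tau> \<omega> of enat n \<Rightarrow> G (\<omega> n) | \<infinity> \<Rightarrow> 0)"

definition expected_payoff ::
    "'a::euclidean_space set \<Rightarrow> real \<Rightarrow> real \<Rightarrow> real \<Rightarrow> ('a \<Rightarrow> real) \<Rightarrow> 'a \<Rightarrow> ((nat \<Rightarrow> 'a) \<Rightarrow> enat) \<Rightarrow>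
     (nat \<Rightarrow> (nat \<Rightarrow> 'a) \<Rightarrow> 'a) \<Rightarrow> (nat \<Rightarrow> (nat \<Rightarrow> 'a) \<Rightarrow> 'a) \<Rightarrow> real" where
  "expected_payoff X \<epsilon> \<alpha> \<beta> G x\<^sub>0 \<tau> \<sigma>\<^sub>I \<sigma>\<^sub>I\<^sub>I =
    (\<integral>\<omega>. stopped_payoff G \<tau> \<omega> \<partial>game_measure X \<epsilon> \<alpha> \<beta> x\<^sub>0 \<tau> \<sigma>\<^sub>I \<sigma>\<^sub>I\<^sub>I)"

definition value_I ::
    "'a::euclidean_space set \<Rightarrow> real \<Rightarrow> real \<Rightarrow> real \<Rightarrow> real \<Rightarrow> ('a \<Rightarrow> real) \<Rightarrow> 'a \<Rightarrow> real" where
  "value_I \<Omega> \<epsilon>\<^sub>0 \<epsilon> \<alpha> \<beta> G x\<^sub>0 =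
    (SUP (\<tau>, \<sigma>\<^sub>I)\<in>admissible_times \<Omega> \<epsilon>\<^sub>0 x\<^sub>0 \<times> strategies (arena \<Omega> \<epsilon>\<^sub>0) \<epsilon>.
       INF \<sigma>\<^sub>I\<^sub>I\<in>strategies (arena \<Omega> \<epsilon>\<^sub>0) \<epsilon>.
         expected_payoff (arena \<Omega> \<epsilon>\<^sub>0) \<epsilon> \<alpha> \<beta> G x\<^sub>0 \<tau> \<sigma>\<^sub>I \<sigma>\<^sub>I\<^sub>I)"

definition value_II ::
    "'a::euclidean_space set \<Rightarrow> real \<Rightarrow> real \<Rightarrow> real \<Rightarrow> real \<Rightarrow> ('a \<Rightarrow> real) \<Rightarrow> 'a \<Rightarrow> real" where
  "value_II \<Omega> \<epsilon>\<^sub>0 \<epsilon> \<alpha> \<beta> G x\<^sub>0 =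
    (INF \<sigma>\<^sub>I\<^sub>I\<in>strategies (arena \<Omega> \<epsilon>\<^sub>0) \<epsilon>.
       SUP (\<tau>, \<sigma>\<^sub>I)\<in>admissible_times \<Omega> \<epsilon>\<^sub>0 x\<^sub>0 \<times> strategies (arena \<Omega> \<epsilon>\<^sub>0) \<epsilon>.
         expected_payoff (arena \<Omega> \<epsilon>\<^sub>0) \<epsilon> \<alpha> \<beta> G x\<^sub>0 \<tau> \<sigma>\<^sub>I \<sigma>\<^sub>I\<^sub>I)"

definition dpp_solution ::
    "'a::euclidean_space set \<Rightarrow> real \<Rightarrow> real \<Rightarrow> real \<Rightarrow> real \<Rightarrow> ('a \<Rightarrow> real) \<Rightarrow> ('a \<Rightarrow> real) \<Rightarrow>
     ('a \<Rightarrow> real) \<Rightarrow> bool" where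
  "dpp_solution \<Omega> \<epsilon>\<^sub>0 \<epsilon> \<alpha> \<beta> F \<Psi> u \<longleftrightarrow>
    u \<in> borel_measurable (borel_on (arena \<Omega> \<epsilon>\<^sub>0)) \<and>
    bounded (u ` arena \<Omega> \<epsilon>\<^sub>0) \<and>
    (\<forall>x\<in>\<Omega>. u x = max (\<Psi> x)
       (\<alpha> / 2 * (SUP y\<in>ball x \<epsilon>. u y) + \<alpha> / 2 * (INF y\<in>ball x \<epsilon>. u y) +
        \<beta> * (1 / measure lborel (ball x \<epsilon>) * (LINT y:ball x \<epsilon>|lborel. u y)))) \<and>
    (\<forall>x\<in>outer_strip \<Omega> \<epsilon>\<^sub>0. u x = F x)"

end

theory Submission
  imports Defs
begin

text \<open>
  Let \<open>u\<close> solve the dynamic programming equation. The proof produces functions \<open>v\<close>, as close to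
  \<open>u\<close> as desired, together with a Borel way of moving for one player, such that the expected value
  of \<open>v\<close> at the next position exceeds its current value by a fixed amount \<open>c > 0\<close>, whatever the
  opponent does. Such a drift does two jobs at once (\<open>drift_lower_bound\<close>). As \<open>v\<close> is bounded, the
  expected number of turns is at most of order \<open>1 / c\<close>, so the game stops almost surely; and optional
  stopping bounds the expected final value of \<open>v\<close> below by \<open>v x\<^sub>0\<close>. Player I uses this with
  \<open>v\<close> near \<open>u\<close> and stops as soon as \<open>u \<le> \<Psi>\<close>, where the payoff is no less than \<open>u\<close>. Player II uses it
  with \<open>v\<close> near \<open>-u\<close>, at every point of \<open>\<Omega>\<close>: the payoff never exceeds \<open>u\<close>, so no choice of the
  stopping time helps Player I. Since \<open>sup inf \<le> inf sup\<close>, both values equal \<open>u\<close>.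

  The function \<open>w = u\<close> is a subsolution of the equation without obstacle where \<open>u > \<Psi>\<close>, and
  \<open>w = -u\<close> is one in all of \<open>\<Omega>\<close>. So everything rests on making a subsolution strict by a small
  perturbation (\<open>strict_subsolution_exists\<close>). If \<open>\<beta> > 0\<close>, the noise moves the token a definite
  distance in a fixed direction with a probability bounded below; adding a small multiple of an
  exponential that is steep enough in this direction gives the drift, because the players can at worst
  bring the exponential down to \<open>0\<close>. If \<open>\<beta> = 0\<close>, the players alone move the token and the drift comes
  from convexity: if the supremum of \<open>w\<close> over the ball exceeds \<open>w x\<close> by at least \<open>d\<close>, then
  \<open>w + k (w + D)\<^sup>2\<close> gains a variance term. A subsolution may be flat, so it is first made steep
  (\<open>steepening\<close>): where its slope is at most \<open>d\<close>, it is replaced by the best value outside this flat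
  region less a toll of \<open>d\<close> for every step needed to get there.

  Measurability of the extremal terms is free: the supremum of any bounded function over the open ball
  of radius \<open>\<epsilon>\<close> is a lower semicontinuous function of the centre. By Lindeloef's theorem almost optimal
  moves can be chosen from a countable set of points, hence in a Borel way (\<open>near_sup_selector\<close>).

  A solution exists for two different reasons. If \<open>\<beta> = 0\<close>, the right-hand side of the equation is a
  monotone operator on a complete lattice of functions and Borel measurability of its fixed points is
  automatic. If \<open>\<beta> > 0\<close>, the operator is iterated from below; the averages of the iterates converge
  uniformly, the remaining part of the operator contracts by the factor \<open>\<alpha> < 1\<close>, and so the
  convergence is uniform and passes through the infimum.
\<close>

section \<open>The arena\<close>

text \<open>
  The domain is assumed to be nonempty because \<open>infdist x {} = 0\<close> makes the arena of the empty
  domain the whole space, which is not bounded.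
\<close>
locale tug_of_war =
  fixes \<Omega> :: "'a::euclidean_space set" and \<epsilon>\<^sub>0 \<epsilon> \<alpha> \<beta> :: real
  assumes open_domain: "open \<Omega>" and bounded_domain: "bounded \<Omega>" and nonempty_domain: "\<Omega> \<noteq> {}"
    and eps_pos: "0 < \<epsilon>" and eps_le: "\<epsilon> \<le> \<epsilon>\<^sub>0"
    and alpha_nonneg: "0 \<le> \<alpha>" and beta_nonneg: "0 \<le> \<beta>" and alpha_beta: "\<alpha> + \<beta> = 1"
begin

abbreviation X :: "'a set" where "X \<equiv> arena \<Omega> \<epsilon>\<^sub>0"
abbreviation \<Gamma> :: "'a set" where "\<Gamma> \<equiv> outer_strip \<Omega> \<epsilon>\<^sub>0"

lemma arena_eq: "X = {x. infdist x \<Omega> < \<epsilon>\<^sub>0}"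
  using eps_pos eps_le by (auto simp: arena_def outer_strip_def)

lemma open_arena: "open X"
  unfolding arena_eq by (intro open_Collect_less continuous_intros)

lemma arena_borel [measurable]: "X \<in> sets borel"
  using open_arena by simp

lemma domain_subset: "\<Omega> \<subseteq> X" and strip_eq: "\<Gamma> = X - \<Omega>"
  by (auto simp: arena_def outer_strip_def)

lemma domain_borel [measurable]: "\<Omega> \<in> sets borel"
  using open_domain by simp

lemma strip_borel [measurable]: "\<Gamma> \<in> sets borel"
  unfolding strip_eq by measurable

text \<open>
  This is where \<open>\<epsilon> \<le> \<epsilon>\<^sub>0\<close> matters: from a point of \<open>\<Omega>\<close> neither a player nor the noise leaves
  the arena.
\<close>
lemma ball_subset_arena: "x \<in> \<Omega> \<Longrightarrow> ball x \<epsilon> \<subseteq> X"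
  using eps_le by (auto simp: arena_eq dist_commute intro: le_less_trans[OF infdist_le])

lemma bounded_arena: "bounded X"
proof -
  obtain a where a: "a \<in> \<Omega>" using nonempty_domain by auto
  obtain R where R: "\<And>y. y \<in> \<Omega> \<Longrightarrow> dist a y \<le> R"
    using bounded_domain unfolding bounded_any_center[where a=a] by auto
  have "dist a x \<le> R + \<epsilon>\<^sub>0" if "x \<in> X" for x
  proof -
    from that have "infdist x \<Omega> < \<epsilon>\<^sub>0" by (simp add: arena_eq)
    then have "(INF a\<in>\<Omega>. dist x a) < \<epsilon>\<^sub>0" using nonempty_domain by (simp add: infdist_def)
    then obtain y where y: "y \<in> \<Omega>" "dist x y < \<epsilon>\<^sub>0"
      using nonempty_domain by (subst (asm) cINF_less_iff) auto
    have "dist a x \<le> dist a y + dist x y" by (metis dist_triangle dist_commute)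
    with R[OF y(1)] y(2) show ?thesis by linarith
  qed
  then show ?thesis unfolding bounded_any_center[where a=a] by blast
qed

section \<open>Averages over balls\<close>

lemma ball_measure_pos: "0 < measure lborel (ball (x::'a) \<epsilon>)"
  using eps_pos by (simp add: content_ball)

lemma emeasure_ball_eq: "emeasure lborel (ball (x::'a) \<epsilon>) = ennreal (measure lborel (ball x \<epsilon>))"
  using emeasure_lborel_ball_finite[of x \<epsilon>] by (intro emeasure_eq_ennreal_measure) auto

definition ball_mean :: "('a \<Rightarrow> real) \<Rightarrow> 'a \<Rightarrow> real" where
  "ball_mean f x = 1 / measure lborel (ball x \<epsilon>) * (LINT y:ball x \<epsilon>|lborel. f y)"

lemma set_integrable_ball:
  assumes "f \<in> borel_measurable borel" "\<And>y. \<bar>f y\<bar> \<le> C"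
  shows "set_integrable lborel (ball (x::'a) r) (f :: 'a \<Rightarrow> real)"
  unfolding set_integrable_def using assms emeasure_lborel_ball_finite[of x r]
  by (intro integrableI_bounded_set_indicator[where B=C]) auto

lemma ball_mean_add:
  assumes "set_integrable lborel (ball x \<epsilon>) f" "set_integrable lborel (ball x \<epsilon>) g"
  shows "ball_mean (\<lambda>y. f y + g y) x = ball_mean f x + ball_mean g x"
  using set_integral_add(2)[OF assms] by (simp add: ball_mean_def add_divide_distrib)

lemma ball_mean_cmult: "ball_mean (\<lambda>y. a * f y) x = a * ball_mean f x"
  by (simp add: ball_mean_def)

lemma ball_mean_const: "ball_mean (\<lambda>_. a) x = a"
  using ball_measure_pos[of x] by (simp add: ball_mean_def set_lebesgue_integral_def emeasure_ball_eq)

lemma ball_mean_mono: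
  assumes "set_integrable lborel (ball x \<epsilon>) f" "set_integrable lborel (ball x \<epsilon>) g"
    and "\<And>y. y \<in> ball x \<epsilon> \<Longrightarrow> f y \<le> g y"
  shows "ball_mean f x \<le> ball_mean g x"
  unfolding ball_mean_def using set_integral_mono[OF assms] by (intro mult_left_mono) auto

lemma ball_mean_cong: "(\<And>y. y \<in> ball x \<epsilon> \<Longrightarrow> f y = g y) \<Longrightarrow> ball_mean f x = ball_mean g x"
  using set_lebesgue_integral_cong[of "ball x \<epsilon>" lborel f g] by (simp add: ball_mean_def)

lemma nn_integral_uniform_ball:
  assumes f: "f \<in> borel_measurable borel" "\<And>y. 0 \<le> f y" "\<And>y. f y \<le> C"
  shows "(\<integral>\<^sup>+y. ennreal (f y) \<partial>uniform_measure lborel (ball x \<epsilon>)) = ennreal (ball_mean f x)"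
    and "0 \<le> ball_mean f x"
proof -
  have int: "set_integrable lborel (ball x \<epsilon>) f"
    using f by (intro set_integrable_ball[where C=C]) auto
  have n: "0 \<le> (LINT y:ball x \<epsilon>|lborel. f y)"
    unfolding set_lebesgue_integral_def using f(2) by (intro integral_nonneg_AE) auto
  have "(\<integral>\<^sup>+y. ennreal (f y) \<partial>uniform_measure lborel (ball x \<epsilon>)) =
      (\<integral>\<^sup>+y. ennreal (f y) * indicator (ball x \<epsilon>) y \<partial>lborel) / emeasure lborel (ball x \<epsilon>)"
    using f(1) by (intro nn_integral_uniform_measure) auto
  also have "(\<integral>\<^sup>+y. ennreal (f y) * indicator (ball x \<epsilon>) y \<partial>lborel) =
      (\<integral>\<^sup>+y. ennreal (indicator (ball x \<epsilon>) y *\<^sub>R f y) \<partial>lborel)"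
    by (intro nn_integral_cong) (auto split: split_indicator)
  also have "\<dots> = ennreal (LINT y:ball x \<epsilon>|lborel. f y)"
    using int f(2) unfolding set_integrable_def set_lebesgue_integral_def
    by (intro nn_integral_eq_integral) auto
  finally show "(\<integral>\<^sup>+y. ennreal (f y) \<partial>uniform_measure lborel (ball x \<epsilon>)) = ennreal (ball_mean f x)"
    using n ball_measure_pos[of x] by (simp add: emeasure_ball_eq ball_mean_def divide_ennreal)
  show "0 \<le> ball_mean f x" using n by (simp add: ball_mean_def)
qed

section \<open>Extrema over balls and Borel selection\<close>

lemma bdd_of_abs:
  assumes "\<And>y. \<bar>f y\<bar> \<le> (C::real)"
  shows "bdd_above (f ` A)" "bdd_below (f ` A)"
  using assms by (auto simp: abs_le_iff intro!: bdd_aboveI2[where M=C] bdd_belowI2[where m="-C"]) (smt (verit))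

lemma SUP_ball_upper: "(\<And>y. \<bar>f y\<bar> \<le> (C::real)) \<Longrightarrow> y \<in> ball x \<epsilon> \<Longrightarrow> f y \<le> (SUP y\<in>ball x \<epsilon>. f y)"
  by (intro cSUP_upper bdd_of_abs(1))

lemma INF_ball_lower: "(\<And>y. \<bar>f y\<bar> \<le> (C::real)) \<Longrightarrow> y \<in> ball x \<epsilon> \<Longrightarrow> (INF y\<in>ball x \<epsilon>. f y) \<le> f y"
  by (intro cINF_lower bdd_of_abs(2))

lemma ball_nonempty: "ball x \<epsilon> \<noteq> {}"
  using eps_pos by simp

lemma SUP_ball_least: "(\<And>y. y \<in> ball x \<epsilon> \<Longrightarrow> f y \<le> (M::real)) \<Longrightarrow> (SUP y\<in>ball x \<epsilon>. f y) \<le> M"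
  by (intro cSUP_least ball_nonempty)

lemma INF_ball_greatest: "(\<And>y. y \<in> ball x \<epsilon> \<Longrightarrow> (M::real) \<le> f y) \<Longrightarrow> M \<le> (INF y\<in>ball x \<epsilon>. f y)"
  by (intro cINF_greatest ball_nonempty)

lemma INF_ball_eq: "(INF y\<in>ball x \<epsilon>. (f y::real)) = - (SUP y\<in>ball x \<epsilon>. - f y)"
  by (simp add: Inf_real_def image_image)

lemma less_SUP_ball:
  "(\<And>y. \<bar>f y\<bar> \<le> (C::real)) \<Longrightarrow> a < (SUP y\<in>ball x \<epsilon>. f y) \<longleftrightarrow> (\<exists>y\<in>ball x \<epsilon>. a < f y)"
  by (intro less_cSUP_iff ball_nonempty bdd_of_abs(1))

text \<open>
  The supremum exceeds \<open>a\<close> exactly at the points within \<open>\<epsilon>\<close> of some \<open>y\<close> with \<open>f y > a\<close>, and a union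
  of open balls is open, whatever \<open>f\<close> is.
\<close>
lemma measurable_SUP_ball:
  assumes "\<And>y. \<bar>f y\<bar> \<le> (C::real)"
  shows "(\<lambda>x. SUP y\<in>ball x \<epsilon>. f y) \<in> borel_measurable (borel :: 'a measure)"
proof (subst borel_measurable_iff_greater, intro allI)
  fix a
  have "{x. a < (SUP y\<in>ball x \<epsilon>. f y)} = (\<Union>y\<in>{y. a < f y}. ball y \<epsilon>)"
    using less_SUP_ball[where f=f, OF assms] by (auto simp: dist_commute)
  moreover have "open (\<Union>y\<in>{y. a < f y}. ball y \<epsilon>)" by auto
  ultimately show "{x \<in> space borel. a < (SUP y\<in>ball x \<epsilon>. f y)} \<in> sets borel" by simp
qed

lemma measurable_INF_ball:
  assumes "\<And>y. \<bar>f y\<bar> \<le> (C::real)"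
  shows "(\<lambda>x. INF y\<in>ball x \<epsilon>. f y) \<in> borel_measurable (borel :: 'a measure)"
  unfolding INF_ball_eq using assms by (intro borel_measurable_uminus measurable_SUP_ball[where C=C]) simp

lemma measurable_ball_mean:
  assumes [measurable]: "f \<in> borel_measurable borel"
  shows "ball_mean f \<in> borel_measurable borel"
proof -
  define d where "d = measure lborel (ball (0::'a) \<epsilon>)"
  have m: "measure lborel (ball x \<epsilon>) = d" for x :: 'a
    using eps_pos by (simp add: content_ball d_def)
  have "(\<lambda>x. \<integral>y. (if dist x y < \<epsilon> then f y else 0) \<partial>lborel) \<in> borel_measurable borel"
    by (rule lborel.borel_measurable_lebesgue_integral) measurable
  also have "(\<lambda>x. \<integral>y. (if dist x y < \<epsilon> then f y else 0) \<partial>lborel) = (\<lambda>x. LINT y:ball x \<epsilon>|lborel. f y)"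
    unfolding set_lebesgue_integral_def
    by (intro ext Bochner_Integration.integral_cong) (auto split: split_indicator)
  finally show ?thesis unfolding ball_mean_def[abs_def] m by measurable
qed

text \<open>
  For every rational \<open>q\<close> the balls around the points where \<open>f > q\<close> have a countable subfamily with the
  same union. The centres of these subfamilies form one countable set in which every ball contains an
  almost maximal point of \<open>f\<close>; taking the first such point in an enumeration is a Borel choice.
\<close>
lemma near_sup_selector:
  assumes f: "\<And>y. \<bar>f y\<bar> \<le> (C::real)" and W: "W \<in> sets borel" "W \<subseteq> \<Omega>" and \<eta>: "0 < \<eta>"
  obtains s where "s \<in> borel \<rightarrow>\<^sub>M borel" "\<And>x. x \<in> X \<Longrightarrow> s x \<in> ball x \<epsilon> \<inter> X"
    "\<And>x. x \<in> W \<Longrightarrow> (SUP y\<in>ball x \<epsilon>. f y) - \<eta> \<le> f (s x)"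
proof -
  have "\<forall>q. \<exists>Y. countable Y \<and> Y \<subseteq> {y. q < f y} \<and> (\<Union>y\<in>Y. ball y \<epsilon>) = (\<Union>y\<in>{y. q < f y}. ball y \<epsilon>)"
  proof
    fix q
    let ?F = "(\<lambda>y. ball y \<epsilon>) ` {y. q < f y}"
    obtain F' where F': "F' \<subseteq> ?F" "countable F'" "\<Union>F' = \<Union>?F"
      by (rule Lindelof[of ?F]) auto
    then obtain Y where "countable Y" "Y \<subseteq> {y. q < f y}" "F' = (\<lambda>y. ball y \<epsilon>) ` Y"
      using countable_subset_image[of F' "\<lambda>y. ball y \<epsilon>" "{y. q < f y}"] by auto
    with F'(3) show "\<exists>Y. countable Y \<and> Y \<subseteq> {y. q < f y} \<and> (\<Union>y\<in>Y. ball y \<epsilon>) = (\<Union>y\<in>{y. q < f y}. ball y \<epsilon>)"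
      by (intro exI[of _ Y]) simp
  qed
  from choice[OF this] obtain Y where "\<forall>q. countable (Y q) \<and> Y q \<subseteq> {y. q < f y} \<and>
    (\<Union>y\<in>Y q. ball y \<epsilon>) = (\<Union>y\<in>{y. q < f y}. ball y \<epsilon>)" by blast
  then have Y: "countable (Y q)" "Y q \<subseteq> {y. q < f y}"
    "(\<Union>y\<in>Y q. ball y \<epsilon>) = (\<Union>y\<in>{y. q < f y}. ball y \<epsilon>)" for q by auto
  define Z where "Z = (\<Union>q\<in>\<rat>. Y q)"
  have Z: "countable Z" unfolding Z_def using Y(1) countable_rat by blast
  have ex: "\<exists>z\<in>Z. dist x z < \<epsilon> \<and> (SUP y\<in>ball x \<epsilon>. f y) - \<eta> < f z" for x
  proof -
    obtain q where q: "q \<in> \<rat>" "(SUP y\<in>ball x \<epsilon>. f y) - \<eta> < q" "q < (SUP y\<in>ball x \<epsilon>. f y)"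
      using Rats_dense_in_real[of "(SUP y\<in>ball x \<epsilon>. f y) - \<eta>" "SUP y\<in>ball x \<epsilon>. f y"] \<eta> by auto
    obtain y where "y \<in> ball x \<epsilon>" "q < f y" using q(3) less_SUP_ball[where f=f, OF f] by blast
    then have "x \<in> (\<Union>y\<in>{y. q < f y}. ball y \<epsilon>)" by (auto simp: dist_commute)
    then obtain z where "z \<in> Y q" "dist z x < \<epsilon>" unfolding Y(3)[symmetric] by auto
    with q Y(2)[of q] show ?thesis unfolding Z_def by (force simp: dist_commute)
  qed
  then have "Z \<noteq> {}" by blast
  define e where "e = from_nat_into Z"
  have e: "\<exists>n. e n = z" if "z \<in> Z" for z
    using from_nat_into_surj[OF Z that] by (simp add: e_def)
  define P where "P x n \<longleftrightarrow> dist x (e n) < \<epsilon> \<and> (SUP y\<in>ball x \<epsilon>. f y) - \<eta> < f (e n)" for x n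
  define N where "N x = (LEAST n. P x n)" for x
  have PN: "P x (N x)" for x
  proof -
    obtain z where "z \<in> Z" "dist x z < \<epsilon>" "(SUP y\<in>ball x \<epsilon>. f y) - \<eta> < f z" using ex by blast
    with e[of z] have "\<exists>n. P x n" unfolding P_def by auto
    then show ?thesis unfolding N_def by (rule LeastI_ex)
  qed
  note measurable_SUP_ball[where f=f, OF f, measurable]
  have "(\<lambda>x. P x n) \<in> borel \<rightarrow>\<^sub>M count_space UNIV" for n
    unfolding P_def by measurable
  then have N: "N \<in> borel \<rightarrow>\<^sub>M count_space UNIV"
    unfolding N_def[abs_def] by (rule measurable_Least)
  have "(\<lambda>x. e (N x)) \<in> borel \<rightarrow>\<^sub>M borel"
    by (rule measurable_compose[OF N]) simp
  \<comment> \<open>Outside \<open>W\<close> the ball may leave the arena; staying put is always a legal move.\<close>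
  then have "(\<lambda>x. if x \<in> W then e (N x) else x) \<in> borel \<rightarrow>\<^sub>M borel"
    using W(1) by measurable
  moreover have "(if x \<in> W then e (N x) else x) \<in> ball x \<epsilon> \<inter> X" if "x \<in> X" for x
    using PN[of x] W(2) ball_subset_arena[of x] that eps_pos by (auto simp: P_def subset_iff)
  moreover have "(SUP y\<in>ball x \<epsilon>. f y) - \<eta> \<le> f (if x \<in> W then e (N x) else x)" if "x \<in> W" for x
    using PN[of x] that by (simp add: P_def)
  ultimately show ?thesis by (rule that)
qed

text \<open>
  The right-hand side of the dynamic programming equation without the obstacle.
\<close>
definition dpp_op :: "('a \<Rightarrow> real) \<Rightarrow> 'a \<Rightarrow> real" where
  "dpp_op u x = \<alpha> / 2 * (SUP y\<in>ball x \<epsilon>. u y) + \<alpha> / 2 * (INF y\<in>ball x \<epsilon>. u y) + \<beta> * ball_mean u x"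

lemma alpha_le_1: "\<alpha> \<le> 1" and beta_le_1: "\<beta> \<le> 1"
  using alpha_nonneg beta_nonneg alpha_beta by auto

section \<open>Strict subsolutions\<close>

lemma bounded_coordinate:
  obtains R where "0 < R" "\<And>y e. y \<in> X \<Longrightarrow> norm e = 1 \<Longrightarrow> \<bar>y \<bullet> e\<bar> \<le> R"
proof -
  obtain R where R: "0 < R" "\<And>y. y \<in> X \<Longrightarrow> norm y \<le> R"
    using bounded_arena unfolding bounded_pos by auto
  have "\<bar>y \<bullet> e\<bar> \<le> R" if "y \<in> X" "norm e = 1" for y e
    using Cauchy_Schwarz_ineq2[of y e] R(2)[OF that(1)] that(2) by simp
  with R(1) that show ?thesis by blast
qed

text \<open>
  The potential is \<open>exp (K * (y \<bullet> e))\<close> for a unit vector \<open>e\<close>. A fixed fraction of the ball around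
  \<open>x\<close> consists of points \<open>y\<close> with \<open>y \<bullet> e \<ge> x \<bullet> e + \<epsilon> / 2\<close>, where the potential is larger by the factor
  \<open>exp (K * \<epsilon> / 2)\<close>. For large \<open>K\<close> this part of the average alone is twice the value at \<open>x\<close>, so the
  estimate survives even if both players move to points where the potential is \<open>0\<close>.
\<close>
lemma noise_potential:
  assumes "0 < \<beta>"
  obtains \<phi> B c where "\<phi> \<in> borel_measurable borel" "\<And>y. 0 \<le> \<phi> y" "\<And>y. \<phi> y \<le> B" "0 < c"
    "\<And>x. x \<in> \<Omega> \<Longrightarrow> \<phi> x + c \<le> \<beta> * ball_mean \<phi> x"
proof -
  obtain e :: 'a where e: "norm e = 1" using vector_choose_size[of 1] by auto
  then have ee: "e \<bullet> e = 1" by (simp add: norm_eq_1)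
  obtain R where R: "0 < R" "\<And>y. y \<in> X \<Longrightarrow> \<bar>y \<bullet> e\<bar> \<le> R" using bounded_coordinate e by metis
  \<comment> \<open>The probability that noise moves the token from \<open>x\<close> into the ball of radius \<open>\<epsilon> / 4\<close> around \<open>x + (3 / 4 * \<epsilon>) *\<^sub>R e\<close>.\<close>
  define k where "k = \<beta> * (1 / 4) ^ DIM('a)"
  have k: "0 < k" "k \<le> 1"
    using assms beta_le_1 by (auto simp: k_def intro!: mult_le_one power_le_one)
  \<comment> \<open>Chosen so that this probability times the gain of the potential is exactly \<open>2\<close>.\<close>
  define K where "K = 2 / \<epsilon> * ln (2 / k)"
  have K: "0 \<le> K" "k * exp (K * (\<epsilon> / 2)) = 2"
    using k eps_pos by (auto simp: K_def exp_ln)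
  define \<phi> where "\<phi> y = (if y \<in> X then exp (K * (y \<bullet> e)) else 0)" for y
  have \<phi>m: "\<phi> \<in> borel_measurable borel" unfolding \<phi>_def[abs_def] by measurable
  have \<phi>0: "0 \<le> \<phi> y" for y by (simp add: \<phi>_def)
  have \<phi>B: "\<phi> y \<le> exp (K * R)" for y
    using R(2)[of y] K(1) by (auto simp: \<phi>_def abs_le_iff intro!: mult_left_mono)
  have drift: "\<phi> x + exp (- (K * R)) \<le> \<beta> * ball_mean \<phi> x" if x: "x \<in> \<Omega>" for x
  proof -
    let ?z = "x + (3 / 4 * \<epsilon>) *\<^sub>R e"
    let ?a = "exp (K * (x \<bullet> e + \<epsilon> / 2))"
    have xX: "x \<in> X" using x domain_subset by auto
    have sub: "ball ?z (\<epsilon> / 4) \<subseteq> ball x \<epsilon>"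
    proof
      fix y assume "y \<in> ball ?z (\<epsilon> / 4)"
      moreover have "dist x ?z = 3 / 4 * \<epsilon>" using e eps_pos by (simp add: dist_norm)
      ultimately show "y \<in> ball x \<epsilon>" using dist_triangle[of x y ?z] by simp
    qed
    have low: "?a \<le> \<phi> y" if y: "y \<in> ball ?z (\<epsilon> / 4)" for y
    proof -
      have "\<bar>(y - ?z) \<bullet> e\<bar> \<le> norm (y - ?z)"
        using Cauchy_Schwarz_ineq2[of "y - ?z" e] e by simp
      also have "\<dots> < \<epsilon> / 4" using y by (simp add: dist_norm norm_minus_commute)
      finally have "\<bar>y \<bullet> e - (x \<bullet> e + 3 / 4 * \<epsilon>)\<bar> < \<epsilon> / 4"
        using ee by (simp add: inner_diff_left inner_add_left)
      then have "x \<bullet> e + \<epsilon> / 2 \<le> y \<bullet> e" by linarith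
      then have "K * (x \<bullet> e + \<epsilon> / 2) \<le> K * (y \<bullet> e)" using K(1) by (rule mult_left_mono)
      moreover have "y \<in> X" using sub y ball_subset_arena[OF x] by auto
      ultimately show ?thesis by (simp add: \<phi>_def)
    qed
    let ?g = "\<lambda>y. indicator (ball ?z (\<epsilon> / 4)) y * ?a"
    have "ball_mean ?g x = ?a * (1 / 4) ^ DIM('a)"
    proof -
      have "(LINT y:ball x \<epsilon>|lborel. ?g y) = (LINT y|lborel. indicator (ball ?z (\<epsilon> / 4)) y * ?a)"
        unfolding set_lebesgue_integral_def
        using sub by (intro Bochner_Integration.integral_cong) (auto split: split_indicator)
      also have "\<dots> = measure lborel (ball ?z (\<epsilon> / 4)) * ?a"
        using emeasure_lborel_ball_finite[of ?z "\<epsilon> / 4"] by simp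
      finally show ?thesis
        using eps_pos less_imp_neq[OF unit_ball_vol_pos[of "real DIM('a)"], symmetric]
        by (simp add: ball_mean_def content_ball power_divide)
    qed
    moreover have "ball_mean ?g x \<le> ball_mean \<phi> x"
    proof (rule ball_mean_mono)
      show "set_integrable lborel (ball x \<epsilon>) ?g"
      proof (rule set_integrable_ball)
        show "?g \<in> borel_measurable borel"
          by (intro borel_measurable_times borel_measurable_indicator borel_measurable_const) simp
        show "\<bar>?g y\<bar> \<le> ?a" for y by (simp add: indicator_def)
      qed
      show "set_integrable lborel (ball x \<epsilon>) \<phi>"
        using \<phi>0 \<phi>B by (intro set_integrable_ball[where C="exp (K * R)"] \<phi>m) simp
    qed (use low \<phi>0 in \<open>auto split: split_indicator\<close>)
    ultimately have "?a * (1 / 4) ^ DIM('a) \<le> ball_mean \<phi> x" by simp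
    then have "\<beta> * (?a * (1 / 4) ^ DIM('a)) \<le> \<beta> * ball_mean \<phi> x"
      using beta_nonneg by (rule mult_left_mono)
    moreover have "\<beta> * (?a * (1 / 4) ^ DIM('a)) = 2 * \<phi> x"
      using K(2) xX by (simp add: k_def \<phi>_def distrib_left exp_add mult_ac)
    moreover have "exp (- (K * R)) \<le> \<phi> x"
      using R(2)[OF xX] K(1) mult_left_mono[of "- R" "x \<bullet> e" K] xX by (auto simp: \<phi>_def abs_le_iff)
    ultimately show ?thesis by simp
  qed
  show ?thesis by (rule that[OF \<phi>m \<phi>0 \<phi>B exp_gt_zero drift])
qed

text \<open>
  The player who moves by \<open>s\<close> makes \<open>v\<close> grow by \<open>c\<close> in expectation at every point of \<open>W\<close>, against every
  move \<open>y\<close> of the opponent. The transition is symmetric in the two moves, so this may be either of the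
  players, and one construction serves both.
\<close>
definition strict_subsolution where
  "strict_subsolution W v s c \<longleftrightarrow> v \<in> borel_measurable borel \<and> (\<exists>D. \<forall>y. \<bar>v y\<bar> \<le> D) \<and>
     s \<in> borel \<rightarrow>\<^sub>M borel \<and> (\<forall>x\<in>X. s x \<in> ball x \<epsilon> \<inter> X) \<and> 0 < c \<and>
     (\<forall>x\<in>W. \<forall>y\<in>ball x \<epsilon>. v x + c \<le> \<alpha> / 2 * v (s x) + \<alpha> / 2 * v y + \<beta> * ball_mean v x)"

text \<open>
  The drift \<open>k * c\<close> of the added potential pays for the error \<open>k * c\<close> that the almost optimal move may
  make, since the latter is only taken with probability \<open>\<alpha> / 2 \<le> 1 / 2\<close>.
\<close>
lemma strict_subsolution_noise:
  assumes "0 < \<beta>" and w: "w \<in> borel_measurable borel" "\<And>y. \<bar>w y\<bar> \<le> C"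
    and W: "W \<in> sets borel" "W \<subseteq> \<Omega>" and sub: "\<And>x. x \<in> W \<Longrightarrow> w x \<le> dpp_op w x" and \<eta>: "0 < \<eta>"
  shows "\<exists>v s c. strict_subsolution W v s c \<and> (\<forall>y. \<bar>v y - w y\<bar> \<le> \<eta>)"
proof -
  obtain \<phi> B c where \<phi>: "\<phi> \<in> borel_measurable borel" "\<And>y. 0 \<le> \<phi> y" "\<And>y. \<phi> y \<le> B" "0 < c"
    "\<And>x. x \<in> \<Omega> \<Longrightarrow> \<phi> x + c \<le> \<beta> * ball_mean \<phi> x" using noise_potential[OF assms(1)] by metis
  have B: "0 \<le> B" using \<phi>(2,3) order_trans by blast
  define k where "k = \<eta> / (B + 1)"
  have k: "0 < k" "k * B \<le> \<eta>" using \<eta> B by (auto simp: k_def field_simps)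
  define v where "v y = w y + k * \<phi> y" for y
  obtain s where s: "s \<in> borel \<rightarrow>\<^sub>M borel" "\<And>x. x \<in> X \<Longrightarrow> s x \<in> ball x \<epsilon> \<inter> X"
    "\<And>x. x \<in> W \<Longrightarrow> (SUP y\<in>ball x \<epsilon>. w y) - k * c \<le> w (s x)"
    using near_sup_selector[where f=w, OF w(2) W, of "k * c"] k \<phi>(4) by (metis mult_pos_pos)
  have k\<phi>: "0 \<le> k * \<phi> y" "k * \<phi> y \<le> \<eta>" for y
    using k \<phi>(2)[of y] order_trans[OF mult_left_mono[OF \<phi>(3)[of y], of k] k(2)] by auto
  have mean: "ball_mean v x = ball_mean w x + k * ball_mean \<phi> x" for x
  proof -
    have "set_integrable lborel (ball x \<epsilon>) (\<lambda>y. k * \<phi> y)"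
      using \<phi>(1) k\<phi> by (intro set_integrable_ball[where C=\<eta>]) auto
    then show ?thesis
      unfolding v_def using ball_mean_add[OF set_integrable_ball[where f=w, OF w]] ball_mean_cmult by simp
  qed
  have "v x + k * c / 2 \<le> \<alpha> / 2 * v (s x) + \<alpha> / 2 * v y + \<beta> * ball_mean v x"
    if x: "x \<in> W" and y: "y \<in> ball x \<epsilon>" for x y
  proof -
    have 1: "\<alpha> / 2 * ((SUP y\<in>ball x \<epsilon>. w y) - k * c) \<le> \<alpha> / 2 * w (s x)"
      using s(3)[OF x] alpha_nonneg by (intro mult_left_mono) auto
    have 2: "\<alpha> / 2 * (INF y\<in>ball x \<epsilon>. w y) \<le> \<alpha> / 2 * w y"
      using INF_ball_lower[where f=w, OF w(2) y] alpha_nonneg by (intro mult_left_mono) auto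
    have 3: "k * (\<phi> x + c) \<le> k * (\<beta> * ball_mean \<phi> x)"
      using \<phi>(5)[of x] x W(2) k by (intro mult_left_mono) auto
    have 4: "0 \<le> \<alpha> / 2 * (k * \<phi> (s x))" "0 \<le> \<alpha> / 2 * (k * \<phi> y)" using k\<phi> alpha_nonneg by auto
    have 5: "\<alpha> / 2 * (k * c) \<le> 1 / 2 * (k * c)" using alpha_le_1 k \<phi>(4) by (intro mult_right_mono) auto
    have "\<alpha> / 2 * v (s x) + \<alpha> / 2 * v y + \<beta> * ball_mean v x =
      (\<alpha> / 2 * w (s x) + \<alpha> / 2 * w y + \<beta> * ball_mean w x) +
      (\<alpha> / 2 * (k * \<phi> (s x)) + \<alpha> / 2 * (k * \<phi> y) + k * (\<beta> * ball_mean \<phi> x))"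
      by (simp add: v_def mean algebra_simps)
    then show ?thesis
      using 1 2 3 4 5 sub[OF x] by (simp add: v_def dpp_op_def algebra_simps)
  qed
  moreover have "\<bar>v y\<bar> \<le> C + \<eta>" for y
    using w(2)[of y] k\<phi>[of y] by (simp add: v_def)
  moreover have "v \<in> borel_measurable borel" unfolding v_def[abs_def] using w(1) \<phi>(1) by measurable
  ultimately have "strict_subsolution W v s (k * c / 2)"
    using s k \<phi>(4) unfolding strict_subsolution_def by auto
  moreover have "\<bar>v y - w y\<bar> \<le> \<eta>" for y using k\<phi>[of y] by (simp add: v_def)
  ultimately show ?thesis by blast
qed

text \<open>
  A bounded domain is left after a fixed number of equal steps in one direction.
\<close>
lemma escape_steps:
  obtains N :: nat and p :: 'a where "norm p < \<epsilon>" "\<And>x. x \<in> \<Omega> \<Longrightarrow> x + real N *\<^sub>R p \<notin> \<Omega>"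
proof -
  obtain e :: 'a where e: "norm e = 1" using vector_choose_size[of 1] by auto
  obtain R where R: "0 < R" "\<And>y. y \<in> X \<Longrightarrow> \<bar>y \<bullet> e\<bar> \<le> R" using bounded_coordinate e by metis
  obtain N where N: "2 * R < real N * (\<epsilon> / 2)" using ex_less_of_nat_mult[of "\<epsilon> / 2" "2 * R"] eps_pos by auto
  have "x + real N *\<^sub>R ((\<epsilon> / 2) *\<^sub>R e) \<notin> \<Omega>" if "x \<in> \<Omega>" for x
  proof
    assume "x + real N *\<^sub>R ((\<epsilon> / 2) *\<^sub>R e) \<in> \<Omega>"
    then have "\<bar>(x + real N *\<^sub>R ((\<epsilon> / 2) *\<^sub>R e)) \<bullet> e\<bar> \<le> R" "\<bar>x \<bullet> e\<bar> \<le> R"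
      using R(2) that domain_subset by blast+
    moreover have "e \<bullet> e = 1" using e by (simp add: norm_eq_1)
    ultimately show False using N by (simp add: inner_add_left abs_le_iff)
  qed
  moreover have "norm ((\<epsilon> / 2) *\<^sub>R e) < \<epsilon>" using e eps_pos by simp
  ultimately show ?thesis using that by blast
qed

text \<open>
  Let \<open>V\<close> be the part of \<open>W\<close> where the supremum of \<open>w\<close> over the ball exceeds \<open>w\<close> by at most \<open>d\<close>. The
  subsolution property forces \<open>w\<close> to change by at most \<open>d\<close> in a step that starts in \<open>V\<close>. Let \<open>w' x\<close> be the supremum of
  \<open>w y - d * n\<close> over all points \<open>y\<close> outside \<open>V\<close> that are reached from \<open>x\<close> in \<open>n\<close> steps of which each
  starts in \<open>V\<close>. Along such a path \<open>w\<close> changes by at most \<open>d * n\<close>, so \<open>w' \<le> w\<close>; and as \<open>N\<close> equal steps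
  lead out of \<open>\<Omega>\<close>, \<open>w'\<close> is at most \<open>2 * N * d\<close> below \<open>w\<close>. On \<open>V\<close> the first step of a path shows that
  its supremum over the ball is exactly \<open>w' x + d\<close>; and \<open>w'\<close> falls by at most \<open>d\<close>, at a point of \<open>V\<close>
  because a path from there may begin by going back to \<open>x\<close>, at other points because \<open>w\<close> does. If \<open>x\<close> is
  not in \<open>V\<close>, the points where \<open>w\<close> almost attains its supremum are not in \<open>V\<close> either, so the supremum
  of \<open>w'\<close> is at least that of \<open>w\<close>, which is above \<open>w x + d\<close>; and going back to \<open>x\<close> shows that the infimum
  of \<open>w'\<close> drops below that of \<open>w\<close> at most to \<open>w x - d\<close>.
\<close>
lemma steepening:
  fixes w :: "'a \<Rightarrow> real" and d :: real
  assumes w: "w \<in> borel_measurable borel" "\<And>y. \<bar>w y\<bar> \<le> C"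
    and W: "W \<in> sets borel" "W \<subseteq> \<Omega>"
    and sub: "\<And>x. x \<in> W \<Longrightarrow> 2 * w x \<le> (SUP y\<in>ball x \<epsilon>. w y) + (INF y\<in>ball x \<epsilon>. w y)"
    and escape: "norm p < \<epsilon>" "\<And>x. x \<in> \<Omega> \<Longrightarrow> x + real N *\<^sub>R p \<notin> \<Omega>"
    and d: "0 < d"
  shows "\<exists>w'. w' \<in> borel_measurable borel \<and> (\<forall>y. \<bar>w' y - w y\<bar> \<le> 2 * real N * d) \<and>
    (\<forall>x\<in>W. w' x + d \<le> (SUP y\<in>ball x \<epsilon>. w' y) \<and>
       2 * w' x \<le> (SUP y\<in>ball x \<epsilon>. w' y) + (INF y\<in>ball x \<epsilon>. w' y))"
proof -
  define S where "S x = (SUP y\<in>ball x \<epsilon>. w y)" for x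
  define I where "I x = (INF y\<in>ball x \<epsilon>. w y)" for x
  define V where "V = {x \<in> W. S x - w x \<le> d}"
  define R where "R = {(x, y). x \<in> V \<and> y \<in> ball x \<epsilon>}"
  define K where "K x = {w y - d * real n | n y. (x, y) \<in> R ^^ n \<and> y \<notin> V}" for x
  define w' where "w' x = Sup (K x)" for x
  have S: "w y \<le> S x" and I: "I x \<le> w y" if "y \<in> ball x \<epsilon>" for x y
    unfolding S_def I_def
    using SUP_ball_upper[where f=w, OF w(2) that] INF_ball_lower[where f=w, OF w(2) that] by auto
  have SI: "2 * w x \<le> S x + I x" if "x \<in> W" for x
    using sub[OF that] by (simp add: S_def I_def)
  have osc: "\<bar>w y - w x\<bar> \<le> d" if "(x, y) \<in> R" for x y
    using that S[of y x] I[of y x] SI[of x] by (auto simp: R_def V_def)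
  have path_osc: "\<bar>w y - w x\<bar> \<le> d * real n" if "(x, y) \<in> R ^^ n" for x y n
    using that
  proof (induction n arbitrary: y)
    case (Suc n)
    then obtain z where "(x, z) \<in> R ^^ n" "(z, y) \<in> R" by auto
    with Suc.IH[of z] osc[of z y] show ?case by (simp add: algebra_simps)
  qed simp
  have K_upper: "k \<le> w x" if "k \<in> K x" for k x
    using that path_osc unfolding K_def by (force simp: abs_le_iff)
  have line: "(\<exists>m<n. \<exists>y. (x, y) \<in> R ^^ m \<and> y \<notin> V) \<or> (x, x + real n *\<^sub>R p) \<in> R ^^ n" for x n
  proof (induction n)
    case (Suc n)
    show ?case
    proof (cases "(x, x + real n *\<^sub>R p) \<in> R ^^ n \<and> x + real n *\<^sub>R p \<in> V")
      case True
      then have "(x + real n *\<^sub>R p, x + real (Suc n) *\<^sub>R p) \<in> R"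
        using escape(1) by (simp add: R_def dist_norm algebra_simps)
      with True show ?thesis by auto
    next
      case False
      with Suc show ?thesis using less_Suc_eq by blast
    qed
  qed simp
  have exit: "\<exists>m\<le>N. \<exists>y. (x, y) \<in> R ^^ m \<and> y \<notin> V" for x
  proof (cases "x \<in> V")
    case True
    then have "x \<in> \<Omega>" using W(2) by (auto simp: V_def)
    then have "x + real N *\<^sub>R p \<notin> V" using escape(2) W(2) by (auto simp: V_def)
    with line[of N x] show ?thesis by (meson less_imp_le order_refl)
  next
    case False
    then show ?thesis by (intro exI[of _ 0]) auto
  qed
  have K_low: "\<exists>k\<in>K x. w x - 2 * real N * d \<le> k" for x
  proof -
    obtain m y where m: "m \<le> N" "(x, y) \<in> R ^^ m" "y \<notin> V" using exit[of x] by blast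
    have "w x - 2 * real N * d \<le> w y - d * m"
    proof -
      have "d * real m \<le> d * real N" using d m(1) by simp
      then show ?thesis using path_osc[OF m(2)] by (simp add: abs_le_iff algebra_simps)
    qed
    with m show ?thesis unfolding K_def by blast
  qed
  have K_ne: "K x \<noteq> {}" for x using K_low by blast
  have K_bdd: "bdd_above (K x)" for x by (rule bdd_aboveI) (rule K_upper)
  have w'_upper: "w' x \<le> w x" for x unfolding w'_def using K_ne K_upper by (rule cSup_least)
  have w'_lower: "w x - 2 * real N * d \<le> w' x" for x
    unfolding w'_def using K_low[of x] cSup_upper[OF _ K_bdd] order_trans by blast
  have w'_off: "w' x = w x" if "x \<notin> V" for x
  proof -
    have "w x \<in> K x" unfolding K_def using that by (force intro: exI[of _ 0])
    then have "w x \<le> w' x" unfolding w'_def by (rule cSup_upper[OF _ K_bdd])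
    with w'_upper[of x] show ?thesis by simp
  qed
  have w'_step: "w' y - d \<le> w' x" if xy: "(x, y) \<in> R" for x y
  proof -
    have "w' y \<le> w' x + d"
      unfolding w'_def[of y]
    proof (rule cSup_least[OF K_ne])
      fix k assume "k \<in> K y"
      then obtain n z where k: "k = w z - d * real n" "(y, z) \<in> R ^^ n" "z \<notin> V" unfolding K_def by blast
      have "(x, z) \<in> R ^^ Suc n" using xy k(2) by (rule relpow_Suc_I2)
      then have "w z - d * real (Suc n) \<in> K x" unfolding K_def using k(3) by blast
      then have "w z - d * real (Suc n) \<le> w' x" unfolding w'_def by (rule cSup_upper[OF _ K_bdd])
      then show "k \<le> w' x + d" by (simp add: k(1) algebra_simps)
    qed
    then show ?thesis by simp
  qed
  have w'_bound: "\<bar>w' y\<bar> \<le> C + 2 * real N * d" for y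
  proof -
    have "0 \<le> 2 * real N * d" using d by simp
    then show ?thesis using w'_upper[of y] w'_lower[of y] w(2)[of y] by linarith
  qed
  define S' where "S' x = (SUP y\<in>ball x \<epsilon>. w' y)" for x
  have S': "w' y \<le> S' x" if "y \<in> ball x \<epsilon>" for x y
    unfolding S'_def by (rule SUP_ball_upper[where f=w', OF w'_bound that])
  \<comment> \<open>On \<open>V\<close>, one step of the optimisation; it also shows that \<open>w'\<close> is Borel, although it is defined through uncountably many paths.\<close>
  have w'_on: "w' x = S' x - d" if x: "x \<in> V" for x
  proof (rule antisym)
    show "w' x \<le> S' x - d"
      unfolding w'_def[of x]
    proof (rule cSup_least[OF K_ne])
      fix k assume "k \<in> K x"
      then obtain n y where k: "k = w y - d * real n" "(x, y) \<in> R ^^ n" "y \<notin> V" unfolding K_def by blast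
      with x obtain m where m: "n = Suc m" by (cases n) auto
      with k(2) obtain z where z: "(x, z) \<in> R" "(z, y) \<in> R ^^ m" using relpow_Suc_D2 by metis
      then have "w y - d * real m \<in> K z" unfolding K_def using k(3) by blast
      then have "w y - d * real m \<le> w' z" unfolding w'_def by (rule cSup_upper[OF _ K_bdd])
      also have "w' z \<le> S' x" using z(1) by (intro S') (auto simp: R_def)
      finally show "k \<le> S' x - d" by (simp add: k(1) m algebra_simps)
    qed
    have "S' x \<le> w' x + d"
      unfolding S'_def
    proof (rule SUP_ball_least)
      fix y assume "y \<in> ball x \<epsilon>"
      then show "w' y \<le> w' x + d" using w'_step[of x y] x by (simp add: R_def)
    qed
    then show "S' x - d \<le> w' x" by simp
  qed
  have V: "V \<in> sets borel"
  proof -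
    note measurable_SUP_ball[where f=w, OF w(2), measurable] and w(1)[measurable] and W(1)[measurable]
    show ?thesis unfolding V_def S_def by measurable
  qed
  have w'm: "w' \<in> borel_measurable borel"
  proof -
    have "w' = (\<lambda>x. if x \<in> V then S' x - d else w x)" using w'_on w'_off by auto
    moreover note measurable_SUP_ball[where f=w', OF w'_bound, folded S'_def, measurable]
      and w(1)[measurable] and V[measurable]
    ultimately show ?thesis by simp
  qed
  have "w' x + d \<le> S' x \<and> 2 * w' x \<le> S' x + (INF y\<in>ball x \<epsilon>. w' y)" if x: "x \<in> W" for x
  proof (cases "x \<in> V")
    case True
    have "w' x - d \<le> (INF y\<in>ball x \<epsilon>. w' y)"
    proof (rule INF_ball_greatest)
      fix y assume y: "y \<in> ball x \<epsilon>"
      show "w' x - d \<le> w' y"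
      proof (cases "y \<in> V")
        case yV: True
        with y have "(y, x) \<in> R" by (simp add: R_def dist_commute)
        then show ?thesis by (rule w'_step)
      next
        case False
        have "(x, y) \<in> R" using True y by (simp add: R_def)
        then show ?thesis using osc w'_upper[of x] w'_off[OF False] by (force simp: abs_le_iff)
      qed
    qed
    with w'_on[OF True] show ?thesis by simp
  next
    case False
    \<comment> \<open>A point \<open>y\<close> of the ball with \<open>w y > w x + d\<close> cannot lie in \<open>V\<close>: moving from \<open>y\<close> to \<open>x\<close> would change \<open>w\<close> by more than \<open>d\<close>.\<close>
    then have steep: "w x + d < S x" using x by (auto simp: V_def)
    have SS': "S x \<le> S' x"
    proof (rule ccontr)
      assume "\<not> S x \<le> S' x"
      then have "max (w x + d) (S' x) < S x" using steep by simp
      then obtain y where y: "y \<in> ball x \<epsilon>" "max (w x + d) (S' x) < w y"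
        unfolding S_def[of x] using less_SUP_ball[where f=w, OF w(2)] by blast
      have "y \<notin> V"
      proof
        assume "y \<in> V"
        then have "(y, x) \<in> R" using y(1) by (simp add: R_def dist_commute)
        from osc[OF this] y(2) show False by (auto simp: abs_le_iff)
      qed
      then have "w y \<le> S' x" using S'[OF y(1)] w'_off by simp
      with y(2) show False by simp
    qed
    have "min (I x) (w x - d) \<le> (INF y\<in>ball x \<epsilon>. w' y)"
    proof (rule INF_ball_greatest)
      fix y assume y: "y \<in> ball x \<epsilon>"
      show "min (I x) (w x - d) \<le> w' y"
      proof (cases "y \<in> V")
        case True
        with y have "(y, x) \<in> R" by (simp add: R_def dist_commute)
        from w'_step[OF this] w'_off[OF False] show ?thesis by simp
      next
        case False
        then show ?thesis using I[OF y] w'_off by simp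
      qed
    qed
    with steep SS' SI[OF x] w'_off[OF False] show ?thesis by (auto simp: min_def split: if_splits)
  qed
  moreover have "\<bar>w' y - w y\<bar> \<le> 2 * real N * d" for y
    using w'_upper[of y] w'_lower[of y] by simp
  ultimately show ?thesis using w'm unfolding S'_def by blast
qed

text \<open>
  With \<open>q r = r + k * (r + D)\<^sup>2\<close> the sum \<open>q a + q b - 2 * q t\<close> is \<open>1 + 2 * k * (t + D)\<close> times \<open>a + b - 2 * t\<close>,
  which is at least \<open>-\<eta>\<close>, plus \<open>k\<close> times the sum of the squares of \<open>a - t\<close> and \<open>b - t\<close>. The steep
  side \<open>a\<close> makes the squares large enough to absorb the error \<open>\<eta>\<close> of the almost optimal move.
\<close>
lemma convex_gain:
  fixes a b t D k d \<eta> :: real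
  assumes "d / 2 \<le> a - t" "2 * t - \<eta> \<le> a + b" "0 \<le> t + D" "t + D \<le> 2 * D" "0 < k" "0 \<le> \<eta>" "0 \<le> d"
    and "(1 + 4 * k * D) * \<eta> \<le> k * d\<^sup>2 / 8"
  shows "t + k * (t + D)\<^sup>2 + k * d\<^sup>2 / 16
    \<le> 1 / 2 * (a + k * (a + D)\<^sup>2) + 1 / 2 * (b + k * (b + D)\<^sup>2)"
proof -
  have "(d / 2)\<^sup>2 \<le> (a - t)\<^sup>2" using assms by (intro power_mono) auto
  then have "d\<^sup>2 / 4 \<le> (a - t)\<^sup>2" by (simp add: power_divide)
  then have "d\<^sup>2 / 4 \<le> (a - t)\<^sup>2 + (b - t)\<^sup>2" using zero_le_power2[of "b - t"] by linarith
  then have sq: "k * (d\<^sup>2 / 4) \<le> k * ((a - t)\<^sup>2 + (b - t)\<^sup>2)"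
    using assms(5) by (intro mult_left_mono) auto
  have "(1 + 2 * k * (t + D)) * (- \<eta>) \<le> (1 + 2 * k * (t + D)) * (a + b - 2 * t)"
    using assms by (intro mult_left_mono) auto
  moreover have "(1 + 2 * k * (t + D)) * \<eta> \<le> (1 + 4 * k * D) * \<eta>"
    using assms by (intro mult_right_mono) auto
  moreover have "a + k * (a + D)\<^sup>2 + (b + k * (b + D)\<^sup>2) - 2 * (t + k * (t + D)\<^sup>2) =
      (1 + 2 * k * (t + D)) * (a + b - 2 * t) + k * ((a - t)\<^sup>2 + (b - t)\<^sup>2)"
    by (simp add: power2_eq_square algebra_simps)
  ultimately show ?thesis using sq assms(8) by (simp add: algebra_simps)
qed

lemma strict_subsolution_tug:
  fixes w :: "'a \<Rightarrow> real"
  assumes "\<beta> = 0" and w: "w \<in> borel_measurable borel" "\<And>y. \<bar>w y\<bar> \<le> C"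
    and W: "W \<in> sets borel" "W \<subseteq> \<Omega>" and sub: "\<And>x. x \<in> W \<Longrightarrow> w x \<le> dpp_op w x" and \<eta>: "0 < \<eta>"
  shows "\<exists>v s c. strict_subsolution W v s c \<and> (\<forall>y. \<bar>v y - w y\<bar> \<le> \<eta>)"
proof -
  have \<alpha>: "\<alpha> = 1" using assms(1) alpha_beta by simp
  have C: "0 \<le> C" using w(2) order_trans abs_ge_zero by blast
  obtain N p where escape: "norm p < \<epsilon>" "\<And>x. x \<in> \<Omega> \<Longrightarrow> x + real N *\<^sub>R (p::'a) \<notin> \<Omega>"
    using escape_steps by metis
  \<comment> \<open>Half of the error \<open>\<eta>\<close> is spent on steepening, the other half on the quadratic term.\<close>
  define d where "d = \<eta> / (4 * N + 1)"
  have d: "0 < d" "2 * real N * d \<le> \<eta> / 2" using \<eta> by (auto simp: d_def field_simps)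
  have sub2: "2 * w x \<le> (SUP y\<in>ball x \<epsilon>. w y) + (INF y\<in>ball x \<epsilon>. w y)" if "x \<in> W" for x
    using sub[OF that, unfolded dpp_op_def] by (simp add: \<alpha> assms(1))
  obtain w' where w': "w' \<in> borel_measurable borel" "\<And>y. \<bar>w' y - w y\<bar> \<le> 2 * real N * d"
    "\<And>x. x \<in> W \<Longrightarrow> w' x + d \<le> (SUP y\<in>ball x \<epsilon>. w' y)"
    "\<And>x. x \<in> W \<Longrightarrow> 2 * w' x \<le> (SUP y\<in>ball x \<epsilon>. w' y) + (INF y\<in>ball x \<epsilon>. w' y)"
    using steepening[OF w W sub2 escape d(1)] by blast
  define D where "D = C + \<eta>"
  have D: "0 < D" "\<And>y. \<bar>w' y\<bar> \<le> D"
  proof -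
    show "0 < D" using C \<eta> by (simp add: D_def)
    show "\<bar>w' y\<bar> \<le> D" for y using w'(2)[of y] w(2)[of y] d \<eta> unfolding D_def by linarith
  qed
  define k where "k = \<eta> / (8 * D\<^sup>2)"
  have k: "0 < k" "k * (2 * D)\<^sup>2 \<le> \<eta> / 2" using \<eta> D(1) by (auto simp: k_def field_simps)
  define v where "v y = w' y + k * (w' y + D)\<^sup>2" for y
  have quad: "0 \<le> k * (w' y + D)\<^sup>2" "k * (w' y + D)\<^sup>2 \<le> \<eta> / 2" for y
  proof -
    show "0 \<le> k * (w' y + D)\<^sup>2" using k by simp
    have "(w' y + D)\<^sup>2 \<le> (2 * D)\<^sup>2" using D(2)[of y] by (intro power_mono) auto
    then have "k * (w' y + D)\<^sup>2 \<le> k * (2 * D)\<^sup>2" using k by simp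
    with k(2) show "k * (w' y + D)\<^sup>2 \<le> \<eta> / 2" by linarith
  qed
  define \<eta>' where "\<eta>' = min (d / 2) (k * d\<^sup>2 / (8 * (1 + 4 * k * D)))"
  have kD: "0 < 1 + 4 * k * D" using k D(1) by (simp add: add_pos_nonneg)
  have \<eta>': "0 < \<eta>'" "\<eta>' \<le> d / 2" "(1 + 4 * k * D) * \<eta>' \<le> k * d\<^sup>2 / 8"
  proof -
    show "0 < \<eta>'" using d k kD by (auto simp: \<eta>'_def)
    show "\<eta>' \<le> d / 2" unfolding \<eta>'_def by (rule min.cobounded1)
    have "(1 + 4 * k * D) * \<eta>' \<le> (1 + 4 * k * D) * (k * d\<^sup>2 / (8 * (1 + 4 * k * D)))"
      using kD by (intro mult_left_mono) (auto simp: \<eta>'_def)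
    also have "\<dots> = k * d\<^sup>2 / 8"
    proof -
      have "m * (z / (8 * m)) = z / 8" if "0 < m" for m z :: real using that by simp
      from this[OF kD] show ?thesis .
    qed
    finally show "(1 + 4 * k * D) * \<eta>' \<le> k * d\<^sup>2 / 8" .
  qed
  obtain s where s: "s \<in> borel \<rightarrow>\<^sub>M borel" "\<And>x. x \<in> X \<Longrightarrow> s x \<in> ball x \<epsilon> \<inter> X"
    "\<And>x. x \<in> W \<Longrightarrow> (SUP y\<in>ball x \<epsilon>. w' y) - \<eta>' \<le> w' (s x)"
    using near_sup_selector[where f=w', OF D(2) W \<eta>'(1)] by metis
  have "v x + k * d\<^sup>2 / 16 \<le> \<alpha> / 2 * v (s x) + \<alpha> / 2 * v y + \<beta> * ball_mean v x"
    if x: "x \<in> W" and y: "y \<in> ball x \<epsilon>" for x y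
  proof -
    have "v x + k * d\<^sup>2 / 16 \<le> 1 / 2 * v (s x) + 1 / 2 * v y"
      unfolding v_def
    proof (rule convex_gain)
      show "d / 2 \<le> w' (s x) - w' x" using s(3)[OF x] w'(3)[OF x] \<eta>'(2) by linarith
      show "2 * w' x - \<eta>' \<le> w' (s x) + w' y"
        using s(3)[OF x] w'(4)[OF x] INF_ball_lower[where f=w', OF D(2) y] by linarith
      show "0 \<le> w' x + D" "w' x + D \<le> 2 * D" using D(2)[of x] by auto
    qed (use k \<eta>' d in auto)
    then show ?thesis by (simp add: \<alpha> assms(1))
  qed
  moreover have "\<bar>v y\<bar> \<le> D + \<eta>" for y
    using quad[of y] D(2)[of y] \<eta> by (simp add: v_def)
  moreover have "v \<in> borel_measurable borel" unfolding v_def[abs_def] using w'(1) by measurable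
  ultimately have "strict_subsolution W v s (k * d\<^sup>2 / 16)"
    using s k d unfolding strict_subsolution_def by auto
  moreover have "\<bar>v y - w y\<bar> \<le> \<eta>" for y
    using quad[of y] w'(2)[of y] d(2) unfolding v_def by linarith
  ultimately show ?thesis by blast
qed

lemma strict_subsolution_exists:
  fixes w :: "'a \<Rightarrow> real"
  assumes "w \<in> borel_measurable borel" "\<And>y. \<bar>w y\<bar> \<le> C"
    and "W \<in> sets borel" "W \<subseteq> \<Omega>" and "\<And>x. x \<in> W \<Longrightarrow> w x \<le> dpp_op w x" and "0 < \<eta>"
  shows "\<exists>v s c. strict_subsolution W v s c \<and> (\<forall>y. \<bar>v y - w y\<bar> \<le> \<eta>)"
proof (cases "\<beta> = 0")
  case True
  then show ?thesis using assms by (rule strict_subsolution_tug)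
next
  case False
  then have "0 < \<beta>" using beta_nonneg by simp
  then show ?thesis using assms by (rule strict_subsolution_noise)
qed

end

section \<open>Existence of solutions\<close>

locale obstacle_problem = tug_of_war \<Omega> \<epsilon>\<^sub>0 \<epsilon> \<alpha> \<beta>
  for \<Omega> :: "'a::euclidean_space set" and \<epsilon>\<^sub>0 \<epsilon> \<alpha> \<beta> +
  fixes F \<Psi> :: "'a \<Rightarrow> real" and C :: real
  assumes F_measurable: "F \<in> borel_measurable (borel_on \<Gamma>)"
    and \<Psi>_measurable [measurable]: "\<Psi> \<in> borel_measurable borel"
    and F_bound: "\<And>x. x \<in> \<Gamma> \<Longrightarrow> \<bar>F x\<bar> \<le> C" and \<Psi>_bound: "\<And>x. \<bar>\<Psi> x\<bar> \<le> C"
begin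

lemma C_nonneg: "0 \<le> C"
  using \<Psi>_bound order_trans abs_ge_zero by blast

text \<open>
  If \<open>\<beta> = 0\<close>, the equation makes sense for all bounded functions, and it is essential to admit all of them:
  the lattice in which a fixed point is sought then is complete.
\<close>
definition regular :: "('a \<Rightarrow> real) \<Rightarrow> bool" where
  "regular u \<longleftrightarrow> (\<forall>y. \<bar>u y\<bar> \<le> C) \<and> (\<beta> = 0 \<or> u \<in> borel_measurable borel)"

lemma regular_bound: "regular u \<Longrightarrow> \<bar>u y\<bar> \<le> C"
  by (simp add: regular_def)

text \<open>
  The averages are kept apart here. Bounding them by \<open>a\<close> too only shows that the operator does not
  expand distances; in the uniform convergence of the iterates they are instead small by themselves.
\<close>
lemma dpp_op_le:
  assumes "regular u" "regular u'" "\<And>y. u y \<le> u' y + a"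
  shows "dpp_op u x \<le> dpp_op u' x + \<alpha> * a + \<beta> * (ball_mean u x - ball_mean u' x)"
proof -
  have 1: "(SUP y\<in>ball x \<epsilon>. u y) \<le> (SUP y\<in>ball x \<epsilon>. u' y) + a"
  proof (rule SUP_ball_least)
    fix y assume "y \<in> ball x \<epsilon>"
    then have "u' y \<le> (SUP y\<in>ball x \<epsilon>. u' y)"
      by (rule SUP_ball_upper[where f=u', OF regular_bound[OF assms(2)]])
    with assms(3)[of y] show "u y \<le> (SUP y\<in>ball x \<epsilon>. u' y) + a" by simp
  qed
  have "(INF y\<in>ball x \<epsilon>. u y) - a \<le> (INF y\<in>ball x \<epsilon>. u' y)"
  proof (rule INF_ball_greatest)
    fix y assume "y \<in> ball x \<epsilon>"
    then have "(INF y\<in>ball x \<epsilon>. u y) \<le> u y"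
      by (rule INF_ball_lower[where f=u, OF regular_bound[OF assms(1)]])
    with assms(3)[of y] show "(INF y\<in>ball x \<epsilon>. u y) - a \<le> u' y" by simp
  qed
  then have 2: "(INF y\<in>ball x \<epsilon>. u y) \<le> (INF y\<in>ball x \<epsilon>. u' y) + a" by simp
  have "\<alpha> / 2 * (SUP y\<in>ball x \<epsilon>. u y) \<le> \<alpha> / 2 * ((SUP y\<in>ball x \<epsilon>. u' y) + a)"
    "\<alpha> / 2 * (INF y\<in>ball x \<epsilon>. u y) \<le> \<alpha> / 2 * ((INF y\<in>ball x \<epsilon>. u' y) + a)"
    using 1 2 alpha_nonneg by (intro mult_left_mono; simp)+
  then show ?thesis unfolding dpp_op_def by (simp add: algebra_simps)
qed

lemma dpp_op_shift:
  assumes "regular u" "regular u'" "\<And>y. u y \<le> u' y + a"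
  shows "dpp_op u x \<le> dpp_op u' x + a"
proof -
  have "\<beta> * (ball_mean u x - ball_mean u' x) \<le> \<beta> * a"
  proof (cases "\<beta> = 0")
    case False
    then have m: "u \<in> borel_measurable borel" "u' \<in> borel_measurable borel"
      using assms by (auto simp: regular_def)
    note int = set_integrable_ball[where f=u, OF m(1) regular_bound[OF assms(1)]]
      set_integrable_ball[where f=u', OF m(2) regular_bound[OF assms(2)]]
      set_integrable_ball[where f="\<lambda>_. a" and C="\<bar>a\<bar>", simplified]
    have "ball_mean u x \<le> ball_mean (\<lambda>y. u' y + a) x"
      using int set_integral_add(1)[OF int(2,3)] assms(3) by (intro ball_mean_mono) auto
    also have "\<dots> = ball_mean u' x + a"
      using ball_mean_add[OF int(2,3)] by (simp add: ball_mean_const)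
    finally show ?thesis using beta_nonneg by (intro mult_left_mono) auto
  qed simp
  moreover have "\<alpha> * a + \<beta> * a = a" using alpha_beta by (simp flip: distrib_right)
  ultimately show ?thesis using dpp_op_le[OF assms, of x] by linarith
qed

lemma measurable_dpp_op:
  assumes "regular u"
  shows "dpp_op u \<in> borel_measurable borel"
proof -
  have [measurable]: "(\<lambda>x. \<beta> * ball_mean u x) \<in> borel_measurable borel"
  proof (cases "\<beta> = 0")
    case False
    then show ?thesis using assms measurable_ball_mean[of u] by (auto simp: regular_def)
  qed simp
  note measurable_SUP_ball[where f=u, OF regular_bound[OF assms], measurable]
    measurable_INF_ball[where f=u, OF regular_bound[OF assms], measurable]
  show ?thesis unfolding dpp_op_def[abs_def] by measurable
qed

text \<open>
  The value \<open>0\<close> outside the arena is a dummy that keeps the iterates total and bounded.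
\<close>
definition dpp_step :: "('a \<Rightarrow> real) \<Rightarrow> 'a \<Rightarrow> real" where
  "dpp_step u x = (if x \<in> \<Omega> then max (\<Psi> x) (dpp_op u x) else if x \<in> \<Gamma> then F x else 0)"

lemma dpp_step_shift:
  assumes "regular u" "regular u'" "\<And>y. u y \<le> u' y + a" "0 \<le> a"
  shows "dpp_step u x \<le> dpp_step u' x + a"
  using dpp_op_shift[OF assms(1-3), of x] assms(4) by (auto simp: dpp_step_def)

lemma dpp_op_bound:
  assumes "regular u"
  shows "\<bar>dpp_op u x\<bar> \<le> C"
proof -
  have z: "regular (\<lambda>_. 0)" using C_nonneg by (simp add: regular_def)
  have "dpp_op (\<lambda>_. 0) x = 0" using eps_pos by (simp add: dpp_op_def ball_mean_const)
  moreover have "u y \<le> 0 + C" "0 \<le> u y + C" for y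
    using regular_bound[OF assms, of y] by (auto simp: abs_le_iff)
  ultimately show ?thesis
    using dpp_op_shift[OF assms z, of C x] dpp_op_shift[OF z assms, of C x] by (simp add: abs_le_iff)
qed

lemma regular_dpp_step:
  assumes "regular u"
  shows "regular (dpp_step u)" "dpp_step u \<in> borel_measurable borel"
proof -
  have "\<bar>dpp_step u x\<bar> \<le> C" for x
    using dpp_op_bound[OF assms, of x] \<Psi>_bound[of x] F_bound[of x] C_nonneg
    by (auto simp: dpp_step_def max_def)
  moreover show "dpp_step u \<in> borel_measurable borel"
  proof -
    have F': "(\<lambda>x. if x \<in> \<Gamma> then F x else 0) \<in> borel_measurable borel"
      using F_measurable by (subst (asm) measurable_restrict_space_iff[where c=0]) auto
    show ?thesis
      unfolding dpp_step_def[abs_def] using measurable_dpp_op[OF assms] F' by measurable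
  qed
  ultimately show "regular (dpp_step u)" by (simp add: regular_def)
qed

lemma dpp_solution_fixpoint:
  assumes "regular u" and fix_u: "\<And>x. u x = dpp_step u x"
  shows "dpp_solution \<Omega> \<epsilon>\<^sub>0 \<epsilon> \<alpha> \<beta> F \<Psi> u"
proof -
  have "u = dpp_step u" using fix_u by (intro ext)
  with regular_dpp_step(2)[OF assms(1)] have "u \<in> borel_measurable borel" by simp
  then have "u \<in> borel_measurable (borel_on X)" by (rule measurable_restrict_space1)
  moreover have "bounded (u ` X)"
    using regular_bound[OF assms(1)] by (intro boundedI[where B=C]) auto
  moreover have "u x = max (\<Psi> x) (dpp_op u x)" if "x \<in> \<Omega>" for x
    using fix_u[of x] that by (simp add: dpp_step_def)
  moreover have "u x = F x" if "x \<in> \<Gamma>" for x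
    using fix_u[of x] that by (simp add: dpp_step_def strip_eq)
  ultimately show ?thesis
    unfolding dpp_solution_def dpp_op_def ball_mean_def by auto
qed

text \<open>
  The Knaster-Tarski argument: the pointwise supremum of all \<open>f \<le> dpp_step f\<close> is a fixed point. The
  supremum is uncountable, but a fixed point is Borel because \<open>dpp_step\<close> only has Borel values.
\<close>
lemma dpp_solution_exists_tug:
  assumes "\<beta> = 0"
  shows "\<exists>u. dpp_solution \<Omega> \<epsilon>\<^sub>0 \<epsilon> \<alpha> \<beta> F \<Psi> u"
proof -
  have reg: "regular f \<longleftrightarrow> (\<forall>y. \<bar>f y\<bar> \<le> C)" for f unfolding regular_def using assms by simp
  define P where "P = {f. regular f \<and> (\<forall>x. f x \<le> dpp_step f x)}"
  define u where "u x = (SUP f\<in>P. f x)" for x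
  have step_low: "- C \<le> dpp_step f x" if "regular f" for f x
    using regular_bound[OF regular_dpp_step(1)[OF that], of x] by (simp add: abs_le_iff)
  have "regular (\<lambda>_. - C)" using C_nonneg by (simp add: reg)
  then have ne: "(\<lambda>_. - C) \<in> P" using step_low by (simp add: P_def)
  have bdd: "bdd_above ((\<lambda>f. f x) ` P)" for x
    by (rule bdd_aboveI2[where M=C]) (auto simp: P_def reg abs_le_iff)
  have upper: "f x \<le> u x" if "f \<in> P" for f x
    unfolding u_def using that by (intro cSUP_upper bdd)
  have "u x \<le> C" for x
    unfolding u_def
  proof (rule cSUP_least)
    show "P \<noteq> {}" using ne by auto
    show "f x \<le> C" if "f \<in> P" for f using that by (auto simp: P_def reg abs_le_iff)
  qed
  moreover have "- C \<le> u x" for x using upper[OF ne, of x] by simp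
  ultimately have u: "regular u" by (simp add: reg abs_le_iff minus_le_iff)
  have sub: "u x \<le> dpp_step u x" for x
    unfolding u_def[of x]
  proof (rule cSUP_least)
    show "P \<noteq> {}" using ne by auto
    fix f assume f: "f \<in> P"
    then have "f x \<le> dpp_step f x" by (simp add: P_def)
    also have "\<dots> \<le> dpp_step u x + 0"
      using f upper[OF f] u by (intro dpp_step_shift) (auto simp: P_def)
    finally show "f x \<le> dpp_step u x" by simp
  qed
  have "dpp_step u \<in> P"
    unfolding P_def using regular_dpp_step(1)[OF u] sub u
      dpp_step_shift[OF u regular_dpp_step(1)[OF u], of 0] by auto
  then have "dpp_step u x \<le> u x" for x by (rule upper)
  with sub have "u x = dpp_step u x" for x by (rule antisym)
  with u show ?thesis using dpp_solution_fixpoint by blast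
qed

text \<open>
  The iterates from \<open>-C\<close> increase to a limit \<open>u\<close>. Write \<open>M n\<close> for the supremum of \<open>u - U n\<close>. The operator
  gives \<open>M (Suc n) \<le> \<alpha> * M n + \<beta> * k * J n\<close>, where \<open>J n\<close>, the integral of \<open>u - U n\<close> over the whole
  bounded arena, tends to \<open>0\<close> and \<open>k * J n\<close> dominates every ball average of \<open>u - U n\<close>. Hence the limit \<open>L\<close> of \<open>M\<close>
  satisfies \<open>L \<le> \<alpha> * L\<close>, and \<open>L = 0\<close> as \<open>\<alpha> < 1\<close>.
\<close>
lemma dpp_solution_exists_noise:
  assumes "0 < \<beta>"
  shows "\<exists>u. dpp_solution \<Omega> \<epsilon>\<^sub>0 \<epsilon> \<alpha> \<beta> F \<Psi> u"
proof -
  define U where "U n = (dpp_step ^^ n) (\<lambda>_. - C)" for n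
  have U_Suc: "U (Suc n) = dpp_step (U n)" for n by (simp add: U_def)
  have U: "regular (U n)" for n
  proof (induction n)
    case 0
    then show ?case using C_nonneg by (simp add: U_def regular_def)
  next
    case (Suc n)
    then show ?case by (simp add: U_Suc regular_dpp_step)
  qed
  have U_mono1: "U n x \<le> U (Suc n) x" for n x
  proof (induction n arbitrary: x)
    case 0
    show ?case using regular_bound[OF U, of 1 x] by (simp add: U_def abs_le_iff)
  next
    case (Suc n)
    then show ?case using dpp_step_shift[OF U U, of n "Suc n" 0 x] by (simp add: U_Suc)
  qed
  have U_mono: "incseq (\<lambda>n. U n x)" for x using U_mono1 by (rule incseq_SucI)
  have U_bdd: "bdd_above (range (\<lambda>n. U n x))" for x
    using regular_bound[OF U] by (intro bdd_aboveI2[where M=C]) (auto simp: abs_le_iff)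
  define u where "u x = (SUP n. U n x)" for x
  have lim: "(\<lambda>n. U n x) \<longlonglongrightarrow> u x" for x
    unfolding u_def by (rule LIMSEQ_incseq_SUP[OF U_bdd U_mono])
  have U_le: "U n x \<le> u x" for n x unfolding u_def by (rule cSUP_upper[OF _ U_bdd]) simp
  have U_meas [measurable]: "U n \<in> borel_measurable borel" for n
    using U[of n] assms by (simp add: regular_def)
  have u_meas [measurable]: "u \<in> borel_measurable borel"
    using lim U_meas by (rule borel_measurable_LIMSEQ_real)
  have "\<bar>u x\<bar> \<le> C" for x
  proof -
    have "u x \<le> C" unfolding u_def using regular_bound[OF U] by (intro cSUP_least) (auto simp: abs_le_iff)
    moreover have "- C \<le> u x" using U_le[of 0 x] by (simp add: U_def)
    ultimately show ?thesis by (simp add: abs_le_iff)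
  qed
  then have u: "regular u" using u_meas by (simp add: regular_def)
  have sub: "u x \<le> dpp_step u x" for x
  proof (rule LIMSEQ_le_const2)
    show "(\<lambda>n. U (Suc n) x) \<longlonglongrightarrow> u x" using lim by (rule LIMSEQ_Suc)
    show "\<exists>N. \<forall>n\<ge>N. U (Suc n) x \<le> dpp_step u x"
      using dpp_step_shift[OF U u, of _ 0 x] U_le by (auto simp: U_Suc)
  qed
  define k where "k = 1 / measure lborel (ball (0::'a) \<epsilon>)"
  have k: "1 / measure lborel (ball x \<epsilon>) = k" for x :: 'a
    using eps_pos by (simp add: k_def content_ball)
  have k0: "0 \<le> k" by (simp add: k_def)
  define J where "J n = (\<integral>y. indicator X y * (u y - U n y) \<partial>lborel)" for n
  have X_fin: "emeasure lborel X < \<infinity>" using bounded_arena by (rule emeasure_bounded_finite)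
  have gap: "0 \<le> u y - U n y" "u y - U n y \<le> 2 * C" for n y
    using U_le[of n y] regular_bound[OF u, of y] regular_bound[OF U, of n y] by (auto simp: abs_le_iff)
  have int_X: "integrable lborel (\<lambda>y. indicator X y * (u y - U n y))" for n
  proof -
    have "integrable lborel (\<lambda>y. indicator X y *\<^sub>R (u y - U n y))"
      using gap X_fin by (intro integrableI_bounded_set_indicator[where B="2 * C"]) auto
    then show ?thesis by simp
  qed
  have "J \<longlonglongrightarrow> (\<integral>y. 0 \<partial>(lborel :: 'a measure))"
    unfolding J_def
  proof (rule integral_dominated_convergence[where w="\<lambda>y. indicator X y * (2 * C)"])
    show "integrable lborel (\<lambda>y. indicator X y * (2 * C))" using X_fin by simp
    show "AE y in lborel. (\<lambda>n. indicator X y * (u y - U n y)) \<longlonglongrightarrow> 0"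
    proof (rule AE_I2)
      fix y
      have "(\<lambda>n. indicator X y * (u y - U n y)) \<longlonglongrightarrow> indicator X y * (u y - u y)"
        by (intro tendsto_intros lim)
      then show "(\<lambda>n. indicator X y * (u y - U n y)) \<longlonglongrightarrow> 0" by simp
    qed
  qed (use gap in \<open>auto split: split_indicator\<close>)
  then have J: "J \<longlonglongrightarrow> 0" by simp
  have mean_gap: "ball_mean u x - ball_mean (U n) x \<le> k * J n" if x: "x \<in> \<Omega>" for x n
  proof -
    note int = set_integrable_ball[where f=u, OF u_meas regular_bound[OF u], of x \<epsilon>]
      set_integrable_ball[where f="U n", OF U_meas regular_bound[OF U], of x \<epsilon>]
    have "ball_mean u x - ball_mean (U n) x = k * (LINT y:ball x \<epsilon>|lborel. u y - U n y)"
      using set_integral_diff(2)[OF int] by (simp add: ball_mean_def k right_diff_distrib)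
    also have "(LINT y:ball x \<epsilon>|lborel. u y - U n y) \<le> J n"
      unfolding J_def set_lebesgue_integral_def
      using set_integral_diff(1)[OF int] int_X ball_subset_arena[OF x] gap
      by (intro integral_mono) (auto simp: set_integrable_def split: split_indicator)
    finally show ?thesis using k0 by (simp add: mult_left_mono)
  qed
  have gap_bdd: "bdd_above (range (\<lambda>x. u x - U n x))" for n
    using gap by (intro bdd_aboveI2[where M="2 * C"])
  define M where "M n = (SUP x. u x - U n x)" for n
  have M: "u x - U n x \<le> M n" for x n unfolding M_def by (rule cSUP_upper[OF _ gap_bdd]) simp
  have M0: "0 \<le> M n" for n using M[of undefined n] gap(1)[of undefined n] by simp
  have J0: "0 \<le> J n" for n
    unfolding J_def using gap by (intro integral_nonneg_AE) (auto split: split_indicator)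
  have M_Suc: "M (Suc n) \<le> \<alpha> * M n + \<beta> * (k * J n)" for n
    unfolding M_def[of "Suc n"]
  proof (rule cSUP_least)
    fix x
    have r0: "0 \<le> \<alpha> * M n + \<beta> * (k * J n)" using M0 J0 k0 alpha_nonneg beta_nonneg by simp
    have "dpp_step u x \<le> U (Suc n) x + (\<alpha> * M n + \<beta> * (k * J n))"
    proof (cases "x \<in> \<Omega>")
      case True
      have "u y \<le> U n y + M n" for y using M[of y n] by simp
      from dpp_op_le[OF u U this, of x]
      have "dpp_op u x \<le> dpp_op (U n) x + \<alpha> * M n + \<beta> * (ball_mean u x - ball_mean (U n) x)" .
      moreover have "\<beta> * (ball_mean u x - ball_mean (U n) x) \<le> \<beta> * (k * J n)"
        using mean_gap[OF True] beta_nonneg by (intro mult_left_mono) auto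
      ultimately show ?thesis using r0 True unfolding U_Suc dpp_step_def by (auto simp: max_def)
    next
      case False
      then show ?thesis using r0 by (simp add: U_Suc dpp_step_def)
    qed
    with sub[of x] show "u x - U (Suc n) x \<le> \<alpha> * M n + \<beta> * (k * J n)" by simp
  qed simp
  have "decseq M"
  proof (rule decseq_SucI)
    fix n
    show "M (Suc n) \<le> M n"
      unfolding M_def[of "Suc n"]
    proof (rule cSUP_least)
      fix x show "u x - U (Suc n) x \<le> M n" using M[of x n] U_mono1[of n x] by simp
    qed simp
  qed
  then obtain L where L: "M \<longlonglongrightarrow> L" using decseq_convergent[of M 0] M0 by blast
  have "L \<le> \<alpha> * L + \<beta> * (k * 0)"
  proof (rule LIMSEQ_le)
    show "(\<lambda>n. M (Suc n)) \<longlonglongrightarrow> L" using L by (rule LIMSEQ_Suc)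
    show "(\<lambda>n. \<alpha> * M n + \<beta> * (k * J n)) \<longlonglongrightarrow> \<alpha> * L + \<beta> * (k * 0)" by (intro tendsto_intros L J)
    show "\<exists>N. \<forall>n\<ge>N. M (Suc n) \<le> \<alpha> * M n + \<beta> * (k * J n)" using M_Suc by blast
  qed
  then have "(1 - \<alpha>) * L \<le> 0" by (simp add: algebra_simps)
  then have "L \<le> 0" using assms alpha_beta by (simp add: mult_le_0_iff)
  moreover have "0 \<le> L" using M0 by (intro LIMSEQ_le_const[OF L]) auto
  ultimately have L0: "M \<longlonglongrightarrow> 0" using L by simp
  have "dpp_step u x \<le> u x" for x
  proof (rule LIMSEQ_le_const)
    have "(\<lambda>n. u x + M n) \<longlonglongrightarrow> u x + 0" by (intro tendsto_intros L0)
    then show "(\<lambda>n. u x + M n) \<longlonglongrightarrow> u x" by simp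
    have "dpp_step u x \<le> u x + M n" for n
    proof -
      have "u y \<le> U n y + M n" for y using M[of y n] by simp
      from dpp_step_shift[OF u U this M0, of x] have "dpp_step u x \<le> U (Suc n) x + M n" by (simp add: U_Suc)
      with U_le[of "Suc n" x] show ?thesis by simp
    qed
    then show "\<exists>N. \<forall>n\<ge>N. dpp_step u x \<le> u x + M n" by blast
  qed
  with sub have "u x = dpp_step u x" for x by (rule antisym)
  with u show ?thesis using dpp_solution_fixpoint by blast
qed

lemma dpp_solution_exists: "\<exists>u. dpp_solution \<Omega> \<epsilon>\<^sub>0 \<epsilon> \<alpha> \<beta> F \<Psi> u"
  using dpp_solution_exists_tug dpp_solution_exists_noise beta_nonneg by (cases "\<beta> = 0") auto

end

section \<open>Histories and transitions\<close>

locale play = tug_of_war \<Omega> \<epsilon>\<^sub>0 \<epsilon> \<alpha> \<beta>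
  for \<Omega> :: "'a::euclidean_space set" and \<epsilon>\<^sub>0 \<epsilon> \<alpha> \<beta> +
  fixes x\<^sub>0 :: 'a and \<tau> :: "(nat \<Rightarrow> 'a) \<Rightarrow> enat" and \<sigma>\<^sub>I \<sigma>\<^sub>I\<^sub>I :: "nat \<Rightarrow> (nat \<Rightarrow> 'a) \<Rightarrow> 'a"
  assumes start: "x\<^sub>0 \<in> X"
    and admissible: "\<tau> \<in> admissible_times \<Omega> \<epsilon>\<^sub>0 x\<^sub>0"
    and strategy_I: "\<sigma>\<^sub>I \<in> strategies X \<epsilon>" and strategy_II: "\<sigma>\<^sub>I\<^sub>I \<in> strategies X \<epsilon>"
begin

abbreviation \<gamma> :: "nat \<Rightarrow> (nat \<Rightarrow> 'a) \<Rightarrow> 'a measure" where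
  "\<gamma> \<equiv> transition X \<epsilon> \<alpha> \<beta> x\<^sub>0 \<tau> \<sigma>\<^sub>I \<sigma>\<^sub>I\<^sub>I"

abbreviation stopped :: "nat \<Rightarrow> (nat \<Rightarrow> 'a) set" where
  "stopped \<equiv> stopped_histories X x\<^sub>0 \<tau>"

text \<open>
  The starting point is made part of the product structure: the coordinate \<open>0\<close> lives in the one-point
  space \<open>{x\<^sub>0}\<close>. Then the product of all state spaces is exactly the path space, and the product of
  the first ones consists exactly of the histories that the game can have.
\<close>
definition state :: "nat \<Rightarrow> 'a measure" where
  "state i = borel_on (if i = 0 then {x\<^sub>0} else X)"

lemma space_state: "space (state i) = (if i = 0 then {x\<^sub>0} else X)"
  by (simp add: state_def space_restrict_space)

lemma state_Suc: "state (Suc n) = borel_on X"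
  by (simp add: state_def)

lemma sets_state: "A \<in> sets (state i) \<longleftrightarrow> A \<in> sets borel \<and> A \<subseteq> space (state i)"
  by (auto simp: state_def sets_restrict_space_iff space_restrict_space)

lemma space_histories:
  "h \<in> space (PiM {..n} state) \<longleftrightarrow> h \<in> extensional {..n} \<and> h 0 = x\<^sub>0 \<and> (\<forall>i\<in>{1..n}. h i \<in> X)"
  by (auto simp: space_PiM PiE_iff space_state split: if_splits)

lemma history_in_PiE: "h \<in> space (PiM {..n} state) \<Longrightarrow> h \<in> {..n} \<rightarrow>\<^sub>E X"
  using start unfolding space_histories PiE_iff
  by (metis One_nat_def Suc_leI atLeastAtMost_iff atMost_iff gr0I)

lemma space_paths: "space (PiM UNIV state) = paths X x\<^sub>0"
  by (auto simp: space_PiM PiE_iff space_state paths_def split: if_splits)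

lemma measurable_state_borel [measurable]: "(\<lambda>x. x) \<in> state i \<rightarrow>\<^sub>M borel"
  unfolding state_def by (rule measurable_restrict_space1) simp

lemma measurable_state_arena: "(\<lambda>x. x) \<in> state i \<rightarrow>\<^sub>M borel_on X"
  using start space_state[of i]
  by (intro measurable_restrict_space2 measurable_state_borel) (auto split: if_splits)

lemma measurable_coordinate: "i \<in> I \<Longrightarrow> (\<lambda>h. h i) \<in> PiM I state \<rightarrow>\<^sub>M borel"
  using measurable_compose[OF measurable_component_singleton[of i I state] measurable_state_borel] by auto

lemma measurable_history_arena: "(\<lambda>h. h) \<in> PiM {..n} state \<rightarrow>\<^sub>M (\<Pi>\<^sub>M i\<in>{..n}. borel_on X)"
proof (rule measurable_PiM_single')
  show "(\<lambda>h. h i) \<in> PiM {..n} state \<rightarrow>\<^sub>M borel_on X" if "i \<in> {..n}" for i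
    using measurable_compose[OF measurable_component_singleton[OF that, of state] measurable_state_arena] .
  show "(\<lambda>h. h) \<in> space (PiM {..n} state) \<rightarrow> {..n} \<rightarrow>\<^sub>E space (borel_on X)"
    using history_in_PiE by (auto simp: space_restrict_space)
qed

lemma measurable_restrict_path: "(\<lambda>\<omega>. restrict \<omega> {..n}) \<in> PiM UNIV state \<rightarrow>\<^sub>M PiM {..n} state"
  by (rule measurable_restrict_subset) simp

lemma restrict_path_in_space: "\<omega> \<in> paths X x\<^sub>0 \<Longrightarrow> restrict \<omega> {..n} \<in> space (PiM {..n} state)"
  using measurable_space[OF measurable_restrict_path] by (simp add: space_paths)

lemma history_extends:
  assumes "h \<in> space (PiM {..n} state)"
  obtains \<omega> where "\<omega> \<in> paths X x\<^sub>0" "restrict \<omega> {..n} = h"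
proof
  show "(\<lambda>i. if i \<le> n then h i else x\<^sub>0) \<in> paths X x\<^sub>0"
    using assms start by (auto simp: paths_def space_histories)
  show "restrict (\<lambda>i. if i \<le> n then h i else x\<^sub>0) {..n} = h"
    using assms by (auto simp: space_histories extensional_def restrict_def)
qed

lemma cylinder_eq:
  assumes "\<forall>i\<in>{1..n}. A i \<in> sets (borel_on X)"
  shows "\<exists>B\<in>sets (PiM {..n} state). cylinder X x\<^sub>0 n A = (\<lambda>\<omega>. restrict \<omega> {..n}) -` B \<inter> paths X x\<^sub>0"
proof (rule bexI)
  let ?B = "PiE {..n} (\<lambda>i. if i = 0 then {x\<^sub>0} else A i)"
  show "?B \<in> sets (PiM {..n} state)"
    using assms by (intro sets_PiM_I_finite) (auto simp: state_def sets_restrict_space_iff)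
  show "cylinder X x\<^sub>0 n A = (\<lambda>\<omega>. restrict \<omega> {..n}) -` ?B \<inter> paths X x\<^sub>0"
    by (auto simp: cylinder_def paths_def PiE_iff split: if_splits)
qed

text \<open>
  Events up to time \<open>n\<close> only depend on the history up to time \<open>n\<close>; the generating cylinders have this
  property, and it is preserved by the operations of a \<open>\<sigma>\<close>-algebra.
\<close>
lemma sets_path_filtration:
  assumes "S \<in> sets (path_filtration X x\<^sub>0 n)"
  obtains B where "B \<in> sets (PiM {..n} state)" "S = (\<lambda>\<omega>. restrict \<omega> {..n}) -` B \<inter> paths X x\<^sub>0"
proof -
  let ?V = "vimage_algebra (paths X x\<^sub>0) (\<lambda>\<omega>. restrict \<omega> {..n}) (PiM {..n} state)"
  let ?G = "{cylinder X x\<^sub>0 n A | A. \<forall>i\<in>{1..n}. A i \<in> sets (borel_on X)}"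
  have V: "sets ?V = {(\<lambda>\<omega>. restrict \<omega> {..n}) -` B \<inter> paths X x\<^sub>0 | B. B \<in> sets (PiM {..n} state)}"
    by (intro sets_vimage_algebra2) (auto simp: restrict_path_in_space)
  have "?G \<subseteq> sets ?V"
  proof
    fix S' assume "S' \<in> ?G"
    then obtain A where A: "S' = cylinder X x\<^sub>0 n A" "\<forall>i\<in>{1..n}. A i \<in> sets (borel_on X)" by auto
    show "S' \<in> sets ?V" unfolding V A(1) using cylinder_eq[OF A(2)] by auto
  qed
  then have "sigma_sets (paths X x\<^sub>0) ?G \<subseteq> sets ?V"
    using sets.sigma_sets_subset[of ?G ?V] by simp
  moreover have "sets (path_filtration X x\<^sub>0 n) = sigma_sets (paths X x\<^sub>0) ?G"
    unfolding path_filtration_def by (intro sets_measure_of) (auto simp: cylinder_def)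
  ultimately have "S \<in> sets ?V" using assms by auto
  then show ?thesis using that unfolding V by auto
qed

lemma stopping_time: "{\<omega> \<in> paths X x\<^sub>0. \<tau> \<omega> \<le> enat n} \<in> sets (path_filtration X x\<^sub>0 n)"
  using admissible by (auto simp: admissible_times_def path_stopping_time_def)

text \<open>
  As \<open>{\<tau> \<le> n}\<close> is determined by the history up to time \<open>n\<close>, a history that has stopped on one of its
  continuations has stopped on all of them.
\<close>
lemma
  shows stopped_measurable [measurable]: "stopped n \<in> sets (PiM {..n} state)"
    and stopped_iff: "\<omega> \<in> paths X x\<^sub>0 \<Longrightarrow> restrict \<omega> {..n} \<in> stopped n \<longleftrightarrow> \<tau> \<omega> \<le> enat n"
proof -
  obtain B where B: "B \<in> sets (PiM {..n} state)"
    "{\<omega> \<in> paths X x\<^sub>0. \<tau> \<omega> \<le> enat n} = (\<lambda>\<omega>. restrict \<omega> {..n}) -` B \<inter> paths X x\<^sub>0"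
    using sets_path_filtration[OF stopping_time] by blast
  have eq: "\<tau> \<omega> \<le> enat n \<longleftrightarrow> restrict \<omega> {..n} \<in> B" if "\<omega> \<in> paths X x\<^sub>0" for \<omega>
    using B(2) that by (auto simp: set_eq_iff)
  have "stopped n = B"
  proof
    show "stopped n \<subseteq> B" using eq by (auto simp: stopped_histories_def)
    show "B \<subseteq> stopped n"
    proof
      fix h assume "h \<in> B"
      then have "h \<in> space (PiM {..n} state)" using B(1) sets.sets_into_space by blast
      then obtain \<omega> where "\<omega> \<in> paths X x\<^sub>0" "restrict \<omega> {..n} = h" by (rule history_extends)
      with \<open>h \<in> B\<close> eq show "h \<in> stopped n" by (auto simp: stopped_histories_def)
    qed
  qed
  then show "stopped n \<in> sets (PiM {..n} state)"
    and "\<omega> \<in> paths X x\<^sub>0 \<Longrightarrow> restrict \<omega> {..n} \<in> stopped n \<longleftrightarrow> \<tau> \<omega> \<le> enat n"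
    using B(1) eq[of \<omega>] by simp_all
qed

text \<open>
  This is the role of \<open>\<tau> \<le> \<tau>\<^sub>0\<close>: while the game goes on, the token is in \<open>\<Omega>\<close>, so the ball of the noise
  is contained in the arena and the transition has total mass \<open>1\<close>.
\<close>
lemma unstopped_in_domain:
  assumes "h \<in> space (PiM {..n} state)" "h \<notin> stopped n"
  shows "h n \<in> \<Omega>"
proof (rule ccontr)
  assume n: "h n \<notin> \<Omega>"
  from assms(1) obtain \<omega> where w: "\<omega> \<in> paths X x\<^sub>0" "restrict \<omega> {..n} = h" by (rule history_extends)
  have "h n \<in> X" using PiE_mem[OF history_in_PiE[OF assms(1)], of n] by simp
  moreover have "h n = \<omega> n" using w(2) by auto
  ultimately have "\<omega> n \<in> \<Gamma>" using n by (simp add: strip_eq)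
  then have "hitting_time \<Gamma> \<omega> \<le> enat n" unfolding hitting_time_def by (intro INF_lower) auto
  moreover have "\<tau> \<omega> \<le> hitting_time \<Gamma> \<omega>" using admissible w(1) by (auto simp: admissible_times_def)
  ultimately have "\<tau> \<omega> \<le> enat n" by (rule order_trans[rotated])
  then show False using stopped_iff[OF w(1), of n] w(2) assms(2) by simp
qed

lemma
  assumes "h \<in> space (PiM {..n} state)"
  shows strategy_I_ball: "\<sigma>\<^sub>I n h \<in> ball (h n) \<epsilon> \<inter> X" and strategy_II_ball: "\<sigma>\<^sub>I\<^sub>I n h \<in> ball (h n) \<epsilon> \<inter> X"
  using history_in_PiE[OF assms] strategy_I strategy_II unfolding strategies_def by blast+

lemma measurable_strategy_I [measurable]: "\<sigma>\<^sub>I n \<in> PiM {..n} state \<rightarrow>\<^sub>M borel_on X"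
  and measurable_strategy_II [measurable]: "\<sigma>\<^sub>I\<^sub>I n \<in> PiM {..n} state \<rightarrow>\<^sub>M borel_on X"
proof -
  have "\<sigma>\<^sub>I n \<in> (\<Pi>\<^sub>M i\<in>{..n}. borel_on X) \<rightarrow>\<^sub>M borel_on X"
    "\<sigma>\<^sub>I\<^sub>I n \<in> (\<Pi>\<^sub>M i\<in>{..n}. borel_on X) \<rightarrow>\<^sub>M borel_on X"
    using strategy_I strategy_II unfolding strategies_def by blast+
  from measurable_compose[OF measurable_history_arena this(1)]
    measurable_compose[OF measurable_history_arena this(2)]
  show "\<sigma>\<^sub>I n \<in> PiM {..n} state \<rightarrow>\<^sub>M borel_on X" "\<sigma>\<^sub>I\<^sub>I n \<in> PiM {..n} state \<rightarrow>\<^sub>M borel_on X" .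
qed

lemma emeasure_transition:
  assumes "h \<notin> stopped n" "A \<in> sets (borel_on X)"
  shows "emeasure (\<gamma> n h) A = ennreal (\<alpha> / 2) * indicator A (\<sigma>\<^sub>I n h) +
      ennreal (\<alpha> / 2) * indicator A (\<sigma>\<^sub>I\<^sub>I n h) +
      ennreal \<beta> * emeasure (uniform_measure lborel (ball (h n) \<epsilon>)) A"
proof -
  let ?m = "\<lambda>A. ennreal (\<alpha> / 2) * emeasure (return (borel_on X) (\<sigma>\<^sub>I n h)) A +
            ennreal (\<alpha> / 2) * emeasure (return (borel_on X) (\<sigma>\<^sub>I\<^sub>I n h)) A +
            ennreal \<beta> * emeasure (uniform_measure lborel (ball (h n) \<epsilon>)) A"
  have g: "\<gamma> n h = measure_of X (sets (borel_on X)) ?m"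
    using assms(1) by (simp add: transition_def)
  have "emeasure (\<gamma> n h) A = ?m A"
  proof (rule emeasure_measure_of[OF g])
    show "sets (borel_on X) \<subseteq> Pow X" by (auto simp: sets_restrict_space)
    show "A \<in> sets (\<gamma> n h)"
      using assms(2) sets.space_closed[of "borel_on X"] sets.sigma_sets_eq[of "borel_on X"]
      by (simp add: g space_restrict_space)
    show "positive (sets (\<gamma> n h)) ?m" by (simp add: positive_def)
    have sets_g: "sets (\<gamma> n h) = sets (borel_on X)"
      using sets.space_closed[of "borel_on X"] sets.sigma_sets_eq[of "borel_on X"]
      by (simp add: g space_restrict_space)
    show "countably_additive (sets (\<gamma> n h)) ?m"
      unfolding sets_g
    proof (rule countably_additiveI)
      fix B :: "nat \<Rightarrow> 'a set" assume B: "range B \<subseteq> sets (borel_on X)" "disjoint_family B"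
      have B': "range B \<subseteq> sets (uniform_measure lborel (ball (h n) \<epsilon>))"
        using B(1) by (auto simp: sets_restrict_space_iff)
      have r: "range B \<subseteq> sets (return (borel_on X) y)" for y using B(1) by simp
      show "(\<Sum>i. ?m (B i)) = ?m (\<Union>i. B i)"
        by (simp only: suminf_emeasure[OF r B(2), symmetric] suminf_emeasure[OF B' B(2), symmetric]
            ennreal_suminf_cmult[symmetric] suminf_add[OF summableI summableI])
    qed
  qed
  with assms(2) show ?thesis by simp
qed

lemma sets_transition [measurable_cong]: "sets (\<gamma> n h) = sets (borel_on X)"
  using sets.space_closed[of "borel_on X"] sets.sigma_sets_eq[of "borel_on X"]
  by (simp add: transition_def space_restrict_space)

lemma space_transition: "space (\<gamma> n h) = X"
  using sets_eq_imp_space_eq[OF sets_transition] by (simp add: space_restrict_space)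

lemma prob_space_transition:
  assumes h: "h \<in> space (PiM {..n} state)"
  shows "prob_space (\<gamma> n h)"
proof (cases "h \<in> stopped n")
  case True
  then show ?thesis using history_in_PiE[OF h]
    by (auto simp: transition_def space_restrict_space intro!: prob_space_return)
next
  case False
  have b: "ball (h n) \<epsilon> \<subseteq> X" using ball_subset_arena unstopped_in_domain[OF h False] by auto
  have "emeasure (\<gamma> n h) (space (\<gamma> n h)) =
      ennreal (\<alpha> / 2) + ennreal (\<alpha> / 2) + ennreal \<beta> * emeasure (uniform_measure lborel (ball (h n) \<epsilon>)) X"
    using strategy_I_ball[OF h] strategy_II_ball[OF h]
    by (subst emeasure_transition[OF False]) (auto simp: space_transition sets_restrict_space_iff)
  also have "emeasure (uniform_measure lborel (ball (h n) \<epsilon>)) X = 1"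
    using ball_measure_pos[of "h n"] b
    by (subst emeasure_uniform_measure)
      (auto simp: Int_absorb2 emeasure_ball_eq intro!: ennreal_divide_self)
  also have "ennreal (\<alpha> / 2) + ennreal (\<alpha> / 2) + ennreal \<beta> * 1 = ennreal (\<alpha> / 2 + \<alpha> / 2 + \<beta>)"
    using alpha_nonneg beta_nonneg by (subst ennreal_plus, simp, simp)+
  also have "\<alpha> / 2 + \<alpha> / 2 + \<beta> = 1" using alpha_beta by simp
  finally show ?thesis by (intro prob_spaceI) simp
qed

lemma nn_integral_transition:
  fixes f :: "'a \<Rightarrow> ennreal"
  assumes h: "h \<in> space (PiM {..n} state)" "h \<notin> stopped n" and f: "f \<in> borel_measurable borel"
  shows "(\<integral>\<^sup>+y. f y \<partial>\<gamma> n h) = ennreal (\<alpha> / 2) * f (\<sigma>\<^sub>I n h) + ennreal (\<alpha> / 2) * f (\<sigma>\<^sub>I\<^sub>I n h) +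
      ennreal \<beta> * (\<integral>\<^sup>+y. f y \<partial>uniform_measure lborel (ball (h n) \<epsilon>))"
  using f
proof induction
  case (cong f g)
  then show ?case by (simp cong: nn_integral_cong)
next
  case (set A)
  have AX: "A \<inter> X \<in> sets (borel_on X)" using set by (auto simp: sets_restrict_space)
  have "(\<integral>\<^sup>+y. indicator A y \<partial>\<gamma> n h) = (\<integral>\<^sup>+y. indicator (A \<inter> X) y \<partial>\<gamma> n h)"
    by (intro nn_integral_cong) (auto simp: space_transition split: split_indicator)
  also have "\<dots> = emeasure (\<gamma> n h) (A \<inter> X)"
    using AX by (simp add: sets_transition)
  also have "\<dots> = ennreal (\<alpha> / 2) * indicator A (\<sigma>\<^sub>I n h) + ennreal (\<alpha> / 2) * indicator A (\<sigma>\<^sub>I\<^sub>I n h) +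
      ennreal \<beta> * emeasure (uniform_measure lborel (ball (h n) \<epsilon>)) (A \<inter> X)"
    using strategy_I_ball[OF h(1)] strategy_II_ball[OF h(1)]
    by (subst emeasure_transition[OF h(2) AX]) (auto split: split_indicator)
  also have "emeasure (uniform_measure lborel (ball (h n) \<epsilon>)) (A \<inter> X) =
      emeasure (uniform_measure lborel (ball (h n) \<epsilon>)) A"
  proof -
    have "ball (h n) \<epsilon> \<inter> (A \<inter> X) = ball (h n) \<epsilon> \<inter> A"
      using ball_subset_arena[OF unstopped_in_domain[OF h]] by auto
    then show ?thesis using set by (simp add: emeasure_uniform_measure)
  qed
  finally show ?case using set by simp
next
  case (mult u c)
  then have "u \<in> borel_measurable (\<gamma> n h)"
    by (simp add: measurable_restrict_space1 cong: measurable_cong_sets[OF sets_transition refl])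
  moreover have "u \<in> borel_measurable (uniform_measure lborel (ball (h n) \<epsilon>))"
    using mult by (subst measurable_cong_sets[OF sets_uniform_measure refl]) simp
  ultimately show ?case using mult
    by (simp only: nn_integral_cmult distrib_left mult.left_commute[of c])
next
  case (add u v)
  then have "u \<in> borel_measurable (\<gamma> n h)" "v \<in> borel_measurable (\<gamma> n h)"
    by (simp_all add: measurable_restrict_space1 cong: measurable_cong_sets[OF sets_transition refl])
  moreover have "u \<in> borel_measurable (uniform_measure lborel (ball (h n) \<epsilon>))"
    "v \<in> borel_measurable (uniform_measure lborel (ball (h n) \<epsilon>))"
    using add by (subst measurable_cong_sets[OF sets_uniform_measure refl], simp)+
  ultimately show ?case using add by (simp only: nn_integral_add distrib_left ac_simps)
next
  case (seq U)
  then have m: "\<And>i. U i \<in> borel_measurable (\<gamma> n h)"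
    by (simp add: measurable_restrict_space1 cong: measurable_cong_sets[OF sets_transition refl])
  have inc: "incseq (\<lambda>i. U i y)" for y using seq(3) by (auto simp: mono_def le_fun_def)
  have I: "incseq (\<lambda>i. \<integral>\<^sup>+y. U i y \<partial>uniform_measure lborel (ball (h n) \<epsilon>))"
    using seq(3) by (auto simp: mono_def le_fun_def intro!: nn_integral_mono)
  have mc: "incseq (\<lambda>i. c * g i)" if "incseq g" for c and g :: "nat \<Rightarrow> ennreal"
    using that by (auto simp: mono_def intro!: mult_left_mono)
  have ma: "incseq (\<lambda>i. f i + g i)" if "incseq f" "incseq g" for f g :: "nat \<Rightarrow> ennreal"
    using that by (auto simp: mono_def intro!: add_mono)
  have "(\<integral>\<^sup>+y. (SUP i. U i) y \<partial>\<gamma> n h) = (SUP i. \<integral>\<^sup>+y. U i y \<partial>\<gamma> n h)"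
    unfolding SUP_apply by (rule nn_integral_monotone_convergence_SUP[OF seq(3) m])
  also have "\<dots> = (SUP i. ennreal (\<alpha> / 2) * U i (\<sigma>\<^sub>I n h) + ennreal (\<alpha> / 2) * U i (\<sigma>\<^sub>I\<^sub>I n h) +
      ennreal \<beta> * (\<integral>\<^sup>+y. U i y \<partial>uniform_measure lborel (ball (h n) \<epsilon>)))"
    using seq by simp
  also have "\<dots> = ennreal (\<alpha> / 2) * (SUP i. U i (\<sigma>\<^sub>I n h)) + ennreal (\<alpha> / 2) * (SUP i. U i (\<sigma>\<^sub>I\<^sub>I n h)) +
      ennreal \<beta> * (SUP i. \<integral>\<^sup>+y. U i y \<partial>uniform_measure lborel (ball (h n) \<epsilon>))"
    by (subst ennreal_SUP_add; (intro ma mc inc I)?)+ (simp add: SUP_mult_left_ennreal)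
  also have "(SUP i. \<integral>\<^sup>+y. U i y \<partial>uniform_measure lborel (ball (h n) \<epsilon>)) =
     (\<integral>\<^sup>+y. (SUP i. U i) y \<partial>uniform_measure lborel (ball (h n) \<epsilon>))"
    unfolding SUP_apply
    using seq by (intro nn_integral_monotone_convergence_SUP[symmetric])
      (simp_all add: measurable_cong_sets[OF sets_uniform_measure refl])
  finally show ?case by (simp only: SUP_apply image_image)
qed

lemma measurable_transition [measurable]:
  "\<gamma> n \<in> PiM {..n} state \<rightarrow>\<^sub>M subprob_algebra (borel_on X)"
proof (rule measurable_subprob_algebra)
  fix h assume "h \<in> space (PiM {..n} state)"
  then interpret prob_space "\<gamma> n h" by (rule prob_space_transition)
  show "subprob_space (\<gamma> n h)" by unfold_locales
  show "sets (\<gamma> n h) = sets (borel_on X)" by (rule sets_transition)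
next
  fix A assume A: "A \<in> sets (borel_on X)"
  then have A': "A \<in> sets borel" by (auto simp: sets_restrict_space_iff)
  have [measurable]: "(\<lambda>h. h n) \<in> PiM {..n} state \<rightarrow>\<^sub>M borel" by (rule measurable_coordinate) simp
  define \<phi> where "\<phi> x = emeasure lborel (ball x \<epsilon> \<inter> A)" for x
  let ?D = "{z \<in> space (borel \<Otimes>\<^sub>M (lborel :: 'a measure)). dist (fst z) (snd z) < \<epsilon> \<and> snd z \<in> A}"
  have "?D \<in> sets (borel \<Otimes>\<^sub>M lborel)" using A' by measurable
  then have "(\<lambda>(x, y). indicator ?D (x, y) :: ennreal) \<in> borel_measurable (borel \<Otimes>\<^sub>M lborel)"
    by simp
  then have "(\<lambda>x. \<integral>\<^sup>+y. indicator ?D (x, y) \<partial>lborel) \<in> borel_measurable (borel :: 'a measure)"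
    by (rule lborel.borel_measurable_nn_integral)
  also have "(\<lambda>x. \<integral>\<^sup>+y. indicator ?D (x, y) \<partial>lborel) = \<phi>"
  proof
    fix x
    have "\<phi> x = (\<integral>\<^sup>+y. indicator (ball x \<epsilon> \<inter> A) y \<partial>lborel)" using A' by (simp add: \<phi>_def)
    also have "\<dots> = (\<integral>\<^sup>+y. indicator ?D (x, y) \<partial>lborel)"
      by (intro nn_integral_cong) (auto simp: space_pair_measure split: split_indicator)
    finally show "(\<integral>\<^sup>+y. indicator ?D (x, y) \<partial>lborel) = \<phi> x" by simp
  qed
  finally have m1 [measurable]: "\<phi> \<in> borel_measurable borel" .
  have unif: "emeasure (uniform_measure lborel (ball x \<epsilon>)) A =
      \<phi> x / emeasure lborel (ball (0::'a) \<epsilon>)" for x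
    using A' eps_pos by (simp add: emeasure_uniform_measure emeasure_ball \<phi>_def)
  have [measurable]: "\<sigma>\<^sub>I n \<in> PiM {..n} state \<rightarrow>\<^sub>M borel" "\<sigma>\<^sub>I\<^sub>I n \<in> PiM {..n} state \<rightarrow>\<^sub>M borel"
    using measurable_strategy_I measurable_strategy_II by (auto simp: measurable_restrict_space2_iff)
  have "emeasure (\<gamma> n h) A = (if h \<in> stopped n then indicator A (h n) else
      ennreal (\<alpha> / 2) * indicator A (\<sigma>\<^sub>I n h) + ennreal (\<alpha> / 2) * indicator A (\<sigma>\<^sub>I\<^sub>I n h) +
      ennreal \<beta> * (\<phi> (h n) / emeasure lborel (ball (0::'a) \<epsilon>)))" for h
  proof (cases "h \<in> stopped n")
    case True
    then show ?thesis using A by (simp add: transition_def)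
  next
    case False
    then show ?thesis using emeasure_transition[OF False A] by (simp add: unif)
  qed
  then have "(\<lambda>h. emeasure (\<gamma> n h) A) \<in> borel_measurable (PiM {..n} state) \<longleftrightarrow>
     (\<lambda>h. if h \<in> stopped n then indicator A (h n) else ennreal (\<alpha> / 2) * indicator A (\<sigma>\<^sub>I n h) +
      ennreal (\<alpha> / 2) * indicator A (\<sigma>\<^sub>I\<^sub>I n h) +
      ennreal \<beta> * (\<phi> (h n) / emeasure lborel (ball (0::'a) \<epsilon>)))
      \<in> borel_measurable (PiM {..n} state)"
    by presburger
  also have "\<dots>"
    using A' by measurable
  finally show "(\<lambda>h. emeasure (\<gamma> n h) A) \<in> borel_measurable (PiM {..n} state)" .
qed

section \<open>The law of the play\<close>

text \<open>
  The Ionescu-Tulcea construction starts from the empty history, so the deterministic choice of \<open>x\<^sub>0\<close>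
  counts as the first transition.
\<close>
definition kernel :: "nat \<Rightarrow> (nat \<Rightarrow> 'a) \<Rightarrow> 'a measure" where
  "kernel n h = (case n of 0 \<Rightarrow> return (state 0) x\<^sub>0 | Suc m \<Rightarrow> \<gamma> m h)"

lemma first_indices: "{0..<Suc n} = {..n}"
  by auto

sublocale IT: Ionescu_Tulcea kernel state
proof (rule Ionescu_Tulcea.intro)
  fix i
  show "kernel i \<in> PiM {0..<i} state \<rightarrow>\<^sub>M subprob_algebra (state i)"
  proof (cases i)
    case 0
    have "prob_space (return (state 0) x\<^sub>0)" by (intro prob_space_return) (simp add: space_state)
    then have "return (state 0) x\<^sub>0 \<in> space (subprob_algebra (state 0))"
      by (auto simp: space_subprob_algebra intro: prob_space_imp_subprob_space)
    then show ?thesis by (simp add: 0 kernel_def[abs_def])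
  next
    case (Suc m)
    then have "kernel i = \<gamma> m" by (simp add: kernel_def[abs_def])
    then show ?thesis using measurable_transition[of m] by (simp add: Suc first_indices state_Suc)
  qed
  fix h assume h: "h \<in> space (PiM {0..<i} state)"
  show "prob_space (kernel i h)"
  proof (cases i)
    case 0
    then show ?thesis by (auto simp: kernel_def space_state intro: prob_space_return)
  next
    case (Suc m)
    then show ?thesis using prob_space_transition[of h m] h by (simp add: kernel_def first_indices)
  qed
qed

abbreviation path_law :: "(nat \<Rightarrow> 'a) measure" where "path_law \<equiv> IT.PF.lim"

lemma space_path_law: "space path_law = paths X x\<^sub>0"
  by (simp add: space_paths)

lemma measurable_restrict_law [measurable]: "(\<lambda>\<omega>. restrict \<omega> {..n}) \<in> path_law \<rightarrow>\<^sub>M PiM {..n} state"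
  using measurable_restrict_path by (simp cong: measurable_cong_sets)

lemma prob_space_path_law: "prob_space path_law"
  by (rule prob_space_distrD[OF measurable_restrict_law[of 0]])
    (auto simp: IT.distr_lim intro: IT.PF.prob_space_P)

lemma history_law: "distr path_law (PiM {..n} state) (\<lambda>\<omega>. restrict \<omega> {..n}) = IT.C 0 (Suc n) (\<lambda>_. undefined)"
proof -
  have up: "IT.up_to {0..<Suc n} = Suc n"
  proof (rule antisym)
    show "IT.up_to {0..<Suc n} \<le> Suc n" by (subst IT.up_to_iff) auto
    show "Suc n \<le> IT.up_to {0..<Suc n}" using IT.up_to_less[of "{0..<Suc n}" n] by simp
  qed
  have "distr path_law (PiM {..n} state) (\<lambda>\<omega>. restrict \<omega> {..n}) = IT.CI {0..<Suc n}"
    using IT.distr_lim[of "{0..<Suc n}"] by (simp only: first_indices) simp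
  also have "\<dots> = IT.C 0 (Suc n) (\<lambda>_. undefined)"
    unfolding IT.CI_def up using IT.distr_C[of "Suc n" "Suc n" "\<lambda>_. undefined" 0]
    by (simp add: space_PiM)
  finally show ?thesis .
qed

text \<open>
  Conditioning on the first \<open>n\<close> moves. All that is needed about the law of the play follows from this
  identity.
\<close>
lemma nn_integral_step:
  assumes f [measurable]: "f \<in> borel_measurable (PiM {..Suc n} state)"
  shows "(\<integral>\<^sup>+\<omega>. f (restrict \<omega> {..Suc n}) \<partial>path_law) =
    (\<integral>\<^sup>+\<omega>. (\<integral>\<^sup>+y. f ((restrict \<omega> {..n})(Suc n := y)) \<partial>\<gamma> n (restrict \<omega> {..n})) \<partial>path_law)"
proof -
  have u: "(\<lambda>_. undefined) \<in> space (PiM {0..<0} state)" by (simp add: space_PiM)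
  let ?g = "\<lambda>h. \<integral>\<^sup>+y. f (h(Suc n := y)) \<partial>\<gamma> n h"
  have f': "f \<in> borel_measurable (PiM {0..<Suc (Suc n)} state)" using f by (simp only: first_indices)
  have C: "sets (IT.C 0 (Suc n) (\<lambda>_. undefined)) = sets (PiM {0..<Suc n} state)"
    using IT.sets_C[OF u, of "Suc n"] by simp
  have eP: "IT.eP (Suc n) \<in> IT.C 0 (Suc n) (\<lambda>_. undefined) \<rightarrow>\<^sub>M subprob_algebra (PiM {0..<Suc (Suc n)} state)"
    using IT.measurable_eP[of "Suc n"] by (subst measurable_cong_sets[OF C refl])
  have "(\<integral>\<^sup>+\<omega>. f (restrict \<omega> {..Suc n}) \<partial>path_law) =
      (\<integral>\<^sup>+h. f h \<partial>distr path_law (PiM {..Suc n} state) (\<lambda>\<omega>. restrict \<omega> {..Suc n}))"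
    by (rule nn_integral_distr[symmetric]) measurable
  also have "\<dots> = (\<integral>\<^sup>+h. f h \<partial>(IT.C 0 (Suc n) (\<lambda>_. undefined) \<bind> IT.eP (Suc n)))"
    unfolding history_law IT.C.simps(2)[of 0 "Suc n"] by simp
  also have "\<dots> = (\<integral>\<^sup>+h. \<integral>\<^sup>+h'. f h' \<partial>IT.eP (Suc n) h \<partial>IT.C 0 (Suc n) (\<lambda>_. undefined))"
    by (rule nn_integral_bind[OF f' eP])
  also have "\<dots> = (\<integral>\<^sup>+h. ?g h \<partial>IT.C 0 (Suc n) (\<lambda>_. undefined))"
  proof (rule nn_integral_cong)
    fix h assume "h \<in> space (IT.C 0 (Suc n) (\<lambda>_. undefined))"
    then have "h \<in> space (PiM {0..<Suc n} state)" using sets_eq_imp_space_eq[OF C] by simp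
    then show "(\<integral>\<^sup>+h'. f h' \<partial>IT.eP (Suc n) h) = ?g h"
      by (subst IT.nn_integral_eP[OF _ f']) (auto simp: kernel_def)
  qed
  also have "\<dots> = (\<integral>\<^sup>+h. ?g h \<partial>distr path_law (PiM {..n} state) (\<lambda>\<omega>. restrict \<omega> {..n}))"
    unfolding history_law ..
  also have "\<dots> = (\<integral>\<^sup>+\<omega>. ?g (restrict \<omega> {..n}) \<partial>path_law)"
  proof (rule nn_integral_distr)
    have "(\<lambda>(h, y). f (h(Suc n := y))) \<in> borel_measurable (PiM {..n} state \<Otimes>\<^sub>M borel_on X)"
    proof -
      have "(\<lambda>p. (fst p)(Suc n := snd p)) \<in> PiM {..n} state \<Otimes>\<^sub>M state (Suc n) \<rightarrow>\<^sub>M PiM {..Suc n} state"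
        by (rule measurable_fun_upd[where J="{..n}"]) auto
      from measurable_compose[OF this f] show ?thesis by (simp add: case_prod_beta' state_Suc)
    qed
    from nn_integral_measurable_subprob_algebra2[OF this measurable_transition]
    show "?g \<in> borel_measurable (distr path_law (PiM {..n} state) (\<lambda>\<omega>. restrict \<omega> {..n}))" by simp
  qed measurable
  finally show ?thesis .
qed

lemma measurable_iterated_integral:
  assumes "\<forall>i\<ge>1. A i \<in> sets (borel_on X)"
  shows "iterated_integral \<gamma> A m k \<in> borel_measurable (PiM {..k} state)"
proof (induction m arbitrary: k)
  case 0
  then show ?case by simp
next
  case (Suc m)
  have A [measurable]: "A (Suc k) \<in> sets (borel_on X)" using assms by auto
  have "(\<lambda>p. (fst p)(Suc k := snd p)) \<in> PiM {..k} state \<Otimes>\<^sub>M state (Suc k) \<rightarrow>\<^sub>M PiM {..Suc k} state"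
    by (rule measurable_fun_upd[where J="{..k}"]) auto
  from measurable_compose[OF this Suc.IH]
  have [measurable]: "(\<lambda>p. iterated_integral \<gamma> A m (Suc k) ((fst p)(Suc k := snd p)))
      \<in> borel_measurable (PiM {..k} state \<Otimes>\<^sub>M borel_on X)" by (simp only: state_Suc)
  have "(\<lambda>(h, y). iterated_integral \<gamma> A m (Suc k) (h(Suc k := y)) * indicator (A (Suc k)) y)
      \<in> borel_measurable (PiM {..k} state \<Otimes>\<^sub>M borel_on X)"
    unfolding case_prod_beta' by measurable
  from nn_integral_measurable_subprob_algebra2[OF this measurable_transition[of k]]
  show ?case by simp
qed

text \<open>
  Let \<open>g k\<close> be the indicator of \<open>x\<^sub>1 \<in> A\<^sub>1, \<dots>, x\<^sub>k \<in> A\<^sub>k\<close> times the iterated integral over the remaining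
  \<open>n - k\<close> coordinates. By conditioning, the expectation of \<open>g k\<close> along the play is the same for all \<open>k\<close>; it is the
  probability of the cylinder for \<open>k = n\<close> and the full iterated integral for \<open>k = 0\<close>.
\<close>
lemma emeasure_path_law_cylinder:
  assumes A: "\<forall>i\<in>{1..n}. A i \<in> sets (borel_on X)"
  shows "emeasure path_law (cylinder X x\<^sub>0 n A) = iterated_integral \<gamma> A n 0 (restrict (\<lambda>_. x\<^sub>0) {..0})"
proof -
  interpret prob_space path_law by (rule prob_space_path_law)
  \<comment> \<open>Continued by the whole arena, so that all sets of the sequence are measurable.\<close>
  define A' where "A' i = (if i \<le> n then A i else X)" for i
  have A': "\<forall>i\<ge>1. A' i \<in> sets (borel_on X)"
    using A sets.top[of "borel_on X"] by (auto simp: A'_def space_restrict_space)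
  have it: "iterated_integral \<gamma> A m k h = iterated_integral \<gamma> A' m k h" if "m + k \<le> n" for m k h
    using that by (induction m arbitrary: k h) (auto simp: A'_def)
  define g :: "nat \<Rightarrow> (nat \<Rightarrow> 'a) \<Rightarrow> ennreal" where "g k h = (if \<forall>i\<in>{1..k}. h i \<in> A' i then iterated_integral \<gamma> A' (n - k) k h else 0)" for k h
  have g [measurable]: "g k \<in> borel_measurable (PiM {..k} state)" for k
  proof -
    have c [measurable]: "(\<lambda>h. h i) \<in> PiM {..k} state \<rightarrow>\<^sub>M borel" if "i \<in> {1..k}" for i
      using that by (intro measurable_coordinate) auto
    have "A' i \<in> sets borel" if "i \<in> {1..k}" for i using A' that by (auto simp: sets_restrict_space_iff)
    then have "Measurable.pred (PiM {..k} state) (\<lambda>h. \<forall>i\<in>{1..k}. h i \<in> A' i)"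
      using c by (intro pred_intros_countable_bounded pred_intros_finite) (auto intro!: pred_sets2)
    then show ?thesis unfolding g_def[abs_def]
      using measurable_iterated_integral[OF A'] by measurable
  qed
  have step: "(\<integral>\<^sup>+\<omega>. g (Suc k) (restrict \<omega> {..Suc k}) \<partial>path_law) = (\<integral>\<^sup>+\<omega>. g k (restrict \<omega> {..k}) \<partial>path_law)"
    if k: "k < n" for k
  proof (subst nn_integral_step[OF g], rule nn_integral_cong)
    fix \<omega> :: "nat \<Rightarrow> 'a"
    define h where "h = restrict \<omega> {..k}"
    have nk: "n - k = Suc (n - Suc k)" using k by simp
    have "(\<forall>i\<in>{1..Suc k}. (h(Suc k := y)) i \<in> A' i) \<longleftrightarrow> (\<forall>i\<in>{1..k}. h i \<in> A' i) \<and> y \<in> A' (Suc k)" for y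
      by (force simp: le_Suc_eq)
    moreover define Q where "Q \<longleftrightarrow> (\<forall>i\<in>{1..k}. h i \<in> A' i)"
    ultimately have "g (Suc k) (h(Suc k := y)) = (if Q
        then iterated_integral \<gamma> A' (n - Suc k) (Suc k) (h(Suc k := y)) * indicator (A' (Suc k)) y else 0)" for y
      unfolding g_def by (auto split: split_indicator)
    moreover have "g k h = (if Q then iterated_integral \<gamma> A' (n - k) k h else 0)"
      by (simp add: g_def Q_def)
    ultimately show "(\<integral>\<^sup>+y. g (Suc k) (h(Suc k := y)) \<partial>\<gamma> k h) = g k h"
      by (cases Q) (simp_all add: nk)
  qed
  have "(\<integral>\<^sup>+\<omega>. g k (restrict \<omega> {..k}) \<partial>path_law) = (\<integral>\<^sup>+\<omega>. g 0 (restrict \<omega> {..0}) \<partial>path_law)" if "k \<le> n" for k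
    using that by (induction k) (simp_all add: step)
  from this[of n]
  have "(\<integral>\<^sup>+\<omega>. g n (restrict \<omega> {..n}) \<partial>path_law) = (\<integral>\<^sup>+\<omega>. g 0 (restrict \<omega> {..0}) \<partial>path_law)" by simp
  also have "\<dots> = (\<integral>\<^sup>+\<omega>. iterated_integral \<gamma> A n 0 (restrict (\<lambda>_. x\<^sub>0) {..0}) \<partial>path_law)"
  proof (rule nn_integral_cong)
    fix \<omega> assume "\<omega> \<in> space path_law"
    then have "restrict \<omega> {..0} = restrict (\<lambda>_. x\<^sub>0) {..0}"
      by (auto simp: space_paths paths_def fun_eq_iff)
    then show "g 0 (restrict \<omega> {..0}) = iterated_integral \<gamma> A n 0 (restrict (\<lambda>_. x\<^sub>0) {..0})"
      by (simp add: g_def it)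
  qed
  also have "\<dots> = iterated_integral \<gamma> A n 0 (restrict (\<lambda>_. x\<^sub>0) {..0})"
    using emeasure_space_1 by simp
  also have "(\<integral>\<^sup>+\<omega>. g n (restrict \<omega> {..n}) \<partial>path_law) = (\<integral>\<^sup>+\<omega>. indicator (cylinder X x\<^sub>0 n A) \<omega> \<partial>path_law)"
    by (intro nn_integral_cong)
      (auto simp: g_def cylinder_def space_paths A'_def split: split_indicator)
  also have "\<dots> = emeasure path_law (cylinder X x\<^sub>0 n A)"
  proof (rule nn_integral_indicator)
    obtain B where B: "B \<in> sets (PiM {..n} state)"
      "cylinder X x\<^sub>0 n A = (\<lambda>\<omega>. restrict \<omega> {..n}) -` B \<inter> space path_law"
      using cylinder_eq[OF A] by (auto simp: space_paths)
    then show "cylinder X x\<^sub>0 n A \<in> sets path_law"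
      using measurable_sets[OF measurable_restrict_law B(1)] by simp
  qed
  finally show ?thesis .
qed

lemma sets_path_law:
  defines "E \<equiv> {cylinder X x\<^sub>0 n A | n A. n \<ge> 1 \<and> (\<forall>i\<in>{1..n}. A i \<in> sets (borel_on X))}"
  shows "sets path_law = sigma_sets (paths X x\<^sub>0) E" (is ?thesis1)
    and "sets (path_algebra X x\<^sub>0) = sets path_law"
proof -
  let ?F = "\<Union>n\<in>{1..}. sets (path_filtration X x\<^sub>0 n)"
  have F: "?F \<subseteq> sets path_law"
  proof safe
    fix S and n :: nat assume "S \<in> sets (path_filtration X x\<^sub>0 n)"
    then obtain B where B: "B \<in> sets (PiM {..n} state)"
      "S = (\<lambda>\<omega>. restrict \<omega> {..n}) -` B \<inter> space path_law"
      unfolding space_path_law by (rule sets_path_filtration)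
    show "S \<in> sets path_law"
      unfolding B(2) by (rule measurable_sets[OF measurable_restrict_law B(1)])
  qed
  have EF: "E \<subseteq> ?F"
  proof
    fix S assume "S \<in> E"
    then obtain n A where S: "n \<ge> 1" "S = cylinder X x\<^sub>0 n A" "\<forall>i\<in>{1..n}. A i \<in> sets (borel_on X)"
      by (auto simp: E_def)
    then have "S \<in> sets (path_filtration X x\<^sub>0 n)"
      unfolding path_filtration_def by (subst sets_measure_of) (auto simp: cylinder_def)
    with S(1) show "S \<in> ?F" by auto
  qed
  have space: "sigma_sets (paths X x\<^sub>0) \<A> \<subseteq> sets path_law" if "\<A> \<subseteq> sets path_law" for \<A>
    using sets.sigma_sets_subset[OF that] by (simp only: space_path_law)
  have single: "{f \<in> (\<Pi>\<^sub>E i\<in>UNIV. space (state i)). f i \<in> B} \<in> sigma_sets (paths X x\<^sub>0) E"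
    if B: "B \<in> sets (state i)" for i B
  proof (cases "i = 0")
    case True
    with B have "B \<subseteq> {x\<^sub>0}" by (auto simp: sets_state space_state)
    then have "{f \<in> (\<Pi>\<^sub>E i\<in>UNIV. space (state i)). f i \<in> B} = (if x\<^sub>0 \<in> B then paths X x\<^sub>0 else {})"
      using True by (auto simp flip: space_paths simp: space_PiM) (auto simp: space_state split: if_splits)
    then show ?thesis by (simp add: sigma_sets_top sigma_sets.Empty)
  next
    case False
    then have BX: "B \<in> sets (borel_on X)" using B by (simp add: state_def)
    let ?A = "\<lambda>j. if j = i then B else X"
    have "{f \<in> (\<Pi>\<^sub>E i\<in>UNIV. space (state i)). f i \<in> B} = cylinder X x\<^sub>0 i ?A"
      using False unfolding space_PiM[symmetric] space_paths by (auto simp: cylinder_def paths_def)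
    moreover have "cylinder X x\<^sub>0 i ?A \<in> E"
      unfolding E_def using False BX sets.top[of "borel_on X"]
      by (intro CollectI exI[of _ i] exI[of _ ?A]) (auto simp: space_restrict_space)
    ultimately show ?thesis by (simp add: sigma_sets.Basic)
  qed
  have "sets path_law \<subseteq> sigma_sets (paths X x\<^sub>0) E"
  proof -
    have "sets path_law = sigma_sets (paths X x\<^sub>0)
      {{f \<in> (\<Pi>\<^sub>E i\<in>UNIV. space (state i)). f i \<in> A} | i A. i \<in> UNIV \<and> A \<in> sets (state i)}"
      using sets_PiM_single[of UNIV state] by (simp flip: space_paths add: space_PiM)
    also have "\<dots> \<subseteq> sigma_sets (paths X x\<^sub>0) E"
      using single by (intro sigma_sets_mono) blast
    finally show ?thesis .
  qed
  with space[of E] EF F show E: ?thesis1 by blast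
  have "sets (path_algebra X x\<^sub>0) = sigma_sets (paths X x\<^sub>0) ?F"
    unfolding path_algebra_def
    using F sets.space_closed[of path_law] unfolding space_path_law by (intro sets_measure_of) blast
  moreover have "\<dots> = sets path_law"
    using space[OF F] E sigma_sets_mono'[OF EF, of "paths X x\<^sub>0"] by blast
  ultimately show "sets (path_algebra X x\<^sub>0) = sets path_law" by simp
qed

lemma cylinder_Int:
  assumes "n \<le> m" "\<forall>i\<in>{1..n}. A i \<subseteq> X"
  shows "cylinder X x\<^sub>0 n A \<inter> cylinder X x\<^sub>0 m B = cylinder X x\<^sub>0 m (\<lambda>i. if i \<le> n then A i \<inter> B i else B i)"
  using assms by (auto simp: cylinder_def)

text \<open>
  The law obtained from the Ionescu-Tulcea theorem has the prescribed values on cylinders; these are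
  stable under intersection and generate the \<open>\<sigma>\<close>-algebra, so no other probability measure has them.
\<close>
lemma game_measure_eq: "game_measure X \<epsilon> \<alpha> \<beta> x\<^sub>0 \<tau> \<sigma>\<^sub>I \<sigma>\<^sub>I\<^sub>I = path_law"
  unfolding game_measure_def
proof (rule the_equality)
  show "prob_space path_law \<and> space path_law = paths X x\<^sub>0 \<and> sets path_law = sets (path_algebra X x\<^sub>0) \<and>
     (\<forall>n\<ge>1. \<forall>A. (\<forall>i\<in>{1..n}. A i \<in> sets (borel_on X)) \<longrightarrow>
       emeasure path_law (cylinder X x\<^sub>0 n A) = iterated_integral \<gamma> A n 0 (restrict (\<lambda>_. x\<^sub>0) {..0}))"
    using prob_space_path_law space_path_law sets_path_law(2) emeasure_path_law_cylinder by simp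
next
  fix P
  assume P: "prob_space P \<and> space P = paths X x\<^sub>0 \<and> sets P = sets (path_algebra X x\<^sub>0) \<and>
     (\<forall>n\<ge>1. \<forall>A. (\<forall>i\<in>{1..n}. A i \<in> sets (borel_on X)) \<longrightarrow>
       emeasure P (cylinder X x\<^sub>0 n A) = iterated_integral \<gamma> A n 0 (restrict (\<lambda>_. x\<^sub>0) {..0}))"
  let ?E = "{cylinder X x\<^sub>0 n A | n A. n \<ge> 1 \<and> (\<forall>i\<in>{1..n}. A i \<in> sets (borel_on X))}"
  show "P = path_law"
  proof (rule measure_eqI_generator_eq[where E="?E" and \<Omega>="paths X x\<^sub>0" and A="\<lambda>_. paths X x\<^sub>0"])
    show "Int_stable ?E"
    proof (rule Int_stableI)
      have *: "cylinder X x\<^sub>0 n A \<inter> cylinder X x\<^sub>0 m B \<in> ?E"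
        if "n \<ge> 1" "n \<le> m" "\<forall>i\<in>{1..n}. A i \<in> sets (borel_on X)" "\<forall>i\<in>{1..m}. B i \<in> sets (borel_on X)"
        for n m A B
      proof -
        have "\<forall>i\<in>{1..n}. A i \<subseteq> X" using that(3) by (auto simp: sets_restrict_space_iff)
        moreover have "\<forall>i\<in>{1..m}. (if i \<le> n then A i \<inter> B i else B i) \<in> sets (borel_on X)"
          using that by auto
        ultimately show ?thesis using that(1,2) cylinder_Int[OF that(2)] by fastforce
      qed
      fix a b assume "a \<in> ?E" "b \<in> ?E"
      then obtain n A m B where a: "n \<ge> 1" "a = cylinder X x\<^sub>0 n A" "\<forall>i\<in>{1..n}. A i \<in> sets (borel_on X)"
        and b: "m \<ge> 1" "b = cylinder X x\<^sub>0 m B" "\<forall>i\<in>{1..m}. B i \<in> sets (borel_on X)" by auto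
      show "a \<inter> b \<in> ?E"
      proof (cases "n \<le> m")
        case True
        show ?thesis unfolding a(2) b(2) by (rule *[OF a(1) True a(3) b(3)])
      next
        case False
        then have "m \<le> n" by simp
        from *[OF b(1) this b(3) a(3)] show ?thesis unfolding a(2) b(2) by (simp only: Int_commute)
      qed
    qed
    show "?E \<subseteq> Pow (paths X x\<^sub>0)" by (auto simp: cylinder_def)
    show "emeasure P S = emeasure path_law S" if "S \<in> ?E" for S
      using that P emeasure_path_law_cylinder by auto
    show "sets P = sigma_sets (paths X x\<^sub>0) ?E" using P sets_path_law by simp
    show "sets path_law = sigma_sets (paths X x\<^sub>0) ?E" by (rule sets_path_law)
    have "paths X x\<^sub>0 = cylinder X x\<^sub>0 1 (\<lambda>_. X)" by (auto simp: cylinder_def paths_def)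
    moreover have "cylinder X x\<^sub>0 1 (\<lambda>_. X) \<in> ?E"
      using sets.top[of "borel_on X"] by (auto simp: space_restrict_space)
    ultimately show "range (\<lambda>_::nat. paths X x\<^sub>0) \<subseteq> ?E" by simp
    interpret prob_space P using P by simp
    show "emeasure P (paths X x\<^sub>0) \<noteq> \<infinity>" for i :: nat by simp
  qed simp
qed

section \<open>Drift and termination\<close>

lemma measurable_law_coordinate [measurable]: "(\<lambda>\<omega>. \<omega> n) \<in> path_law \<rightarrow>\<^sub>M borel"
  using measurable_coordinate[of n UNIV] by (simp cong: measurable_cong_sets)

lemma measurable_stopped_by [measurable]: "Measurable.pred path_law (\<lambda>\<omega>. \<tau> \<omega> \<le> enat n)"
proof -
  have "(\<lambda>\<omega>. restrict \<omega> {..n}) -` stopped n \<inter> space path_law \<in> sets path_law"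
    by measurable
  also have "(\<lambda>\<omega>. restrict \<omega> {..n}) -` stopped n \<inter> space path_law = {\<omega> \<in> space path_law. \<tau> \<omega> \<le> enat n}"
    using stopped_iff by (auto simp: space_paths simp del: restrict_apply)
  finally show ?thesis unfolding pred_def .
qed

lemma nn_integral_transition_real:
  assumes h: "h \<in> space (PiM {..n} state)" "h \<notin> stopped n"
    and f: "f \<in> borel_measurable borel" "\<And>y. 0 \<le> f y" "\<And>y. f y \<le> C"
  shows "(\<integral>\<^sup>+y. ennreal (f y) \<partial>\<gamma> n h) =
    ennreal (\<alpha> / 2 * f (\<sigma>\<^sub>I n h) + \<alpha> / 2 * f (\<sigma>\<^sub>I\<^sub>I n h) + \<beta> * ball_mean f (h n))"
proof -
  have "(\<integral>\<^sup>+y. ennreal (f y) \<partial>\<gamma> n h) = ennreal (\<alpha> / 2) * ennreal (f (\<sigma>\<^sub>I n h)) +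
      ennreal (\<alpha> / 2) * ennreal (f (\<sigma>\<^sub>I\<^sub>I n h)) + ennreal \<beta> * ennreal (ball_mean f (h n))"
    using f(1) by (subst nn_integral_transition[OF h]) (simp_all add: nn_integral_uniform_ball(1)[OF f])
  also have "\<dots> = ennreal (\<alpha> / 2 * f (\<sigma>\<^sub>I n h)) + ennreal (\<alpha> / 2 * f (\<sigma>\<^sub>I\<^sub>I n h)) +
      ennreal (\<beta> * ball_mean f (h n))"
    using alpha_nonneg beta_nonneg f nn_integral_uniform_ball(2)[OF f] by (simp only: ennreal_mult)
  also have "\<dots> = ennreal (\<alpha> / 2 * f (\<sigma>\<^sub>I n h) + \<alpha> / 2 * f (\<sigma>\<^sub>I\<^sub>I n h) + \<beta> * ball_mean f (h n))"
    using alpha_nonneg beta_nonneg f nn_integral_uniform_ball(2)[OF f] by simp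
  finally show ?thesis .
qed

text \<open>
  One turn, restricted to the event that the game still goes on. Adding the constant \<open>C\<close> to \<open>v\<close> makes
  all integrands nonnegative, so the conditioning identity for nonnegative functions applies; the
  constant passes through the transition because \<open>\<alpha> + \<beta> = 1\<close>.
\<close>
lemma alive_increment:
  assumes v: "v \<in> borel_measurable borel" "\<And>y. \<bar>v y\<bar> \<le> C" and c: "0 \<le> c"
    and drift: "\<And>n h. h \<in> space (PiM {..n} state) \<Longrightarrow> h \<notin> stopped n \<Longrightarrow>
      v (h n) + c \<le> \<alpha> / 2 * v (\<sigma>\<^sub>I n h) + \<alpha> / 2 * v (\<sigma>\<^sub>I\<^sub>I n h) + \<beta> * ball_mean v (h n)"
  shows "(\<integral>\<omega>. (if \<tau> \<omega> \<le> enat n then 0 else v (\<omega> n) + c) \<partial>path_law)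
    \<le> (\<integral>\<omega>. (if \<tau> \<omega> \<le> enat n then 0 else v (\<omega> (Suc n))) \<partial>path_law)"
proof -
  interpret prob_space path_law by (rule prob_space_path_law)
  note [measurable] = v(1)
  define q where "q y = v y + C" for y
  have q [measurable]: "q \<in> borel_measurable borel" "\<And>y. 0 \<le> q y" "\<And>y. q y \<le> 2 * C"
    using v(2) by (auto simp: q_def[abs_def] abs_le_iff algebra_simps) (smt (verit))+
  have mean: "ball_mean q x = ball_mean v x + C" for x
    unfolding q_def using ball_mean_add[of x v "\<lambda>_. C"] set_integrable_ball[OF v, of x \<epsilon>]
      set_integrable_ball[of "\<lambda>_. C" "\<bar>C\<bar>" x \<epsilon>] by (simp add: ball_mean_const)
  define f where "f h = (if restrict h {..n} \<in> stopped n then 0 else ennreal (q (h (Suc n))))" for h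
  have [measurable]: "(\<lambda>h. restrict h {..n}) \<in> PiM {..Suc n} state \<rightarrow>\<^sub>M PiM {..n} state"
    by (rule measurable_restrict_subset) auto
  have [measurable]: "(\<lambda>h. h (Suc n)) \<in> PiM {..Suc n} state \<rightarrow>\<^sub>M borel" by (rule measurable_coordinate) simp
  have f [measurable]: "f \<in> borel_measurable (PiM {..Suc n} state)" unfolding f_def[abs_def] by measurable
  have "(\<integral>\<^sup>+\<omega>. (if \<tau> \<omega> \<le> enat n then 0 else ennreal (v (\<omega> n) + (c + C))) \<partial>path_law)
      \<le> (\<integral>\<^sup>+\<omega>. (\<integral>\<^sup>+y. f ((restrict \<omega> {..n})(Suc n := y)) \<partial>\<gamma> n (restrict \<omega> {..n})) \<partial>path_law)"
  proof (rule nn_integral_mono)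
    fix \<omega> assume "\<omega> \<in> space path_law"
    then have w: "\<omega> \<in> paths X x\<^sub>0" by (simp add: space_paths)
    define h where "h = restrict \<omega> {..n}"
    have h: "h \<in> space (PiM {..n} state)" unfolding h_def by (rule restrict_path_in_space[OF w])
    have hn: "h n = \<omega> n" by (simp add: h_def)
    have r: "restrict (h(Suc n := y)) {..n} = h" for y by (auto simp: h_def)
    show "(if \<tau> \<omega> \<le> enat n then 0 else ennreal (v (\<omega> n) + (c + C)))
        \<le> (\<integral>\<^sup>+y. f (h(Suc n := y)) \<partial>\<gamma> n h)"
    proof (cases "\<tau> \<omega> \<le> enat n")
      case False
      then have live: "h \<notin> stopped n" using stopped_iff[OF w, of n] by (simp add: h_def)
      have "ennreal (v (\<omega> n) + (c + C))
          \<le> ennreal (\<alpha> / 2 * q (\<sigma>\<^sub>I n h) + \<alpha> / 2 * q (\<sigma>\<^sub>I\<^sub>I n h) + \<beta> * ball_mean q (h n))"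
      proof (rule ennreal_leI)
        have "\<alpha> / 2 * q (\<sigma>\<^sub>I n h) + \<alpha> / 2 * q (\<sigma>\<^sub>I\<^sub>I n h) + \<beta> * ball_mean q (h n) =
          \<alpha> / 2 * v (\<sigma>\<^sub>I n h) + \<alpha> / 2 * v (\<sigma>\<^sub>I\<^sub>I n h) + \<beta> * ball_mean v (h n) + (\<alpha> + \<beta>) * C"
          unfolding mean q_def by (simp add: field_simps)
        then show "v (\<omega> n) + (c + C)
            \<le> \<alpha> / 2 * q (\<sigma>\<^sub>I n h) + \<alpha> / 2 * q (\<sigma>\<^sub>I\<^sub>I n h) + \<beta> * ball_mean q (h n)"
          using drift[OF h live] by (simp add: alpha_beta hn)
      qed
      also have "\<dots> = (\<integral>\<^sup>+y. ennreal (q y) \<partial>\<gamma> n h)"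
        by (rule nn_integral_transition_real[OF h live q, symmetric])
      also have "\<dots> = (\<integral>\<^sup>+y. f (h(Suc n := y)) \<partial>\<gamma> n h)"
        unfolding f_def r using live by simp
      finally show ?thesis using False by simp
    qed simp
  qed
  also have "\<dots> = (\<integral>\<^sup>+\<omega>. f (restrict \<omega> {..Suc n}) \<partial>path_law)"
    by (rule nn_integral_step[OF f, symmetric])
  also have "\<dots> = (\<integral>\<^sup>+\<omega>. (if \<tau> \<omega> \<le> enat n then 0 else ennreal (q (\<omega> (Suc n)))) \<partial>path_law)"
  proof (rule nn_integral_cong)
    fix \<omega> assume "\<omega> \<in> space path_law"
    then have w: "\<omega> \<in> paths X x\<^sub>0" by (simp add: space_paths)
    have "restrict (restrict \<omega> {..Suc n}) {..n} = restrict \<omega> {..n}" by auto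
    then show "f (restrict \<omega> {..Suc n}) = (if \<tau> \<omega> \<le> enat n then 0 else ennreal (q (\<omega> (Suc n))))"
      unfolding f_def using stopped_iff[OF w, of n] by simp
  qed
  finally have le: "(\<integral>\<^sup>+\<omega>. ennreal (if \<tau> \<omega> \<le> enat n then 0 else v (\<omega> n) + (c + C)) \<partial>path_law)
    \<le> (\<integral>\<^sup>+\<omega>. ennreal (if \<tau> \<omega> \<le> enat n then 0 else v (\<omega> (Suc n)) + C) \<partial>path_law)"
    by (simp only: if_distrib[of ennreal] ennreal_0 q_def)
  have b: "\<bar>v y\<bar> \<le> \<bar>C\<bar>" for y using v(2)[of y] by simp
  have int1: "integrable path_law (\<lambda>\<omega>. if \<tau> \<omega> \<le> enat n then 0 else v (\<omega> k) + d)" for k d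
    using b by (intro integrable_const_bound[where B="\<bar>C\<bar> + \<bar>d\<bar>"]) (auto intro: order_trans[OF abs_triangle_ineq] add_mono)
  have int2: "integrable path_law (\<lambda>\<omega>. if \<tau> \<omega> \<le> enat n then 0 else d::real)" for d
    by (intro integrable_const_bound[where B="\<bar>d\<bar>"]) auto
  have nonneg: "0 \<le> v y + C" for y using v(2)[of y] by (simp add: abs_le_iff)
  have nonneg2: "0 \<le> v y + (c + C)" for y using nonneg[of y] c by simp
  have "(\<integral>\<omega>. (if \<tau> \<omega> \<le> enat n then 0 else v (\<omega> n) + (c + C)) \<partial>path_law)
    \<le> (\<integral>\<omega>. (if \<tau> \<omega> \<le> enat n then 0 else v (\<omega> (Suc n)) + C) \<partial>path_law)"
  proof -
    have "ennreal (\<integral>\<omega>. (if \<tau> \<omega> \<le> enat n then 0 else v (\<omega> n) + (c + C)) \<partial>path_law)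
      = (\<integral>\<^sup>+\<omega>. ennreal (if \<tau> \<omega> \<le> enat n then 0 else v (\<omega> n) + (c + C)) \<partial>path_law)"
      using int1[of n "c + C"] nonneg2 by (intro nn_integral_eq_integral[symmetric]) auto
    also note le
    also have "(\<integral>\<^sup>+\<omega>. ennreal (if \<tau> \<omega> \<le> enat n then 0 else v (\<omega> (Suc n)) + C) \<partial>path_law)
       = ennreal (\<integral>\<omega>. (if \<tau> \<omega> \<le> enat n then 0 else v (\<omega> (Suc n)) + C) \<partial>path_law)"
      using int1[of "Suc n" C] nonneg by (intro nn_integral_eq_integral) auto
    finally show ?thesis
      using nonneg by (subst (asm) ennreal_le_iff) (auto intro!: integral_nonneg_AE)
  qed
  moreover have "(\<integral>\<omega>. (if \<tau> \<omega> \<le> enat n then 0 else v (\<omega> n) + (c + C)) \<partial>path_law) =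
      (\<integral>\<omega>. (if \<tau> \<omega> \<le> enat n then 0 else v (\<omega> n) + c) \<partial>path_law) +
      (\<integral>\<omega>. (if \<tau> \<omega> \<le> enat n then 0 else C) \<partial>path_law)"
    by (subst Bochner_Integration.integral_add[OF int1 int2, symmetric])
      (auto intro!: Bochner_Integration.integral_cong)
  moreover have "(\<integral>\<omega>. (if \<tau> \<omega> \<le> enat n then 0 else v (\<omega> (Suc n)) + C) \<partial>path_law) =
      (\<integral>\<omega>. (if \<tau> \<omega> \<le> enat n then 0 else v (\<omega> (Suc n))) \<partial>path_law) +
      (\<integral>\<omega>. (if \<tau> \<omega> \<le> enat n then 0 else C) \<partial>path_law)"
    using int1[of "Suc n" 0, unfolded add_0_right] by (subst Bochner_Integration.integral_add[OF _ int2, symmetric])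
      (auto intro!: Bochner_Integration.integral_cong)
  ultimately show ?thesis by simp
qed

text \<open>
  The process \<open>v (x\<^bsub>min n \<tau>\<^esub>)\<close>. The recursion makes it evident that it is measurable, although \<open>\<tau>\<close> only
  is known through the events \<open>{\<tau> \<le> n}\<close>.
\<close>
primrec stopped_process :: "('a \<Rightarrow> real) \<Rightarrow> nat \<Rightarrow> (nat \<Rightarrow> 'a) \<Rightarrow> real" where
  "stopped_process v 0 \<omega> = v (\<omega> 0)"
| "stopped_process v (Suc n) \<omega> = (if \<tau> \<omega> \<le> enat n then stopped_process v n \<omega> else v (\<omega> (Suc n)))"

lemma stopped_process_eq: "stopped_process v n \<omega> = (if \<tau> \<omega> \<le> enat n then stopped_payoff v \<tau> \<omega> else v (\<omega> n))"
proof (induction n)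
  case 0
  then show ?case
    by (cases "\<tau> \<omega>") (auto simp: stopped_payoff_def)
next
  case (Suc n)
  show ?case
  proof (cases "\<tau> \<omega> = enat (Suc n)")
    case True
    then show ?thesis by (simp add: stopped_payoff_def)
  next
    case False
    then have "\<tau> \<omega> \<le> enat (Suc n) \<longleftrightarrow> \<tau> \<omega> \<le> enat n" by (cases "\<tau> \<omega>") auto
    then show ?thesis using Suc by simp
  qed
qed

lemma measurable_stopped_process [measurable]:
  assumes [measurable]: "v \<in> borel_measurable borel"
  shows "stopped_process v n \<in> borel_measurable path_law"
proof (induction n)
  case 0
  have "stopped_process v 0 = (\<lambda>\<omega>. v (\<omega> 0))" by (simp add: fun_eq_iff)
  then show ?case by simp
next
  case (Suc n)
  note [measurable] = Suc
  have "stopped_process v (Suc n) = (\<lambda>\<omega>. if \<tau> \<omega> \<le> enat n then stopped_process v n \<omega> else v (\<omega> (Suc n)))"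
    by (simp add: fun_eq_iff)
  then show ?case by simp
qed

lemma stopped_process_tendsto: "\<tau> \<omega> \<noteq> \<infinity> \<Longrightarrow> (\<lambda>n. stopped_process v n \<omega>) \<longlonglongrightarrow> stopped_payoff v \<tau> \<omega>"
proof -
  assume "\<tau> \<omega> \<noteq> \<infinity>"
  then obtain k where "\<tau> \<omega> = enat k" by auto
  then have "eventually (\<lambda>n. stopped_process v n \<omega> = stopped_payoff v \<tau> \<omega>) sequentially"
    by (auto simp: eventually_sequentially stopped_process_eq)
  then show ?thesis by (rule tendsto_eventually)
qed

lemma measurable_stopped_payoff:
  assumes g: "g \<in> borel_measurable (borel_on X)"
  shows "stopped_payoff g \<tau> \<in> borel_measurable path_law"
proof -
  define g' where "g' x = (if x \<in> X then g x else 0)" for x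
  have [measurable]: "g' \<in> borel_measurable borel"
    unfolding g'_def[abs_def] using g by (intro measurable_restrict_space_iff[THEN iffD1]) auto
  have "stopped_payoff g' \<tau> \<in> borel_measurable path_law"
  proof (rule borel_measurable_LIMSEQ_real)
    show "(\<lambda>\<omega>. if \<tau> \<omega> \<le> enat n then stopped_process g' n \<omega> else 0) \<in> borel_measurable path_law" for n
      by measurable
    show "(\<lambda>n. if \<tau> \<omega> \<le> enat n then stopped_process g' n \<omega> else 0) \<longlonglongrightarrow> stopped_payoff g' \<tau> \<omega>" for \<omega>
    proof (cases "\<tau> \<omega>")
      case (enat k)
      then have "eventually (\<lambda>n. (if \<tau> \<omega> \<le> enat n then stopped_process g' n \<omega> else 0) = stopped_payoff g' \<tau> \<omega>) sequentially"
        by (auto simp: eventually_sequentially stopped_process_eq)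
      then show ?thesis by (rule tendsto_eventually)
    qed (simp add: stopped_payoff_def)
  qed
  moreover have "stopped_payoff g \<tau> \<omega> = stopped_payoff g' \<tau> \<omega>" if "\<omega> \<in> space path_law" for \<omega>
  proof -
    have "\<omega> n \<in> X" for n
      using that start by (cases n) (auto simp: space_paths paths_def)
    then show ?thesis by (simp add: stopped_payoff_def g'_def split: enat.split)
  qed
  ultimately show ?thesis
    using measurable_cong[of path_law "stopped_payoff g \<tau>" "stopped_payoff g' \<tau>" borel] by blast
qed

lemma path_in_arena: "\<omega> \<in> paths X x\<^sub>0 \<Longrightarrow> \<omega> n \<in> X"
  using start by (cases n) (auto simp: paths_def)

lemma stopped_payoff_bound:
  assumes "\<And>x. x \<in> X \<Longrightarrow> \<bar>g x\<bar> \<le> D" "\<omega> \<in> paths X x\<^sub>0"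
  shows "\<bar>stopped_payoff g \<tau> \<omega>\<bar> \<le> D"
proof (cases "\<tau> \<omega>")
  case (enat n)
  then show ?thesis using assms(1)[OF path_in_arena[OF assms(2)]] by (simp add: stopped_payoff_def)
next
  case infinity
  then show ?thesis using order_trans[OF abs_ge_zero assms(1)[OF start]] by (simp add: stopped_payoff_def)
qed

lemma integrable_stopped_payoff:
  assumes "g \<in> borel_measurable (borel_on X)" "\<And>x. x \<in> X \<Longrightarrow> \<bar>g x\<bar> \<le> D"
  shows "integrable path_law (stopped_payoff g \<tau>)"
proof -
  interpret prob_space path_law by (rule prob_space_path_law)
  show ?thesis
    using stopped_payoff_bound[OF assms(2)]
    by (intro integrable_const_bound[where B=D] measurable_stopped_payoff assms(1) AE_I2)
      (auto simp: space_paths)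
qed

lemma expected_payoff_eq:
  "expected_payoff X \<epsilon> \<alpha> \<beta> g x\<^sub>0 \<tau> \<sigma>\<^sub>I \<sigma>\<^sub>I\<^sub>I = (\<integral>\<omega>. stopped_payoff g \<tau> \<omega> \<partial>path_law)"
  by (simp add: expected_payoff_def game_measure_eq)

lemma expected_payoff_bound:
  assumes "g \<in> borel_measurable (borel_on X)" "\<And>x. x \<in> X \<Longrightarrow> \<bar>g x\<bar> \<le> D"
  shows "\<bar>expected_payoff X \<epsilon> \<alpha> \<beta> g x\<^sub>0 \<tau> \<sigma>\<^sub>I \<sigma>\<^sub>I\<^sub>I\<bar> \<le> D"
proof -
  interpret prob_space path_law by (rule prob_space_path_law)
  have b: "stopped_payoff g \<tau> \<omega> \<le> D" "- D \<le> stopped_payoff g \<tau> \<omega>" if "\<omega> \<in> space path_law" for \<omega>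
    using stopped_payoff_bound[where g=g and \<omega>=\<omega>, OF assms(2)] that by (auto simp: space_paths abs_le_iff)
  have "expectation (stopped_payoff g \<tau>) \<le> D" "- D \<le> expectation (stopped_payoff g \<tau>)"
    using b by (intro integral_le_const integral_ge_const integrable_stopped_payoff[OF assms] AE_I2; simp)+
  then show ?thesis by (simp add: expected_payoff_eq abs_le_iff)
qed

text \<open>
  Let \<open>a n\<close> be the expectation of \<open>v (x\<^bsub>min n \<tau>\<^esub>)\<close> and \<open>p n\<close> the probability of \<open>\<tau> > n\<close>. The drift gives
  \<open>a (Suc n) \<ge> a n + c * p n\<close>. Because \<open>p\<close> decreases, \<open>n * c * p n \<le> a n - v x\<^sub>0\<close> is bounded, so \<open>p\<close> tends
  to \<open>0\<close> and \<open>\<tau>\<close> is finite almost surely. By dominated convergence \<open>v x\<^sub>0\<close> then bounds the expectation of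
  \<open>v (x\<^sub>\<tau>)\<close> from below.
\<close>
lemma drift_lower_bound:
  assumes v: "v \<in> borel_measurable borel" "\<And>y. \<bar>v y\<bar> \<le> C" and c: "0 < c"
    and drift: "\<And>n h. h \<in> space (PiM {..n} state) \<Longrightarrow> h \<notin> stopped n \<Longrightarrow>
      v (h n) + c \<le> \<alpha> / 2 * v (\<sigma>\<^sub>I n h) + \<alpha> / 2 * v (\<sigma>\<^sub>I\<^sub>I n h) + \<beta> * ball_mean v (h n)"
    and g: "g \<in> borel_measurable (borel_on X)" "\<And>x. x \<in> X \<Longrightarrow> \<bar>g x\<bar> \<le> D"
    and final: "\<And>\<omega> n. \<omega> \<in> paths X x\<^sub>0 \<Longrightarrow> \<tau> \<omega> = enat n \<Longrightarrow> v (\<omega> n) \<le> g (\<omega> n) + \<eta>"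
  shows "v x\<^sub>0 - \<eta> \<le> expected_payoff X \<epsilon> \<alpha> \<beta> g x\<^sub>0 \<tau> \<sigma>\<^sub>I \<sigma>\<^sub>I\<^sub>I"
proof -
  interpret prob_space path_law by (rule prob_space_path_law)
  note [measurable] = v(1)
  define p where "p n = prob {\<omega> \<in> space path_law. \<not> \<tau> \<omega> \<le> enat n}" for n
  define a where "a n = expectation (stopped_process v n)" for n
  have stopped_process_bound: "\<bar>stopped_process v n \<omega>\<bar> \<le> C" for n \<omega>
    using v(2) by (induction n) auto
  have int_stopped_process: "integrable path_law (stopped_process v n)" for n
    using stopped_process_bound by (intro integrable_const_bound[where B=C]) auto
  have int1: "integrable path_law (\<lambda>\<omega>. if \<tau> \<omega> \<le> enat n then 0 else v (\<omega> k))" for n k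
    using v(2) order_trans[OF abs_ge_zero v(2)] by (intro integrable_const_bound[where B="C"]) auto
  have int2: "integrable path_law (\<lambda>\<omega>. if \<tau> \<omega> \<le> enat n then 0 else c)" for n
    using c by (intro integrable_const_bound[where B="c"]) auto
  have pc: "(\<integral>\<omega>. (if \<tau> \<omega> \<le> enat n then 0 else c) \<partial>path_law) = c * p n" for n
  proof -
    have "(\<integral>\<omega>. (if \<tau> \<omega> \<le> enat n then 0 else c) \<partial>path_law) =
        (\<integral>\<omega>. c * indicator {\<omega> \<in> space path_law. \<not> \<tau> \<omega> \<le> enat n} \<omega> \<partial>path_law)"
      by (intro Bochner_Integration.integral_cong) (auto split: split_indicator)
    also have "\<dots> = c * p n" by (auto simp: p_def intro!: arg_cong[where f=prob])
    finally show ?thesis .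
  qed
  have step: "a n + c * p n \<le> a (Suc n)" for n
  proof -
    let ?I = "\<lambda>f. \<integral>\<omega>. f \<omega> \<partial>path_law"
    have "a (Suc n) = ?I (\<lambda>\<omega>. stopped_process v n \<omega> + (if \<tau> \<omega> \<le> enat n then 0 else v (\<omega> (Suc n)))
        - (if \<tau> \<omega> \<le> enat n then 0 else v (\<omega> n)))"
      unfolding a_def by (intro Bochner_Integration.integral_cong) (auto simp: stopped_process_eq[of v n])
    also have "\<dots> = a n + ?I (\<lambda>\<omega>. if \<tau> \<omega> \<le> enat n then 0 else v (\<omega> (Suc n)))
        - ?I (\<lambda>\<omega>. if \<tau> \<omega> \<le> enat n then 0 else v (\<omega> n))"
      unfolding a_def using int_stopped_process int1 by simp
    finally have A: "a (Suc n) = a n + ?I (\<lambda>\<omega>. if \<tau> \<omega> \<le> enat n then 0 else v (\<omega> (Suc n)))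
        - ?I (\<lambda>\<omega>. if \<tau> \<omega> \<le> enat n then 0 else v (\<omega> n))" .
    have "?I (\<lambda>\<omega>. if \<tau> \<omega> \<le> enat n then 0 else v (\<omega> n) + c) =
        ?I (\<lambda>\<omega>. if \<tau> \<omega> \<le> enat n then 0 else v (\<omega> n)) + c * p n"
      unfolding pc[symmetric]
      by (subst Bochner_Integration.integral_add[OF int1 int2, symmetric])
        (auto intro!: Bochner_Integration.integral_cong)
    with A alive_increment[OF v less_imp_le[OF c] drift, of n] show ?thesis by simp
  qed
  have alive_sets: "{\<omega> \<in> space path_law. \<not> \<tau> \<omega> \<le> enat n} \<in> sets path_law" for n
    by measurable
  have p_antimono: "p n \<le> p m" if "m \<le> n" for m n
    unfolding p_def using that
    by (intro finite_measure_mono[OF _ alive_sets]) (auto dest: order_trans[of _ "enat m" "enat n"])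
  have p_nonneg: "0 \<le> p n" for n by (simp add: p_def)
  have sum: "v x\<^sub>0 + n * (c * p n) \<le> a n" for n
  proof (induction n)
    case 0
    have "a 0 = (\<integral>\<omega>. v x\<^sub>0 \<partial>path_law)"
      unfolding a_def by (intro Bochner_Integration.integral_cong) (auto simp: space_paths paths_def)
    then show ?case using prob_space by simp
  next
    case (Suc n)
    have "real (Suc n) * (c * p (Suc n)) \<le> real (Suc n) * (c * p n)"
      using p_antimono[of n "Suc n"] c by (intro mult_left_mono) auto
    with Suc step[of n] show ?case by (simp add: algebra_simps)
  qed
  have aC: "a n \<le> C" for n
    unfolding a_def using stopped_process_bound[of n] by (intro integral_le_const int_stopped_process AE_I2) (simp add: abs_le_iff)
  have never: "prob {\<omega> \<in> space path_law. \<tau> \<omega> = \<infinity>} = 0"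
  proof (rule ccontr)
    let ?d = "prob {\<omega> \<in> space path_law. \<tau> \<omega> = \<infinity>}"
    assume "?d \<noteq> 0"
    then have d: "0 < c * ?d" using c by (simp add: zero_less_measure_iff less_le)
    have "?d \<le> p n" for n
      unfolding p_def by (intro finite_measure_mono[OF _ alive_sets]) auto
    then have "real n * (c * ?d) \<le> real n * (c * p n)" for n
      using c by (intro mult_left_mono) auto
    then have *: "real n * (c * ?d) \<le> C - v x\<^sub>0" for n using sum[of n] aC[of n] by (smt (verit))
    obtain n where "C - v x\<^sub>0 < real n * (c * ?d)" using reals_Archimedean3[OF d] by blast
    with *[of n] show False by simp
  qed
  have "{\<omega> \<in> space path_law. \<tau> \<omega> = \<infinity>} = {\<omega> \<in> space path_law. \<forall>n. \<not> \<tau> \<omega> \<le> enat n}"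
  proof -
    have "t = \<infinity> \<longleftrightarrow> (\<forall>n. \<not> t \<le> enat n)" for t :: enat by (cases t) auto
    then show ?thesis by simp
  qed
  then have "{\<omega> \<in> space path_law. \<tau> \<omega> = \<infinity>} \<in> sets path_law"
    by (simp only:) measurable
  then have finite: "AE \<omega> in path_law. \<tau> \<omega> \<noteq> \<infinity>"
    using never by (intro AE_I[where N="{\<omega> \<in> space path_law. \<tau> \<omega> = \<infinity>}"]) (auto simp: emeasure_eq_measure)
  have v': "v \<in> borel_measurable (borel_on X)" by (intro measurable_restrict_space1 v(1))
  have "a \<longlonglongrightarrow> expectation (stopped_payoff v \<tau>)"
    unfolding a_def
  proof (rule integral_dominated_convergence[where w="\<lambda>_. C"])
    show "AE \<omega> in path_law. (\<lambda>n. stopped_process v n \<omega>) \<longlonglongrightarrow> stopped_payoff v \<tau> \<omega>"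
      using finite by eventually_elim (rule stopped_process_tendsto)
  qed (use stopped_process_bound measurable_stopped_payoff[OF v'] in auto)
  moreover have "v x\<^sub>0 \<le> a n" for n
  proof -
    have "0 \<le> real n * (c * p n)" using c p_nonneg by simp
    with sum[of n] show ?thesis by linarith
  qed
  ultimately have "v x\<^sub>0 \<le> expectation (stopped_payoff v \<tau>)"
    by (intro LIMSEQ_le_const) auto
  also have "\<dots> \<le> expectation (\<lambda>\<omega>. stopped_payoff g \<tau> \<omega> + \<eta>)"
  proof (rule integral_mono_AE)
    show "integrable path_law (stopped_payoff v \<tau>)" using v(2) by (intro integrable_stopped_payoff[OF v', where D=C])
    show "integrable path_law (\<lambda>\<omega>. stopped_payoff g \<tau> \<omega> + \<eta>)"
      using integrable_stopped_payoff[OF g] by simp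
    show "AE \<omega> in path_law. stopped_payoff v \<tau> \<omega> \<le> stopped_payoff g \<tau> \<omega> + \<eta>"
      using finite AE_space
    proof eventually_elim
      case (elim \<omega>)
      then show ?case using final[of \<omega>] by (cases "\<tau> \<omega>") (auto simp: stopped_payoff_def space_paths)
    qed
  qed
  also have "\<dots> = expectation (stopped_payoff g \<tau>) + \<eta>"
    using integrable_stopped_payoff[OF g] prob_space by simp
  finally show ?thesis by (simp add: expected_payoff_eq)
qed

end

section \<open>Hitting times and Markov strategies\<close>

lemma hitting_time_le_iff: "hitting_time T \<omega> \<le> enat n \<longleftrightarrow> (\<exists>k\<le>n. \<omega> k \<in> T)"
proof
  assume le: "hitting_time T \<omega> \<le> enat n"
  show "\<exists>k\<le>n. \<omega> k \<in> T"
  proof (rule ccontr)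
    assume none: "\<not> (\<exists>k\<le>n. \<omega> k \<in> T)"
    have "enat (Suc n) \<le> hitting_time T \<omega>"
      unfolding hitting_time_def
    proof (rule INF_greatest)
      fix k assume "k \<in> {k. \<omega> k \<in> T}"
      with none have "\<not> k \<le> n" by auto
      then show "enat (Suc n) \<le> enat k" by simp
    qed
    from this le have "enat (Suc n) \<le> enat n" by (rule order_trans)
    then show False by simp
  qed
next
  assume "\<exists>k\<le>n. \<omega> k \<in> T"
  then obtain k where k: "k \<le> n" "\<omega> k \<in> T" by auto
  then have "hitting_time T \<omega> \<le> enat k" unfolding hitting_time_def by (intro INF_lower) auto
  with k show "hitting_time T \<omega> \<le> enat n" using order_trans by fastforce
qed

lemma hitting_time_attained:
  assumes "hitting_time T \<omega> = enat n"
  shows "\<omega> n \<in> T"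
proof -
  obtain k where k: "k \<le> n" "\<omega> k \<in> T" using assms hitting_time_le_iff[of T \<omega> n] by auto
  have "hitting_time T \<omega> \<le> enat k" using k(2) hitting_time_le_iff[of T \<omega> k] by auto
  with assms k show ?thesis by (metis antisym enat_ord_simps(1))
qed

lemma hitting_time_antimono: "S \<subseteq> T \<Longrightarrow> hitting_time T \<omega> \<le> hitting_time S \<omega>"
  unfolding hitting_time_def by (intro INF_superset_mono) auto

context tug_of_war
begin

lemma hitting_time_admissible:
  assumes T: "T \<in> sets borel" "T \<subseteq> X" "\<Gamma> \<subseteq> T" and x0: "x\<^sub>0 \<in> X"
  shows "hitting_time T \<in> admissible_times \<Omega> \<epsilon>\<^sub>0 x\<^sub>0"
proof -
  have "{\<omega> \<in> paths X x\<^sub>0. hitting_time T \<omega> \<le> enat n} \<in> sets (path_filtration X x\<^sub>0 n)" for n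
  proof -
    let ?M = "path_filtration X x\<^sub>0 n"
    have space: "space ?M = paths X x\<^sub>0"
      unfolding path_filtration_def by (intro space_measure_of) (auto simp: cylinder_def)
    have hit: "{\<omega> \<in> paths X x\<^sub>0. \<omega> k \<in> T} \<in> sets ?M" if "k \<le> n" for k
    proof (cases "k = 0")
      case True
      then have "{\<omega> \<in> paths X x\<^sub>0. \<omega> k \<in> T} = (if x\<^sub>0 \<in> T then space ?M else {})"
        by (auto simp: space) (auto simp: paths_def)
      then show ?thesis by simp
    next
      case False
      let ?A = "\<lambda>i. if i = k then T else X"
      have "{\<omega> \<in> paths X x\<^sub>0. \<omega> k \<in> T} = cylinder X x\<^sub>0 n ?A"
        using False that by (auto simp: cylinder_def paths_def)
      moreover have "\<forall>i\<in>{1..n}. ?A i \<in> sets (borel_on X)"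
        using T(1,2) by (auto simp: sets_restrict_space_iff)
      moreover have "sets ?M =
          sigma_sets (paths X x\<^sub>0) {cylinder X x\<^sub>0 n A | A. \<forall>i\<in>{1..n}. A i \<in> sets (borel_on X)}"
        unfolding path_filtration_def by (intro sets_measure_of) (auto simp: cylinder_def)
      ultimately show ?thesis by (auto intro!: sigma_sets.Basic)
    qed
    have "{\<omega> \<in> paths X x\<^sub>0. hitting_time T \<omega> \<le> enat n} = (\<Union>k\<in>{..n}. {\<omega> \<in> paths X x\<^sub>0. \<omega> k \<in> T})"
      unfolding hitting_time_le_iff by auto
    also have "\<dots> \<in> sets ?M" using hit by (intro sets.finite_UN) auto
    finally show ?thesis .
  qed
  then show ?thesis
    unfolding admissible_times_def path_stopping_time_def using hitting_time_antimono[OF T(3)] by auto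
qed

lemma markov_strategy:
  assumes s: "s \<in> borel \<rightarrow>\<^sub>M borel" "\<And>x. x \<in> X \<Longrightarrow> s x \<in> ball x \<epsilon> \<inter> X"
  shows "(\<lambda>n h. s (h n)) \<in> strategies X \<epsilon>"
proof -
  have "(\<lambda>h. s (h n)) \<in> (\<Pi>\<^sub>M i\<in>{..n}. borel_on X) \<rightarrow>\<^sub>M borel_on X" for n :: nat
  proof (rule measurable_restrict_space2)
    have "(\<lambda>h. h n) \<in> (\<Pi>\<^sub>M i\<in>{..n}. borel_on X) \<rightarrow>\<^sub>M borel_on X"
      by (rule measurable_component_singleton) simp
    moreover have "s \<in> borel_on X \<rightarrow>\<^sub>M borel" by (intro measurable_restrict_space1 s(1))
    ultimately show "(\<lambda>h. s (h n)) \<in> (\<Pi>\<^sub>M i\<in>{..n}. borel_on X) \<rightarrow>\<^sub>M borel" by (rule measurable_compose)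
    show "(\<lambda>h. s (h n)) \<in> space (\<Pi>\<^sub>M i\<in>{..n}. borel_on X) \<rightarrow> X"
      using s(2) by (auto simp: space_PiM space_restrict_space PiE_iff)
  qed
  then show ?thesis using s(2) by (auto simp: strategies_def PiE_iff)
qed

lemma dpp_op_uminus: "dpp_op (\<lambda>y. - w y) x = - dpp_op w x"
  using ball_mean_cmult[of "-1" w x] by (simp add: dpp_op_def INF_ball_eq algebra_simps)

lemma dpp_op_cong:
  assumes "\<And>y. y \<in> ball x \<epsilon> \<Longrightarrow> u y = w y"
  shows "dpp_op u x = dpp_op w x"
proof -
  have "u ` ball x \<epsilon> = w ` ball x \<epsilon>" using assms by (intro image_cong) auto
  then show ?thesis using ball_mean_cong[OF assms] by (simp add: dpp_op_def)
qed

lemma expected_payoff_uminus: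
  "expected_payoff X \<epsilon> \<alpha> \<beta> (\<lambda>x. - g x) x\<^sub>0 \<tau> \<sigma>\<^sub>I \<sigma>\<^sub>I\<^sub>I = - expected_payoff X \<epsilon> \<alpha> \<beta> g x\<^sub>0 \<tau> \<sigma>\<^sub>I \<sigma>\<^sub>I\<^sub>I"
proof -
  have "stopped_payoff (\<lambda>x. - g x) \<tau> = (\<lambda>\<omega>. - stopped_payoff g \<tau> \<omega>)"
    by (auto simp: stopped_payoff_def fun_eq_iff split: enat.split)
  then show ?thesis by (simp add: expected_payoff_def)
qed

end

section \<open>The value of the game\<close>

text \<open>
  All sets must be shown to be bounded and nonempty because suprema and infima of real sets are otherwise
  unspecified.
\<close>
lemma sup_inf_value:
  fixes f :: "'b \<Rightarrow> 'c \<Rightarrow> real" and z C :: real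
  assumes bound: "\<And>p q. p \<in> A \<Longrightarrow> q \<in> B \<Longrightarrow> \<bar>f p q\<bar> \<le> C"
    and max: "\<And>\<eta>. 0 < \<eta> \<Longrightarrow> \<exists>p\<in>A. \<forall>q\<in>B. z - 2 * \<eta> \<le> f p q"
    and min: "\<And>\<eta>. 0 < \<eta> \<Longrightarrow> \<exists>q\<in>B. \<forall>p\<in>A. f p q \<le> z + 2 * \<eta>"
  shows "(SUP p\<in>A. INF q\<in>B. f p q) = z" "(INF q\<in>B. SUP p\<in>A. f p q) = z"
proof -
  have A: "A \<noteq> {}" and B: "B \<noteq> {}" using max[of 1] min[of 1] by auto
  have inf_bdd: "bdd_below ((\<lambda>q. f p q) ` B)" if "p \<in> A" for p
    using bound[OF that] by (intro bdd_belowI2[where m="-C"]) (auto simp: abs_le_iff minus_le_iff)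
  have sup_bdd: "bdd_above ((\<lambda>p. f p q) ` A)" if "q \<in> B" for q
    using bound[OF _ that] by (intro bdd_aboveI2[where M=C]) (auto simp: abs_le_iff)
  have le: "(INF q\<in>B. f p q) \<le> (SUP p\<in>A. f p q)" if "p \<in> A" "q \<in> B" for p q
    using cINF_lower[OF inf_bdd[OF that(1)] that(2)] cSUP_upper[OF that(1) sup_bdd[OF that(2)]] by linarith
  obtain p\<^sub>0 q\<^sub>0 where pq: "p\<^sub>0 \<in> A" "q\<^sub>0 \<in> B" using A B by auto
  have bdd1: "bdd_above ((\<lambda>p. INF q\<in>B. f p q) ` A)"
    using le[OF _ pq(2)] by (intro bdd_aboveI2)
  have bdd2: "bdd_below ((\<lambda>q. SUP p\<in>A. f p q) ` B)"
    using le[OF pq(1)] by (intro bdd_belowI2)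
  have lower: "z \<le> (SUP p\<in>A. INF q\<in>B. f p q)"
  proof (rule field_le_epsilon)
    fix e :: real assume "0 < e"
    then obtain p where p: "p \<in> A" "\<forall>q\<in>B. z - 2 * (e / 2) \<le> f p q" using max[of "e / 2"] by auto
    then have "z - e \<le> (INF q\<in>B. f p q)" by (intro cINF_greatest B) auto
    also have "\<dots> \<le> (SUP p\<in>A. INF q\<in>B. f p q)" by (rule cSUP_upper[OF p(1) bdd1])
    finally show "z \<le> (SUP p\<in>A. INF q\<in>B. f p q) + e" by simp
  qed
  have upper: "(INF q\<in>B. SUP p\<in>A. f p q) \<le> z"
  proof (rule field_le_epsilon)
    fix e :: real assume "0 < e"
    then obtain q where q: "q \<in> B" "\<forall>p\<in>A. f p q \<le> z + 2 * (e / 2)" using min[of "e / 2"] by auto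
    have "(INF q\<in>B. SUP p\<in>A. f p q) \<le> (SUP p\<in>A. f p q)" by (rule cINF_lower[OF bdd2 q(1)])
    also have "\<dots> \<le> z + e" using q(2) by (intro cSUP_least A) auto
    finally show "(INF q\<in>B. SUP p\<in>A. f p q) \<le> z + e" .
  qed
  have "(SUP p\<in>A. INF q\<in>B. f p q) \<le> (INF q\<in>B. SUP p\<in>A. f p q)"
    using le by (intro cSUP_least cINF_greatest A B)
  with lower upper show "(SUP p\<in>A. INF q\<in>B. f p q) = z" "(INF q\<in>B. SUP p\<in>A. f p q) = z" by auto
qed

locale obstacle_game = obstacle_problem \<Omega> \<epsilon>\<^sub>0 \<epsilon> \<alpha> \<beta> F \<Psi> C
  for \<Omega> :: "'a::euclidean_space set" and \<epsilon>\<^sub>0 \<epsilon> \<alpha> \<beta> F \<Psi> C +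
  fixes G u :: "'a \<Rightarrow> real" and x\<^sub>0 :: 'a
  assumes payoff: "\<forall>x\<in>X. G x = indicat_real \<Gamma> x * F x + indicat_real \<Omega> x * \<Psi> x"
    and solution: "dpp_solution \<Omega> \<epsilon>\<^sub>0 \<epsilon> \<alpha> \<beta> F \<Psi> u"
    and start: "x\<^sub>0 \<in> \<Omega>"
begin

abbreviation payoff_value where
  "payoff_value \<tau> \<sigma>\<^sub>I \<sigma>\<^sub>I\<^sub>I \<equiv> expected_payoff X \<epsilon> \<alpha> \<beta> G x\<^sub>0 \<tau> \<sigma>\<^sub>I \<sigma>\<^sub>I\<^sub>I"

lemma G_strip: "x \<in> \<Gamma> \<Longrightarrow> G x = F x" and G_domain: "x \<in> \<Omega> \<Longrightarrow> G x = \<Psi> x"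
  using payoff by (auto simp: strip_eq domain_subset[THEN subsetD])

lemma arena_cases: "x \<in> X \<Longrightarrow> x \<in> \<Omega> \<or> x \<in> \<Gamma>"
  by (auto simp: strip_eq)

lemma G_bound: "x \<in> X \<Longrightarrow> \<bar>G x\<bar> \<le> C"
  using arena_cases[of x] G_strip G_domain F_bound \<Psi>_bound by auto

lemma G_measurable: "G \<in> borel_measurable (borel_on X)"
proof -
  have [measurable]: "(\<lambda>x. if x \<in> \<Gamma> then F x else 0) \<in> borel_measurable borel"
    using F_measurable by (subst (asm) measurable_restrict_space_iff[where c=0]) auto
  have "(\<lambda>x. if x \<in> \<Omega> then \<Psi> x else if x \<in> \<Gamma> then F x else 0) \<in> borel_measurable borel"
    by measurable
  also have "(\<lambda>x. if x \<in> \<Omega> then \<Psi> x else if x \<in> \<Gamma> then F x else 0) = (\<lambda>x. if x \<in> X then G x else 0)"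
    using G_strip G_domain domain_subset by (auto simp: fun_eq_iff strip_eq)
  finally show ?thesis by (subst measurable_restrict_space_iff[where c=0]) auto
qed

lemma x0_arena: "x\<^sub>0 \<in> X"
  using start domain_subset by auto

lemma play:
  assumes "\<tau> \<in> admissible_times \<Omega> \<epsilon>\<^sub>0 x\<^sub>0" "\<sigma>\<^sub>I \<in> strategies X \<epsilon>" "\<sigma>\<^sub>I\<^sub>I \<in> strategies X \<epsilon>"
  shows "play \<Omega> \<epsilon>\<^sub>0 \<epsilon> \<alpha> \<beta> x\<^sub>0 \<tau> \<sigma>\<^sub>I \<sigma>\<^sub>I\<^sub>I"
  using assms x0_arena by unfold_locales

lemma payoff_value_bound:
  assumes "\<tau> \<in> admissible_times \<Omega> \<epsilon>\<^sub>0 x\<^sub>0" "\<sigma>\<^sub>I \<in> strategies X \<epsilon>" "\<sigma>\<^sub>I\<^sub>I \<in> strategies X \<epsilon>"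
  shows "\<bar>payoff_value \<tau> \<sigma>\<^sub>I \<sigma>\<^sub>I\<^sub>I\<bar> \<le> C"
  using play.expected_payoff_bound[OF play[OF assms] G_measurable G_bound] .

text \<open>
  The solution is only controlled on the arena. Extending it by \<open>0\<close> gives a Borel function that is
  bounded on the whole space and solves the same equation, as balls around points of \<open>\<Omega>\<close> stay in the
  arena.
\<close>
definition extension :: "'a \<Rightarrow> real" where
  "extension x = (if x \<in> X then u x else 0)"

lemma extension_measurable [measurable]: "extension \<in> borel_measurable borel"
  unfolding extension_def[abs_def] using solution
  by (intro measurable_restrict_space_iff[THEN iffD1]) (auto simp: dpp_solution_def)

lemma extension_bounded: "\<exists>D. \<forall>x. \<bar>extension x\<bar> \<le> D"
proof -
  obtain D where "\<And>x. x \<in> X \<Longrightarrow> \<bar>u x\<bar> \<le> D"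
    using solution unfolding dpp_solution_def bounded_iff by (metis imageI real_norm_def)
  then have "\<bar>extension x\<bar> \<le> \<bar>D\<bar>" for x unfolding extension_def by (auto intro: order_trans[OF _ abs_ge_self])
  then show ?thesis by blast
qed

lemma extension_domain: "x \<in> \<Omega> \<Longrightarrow> extension x = max (\<Psi> x) (dpp_op extension x)"
proof -
  assume x: "x \<in> \<Omega>"
  have "dpp_op u x = dpp_op extension x"
    using ball_subset_arena[OF x] by (intro dpp_op_cong) (auto simp: extension_def)
  moreover have "u x = max (\<Psi> x) (dpp_op u x)"
    using solution x by (simp add: dpp_solution_def dpp_op_def ball_mean_def)
  ultimately show ?thesis using x domain_subset by (auto simp: extension_def)
qed

lemma extension_strip: "x \<in> \<Gamma> \<Longrightarrow> extension x = G x"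
  using solution G_strip by (auto simp: dpp_solution_def extension_def strip_eq)

text \<open>
  Player I stops at the first point where the token has left \<open>\<Omega>\<close> or \<open>u \<le> \<Psi>\<close>. Before that, the maximum in
  the equation is attained by its second argument, so \<open>u\<close> is a subsolution; on stopping, the payoff is
  at least \<open>u\<close>.
\<close>
lemma player_I_guarantee:
  assumes \<eta>: "0 < \<eta>"
  shows "\<exists>\<tau>\<in>admissible_times \<Omega> \<epsilon>\<^sub>0 x\<^sub>0. \<exists>\<sigma>\<^sub>I\<in>strategies X \<epsilon>. \<forall>\<sigma>\<^sub>I\<^sub>I\<in>strategies X \<epsilon>.
    u x\<^sub>0 - 2 * \<eta> \<le> payoff_value \<tau> \<sigma>\<^sub>I \<sigma>\<^sub>I\<^sub>I"
proof -
  obtain D where D: "\<And>x. \<bar>extension x\<bar> \<le> D" using extension_bounded by auto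
  define W where "W = {x \<in> \<Omega>. \<Psi> x < extension x}"
  have "W = \<Omega> \<inter> {x \<in> space borel. \<Psi> x < extension x}" by (auto simp: W_def)
  moreover have "{x \<in> space borel. \<Psi> x < extension x} \<in> sets borel" by measurable
  ultimately have W: "W \<in> sets borel" "W \<subseteq> \<Omega>" using domain_borel by auto
  have sub: "extension x \<le> dpp_op extension x" if "x \<in> W" for x
    using that extension_domain[of x] by (auto simp: W_def max_def split: if_splits)
  obtain v s c where v: "strict_subsolution W v s c" "\<And>y. \<bar>v y - extension y\<bar> \<le> \<eta>"
    using strict_subsolution_exists[where w=extension, OF extension_measurable D W sub \<eta>] by blast
  define \<tau> where "\<tau> = hitting_time (X - W)"
  have \<tau>: "\<tau> \<in> admissible_times \<Omega> \<epsilon>\<^sub>0 x\<^sub>0"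
    unfolding \<tau>_def using W x0_arena by (intro hitting_time_admissible) (auto simp: strip_eq)
  define \<sigma>\<^sub>I where "\<sigma>\<^sub>I = (\<lambda>(n::nat) h. s (h n) :: 'a)"
  have \<sigma>\<^sub>I: "\<sigma>\<^sub>I \<in> strategies X \<epsilon>"
    unfolding \<sigma>\<^sub>I_def using v(1) by (intro markov_strategy) (auto simp: strict_subsolution_def)
  have "u x\<^sub>0 - 2 * \<eta> \<le> payoff_value \<tau> \<sigma>\<^sub>I \<sigma>\<^sub>I\<^sub>I" if \<sigma>\<^sub>I\<^sub>I: "\<sigma>\<^sub>I\<^sub>I \<in> strategies X \<epsilon>" for \<sigma>\<^sub>I\<^sub>I
  proof -
    interpret play \<Omega> \<epsilon>\<^sub>0 \<epsilon> \<alpha> \<beta> x\<^sub>0 \<tau> \<sigma>\<^sub>I \<sigma>\<^sub>I\<^sub>I by (rule play[OF \<tau> \<sigma>\<^sub>I \<sigma>\<^sub>I\<^sub>I])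
    obtain E where E: "\<And>y. \<bar>v y\<bar> \<le> E" using v(1) by (auto simp: strict_subsolution_def)
    have "v x\<^sub>0 - \<eta> \<le> payoff_value \<tau> \<sigma>\<^sub>I \<sigma>\<^sub>I\<^sub>I"
    proof (rule drift_lower_bound)
      show "v \<in> borel_measurable borel" "0 < c" using v(1) by (auto simp: strict_subsolution_def)
      show "\<bar>v y\<bar> \<le> E" for y by (rule E)
      show "G \<in> borel_measurable (borel_on X)" by (rule G_measurable)
      show "\<bar>G x\<bar> \<le> C" if "x \<in> X" for x by (rule G_bound[OF that])
    next
      fix n h assume h: "h \<in> space (PiM {..n} state)" "h \<notin> stopped n"
      obtain \<omega> where \<omega>: "\<omega> \<in> paths X x\<^sub>0" "restrict \<omega> {..n} = h" using h(1) by (rule history_extends)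
      have "\<not> \<tau> \<omega> \<le> enat n" using stopped_iff[OF \<omega>(1), of n] h(2) \<omega>(2) by simp
      then have "\<omega> n \<in> W" using path_in_arena[OF \<omega>(1), of n] by (auto simp: \<tau>_def hitting_time_le_iff)
      then have "h n \<in> W" using \<omega>(2) by auto
      moreover have "\<sigma>\<^sub>I\<^sub>I n h \<in> ball (h n) \<epsilon>" using strategy_II_ball[OF h(1)] by simp
      ultimately show "v (h n) + c \<le> \<alpha> / 2 * v (\<sigma>\<^sub>I n h) + \<alpha> / 2 * v (\<sigma>\<^sub>I\<^sub>I n h) + \<beta> * ball_mean v (h n)"
        using v(1) unfolding \<sigma>\<^sub>I_def strict_subsolution_def by blast
    next
      fix \<omega> n assume \<omega>: "\<omega> \<in> paths X x\<^sub>0" "\<tau> \<omega> = enat n"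
      then have "\<omega> n \<in> X - W" unfolding \<tau>_def by (intro hitting_time_attained)
      then have "extension (\<omega> n) \<le> G (\<omega> n)"
        using arena_cases[of "\<omega> n"] extension_strip[of "\<omega> n"] G_domain[of "\<omega> n"] by (auto simp: W_def)
      with v(2)[of "\<omega> n"] show "v (\<omega> n) \<le> G (\<omega> n) + \<eta>" by linarith
    qed
    moreover have "extension x\<^sub>0 = u x\<^sub>0" using x0_arena by (simp add: extension_def)
    ultimately show ?thesis using v(2)[of x\<^sub>0] by linarith
  qed
  with \<tau> \<sigma>\<^sub>I show ?thesis by blast
qed

text \<open>
  Player II is the player of the strict subsolution near \<open>-u\<close>, for the payoff \<open>-G\<close>. Both
  \<open>-u \<le> dpp_op (-u)\<close> in \<open>\<Omega>\<close> and \<open>-u \<le> -G\<close> in the arena hold because the maximum in the equation is at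
  least each of its arguments.
\<close>
lemma player_II_guarantee:
  assumes \<eta>: "0 < \<eta>"
  shows "\<exists>\<sigma>\<^sub>I\<^sub>I\<in>strategies X \<epsilon>. \<forall>\<tau>\<in>admissible_times \<Omega> \<epsilon>\<^sub>0 x\<^sub>0. \<forall>\<sigma>\<^sub>I\<in>strategies X \<epsilon>.
    payoff_value \<tau> \<sigma>\<^sub>I \<sigma>\<^sub>I\<^sub>I \<le> u x\<^sub>0 + 2 * \<eta>"
proof -
  obtain D where D: "\<And>x. \<bar>extension x\<bar> \<le> D" using extension_bounded by auto
  have m: "(\<lambda>y. - extension y) \<in> borel_measurable borel" by measurable
  have b: "\<bar>- extension y\<bar> \<le> D" for y using D by simp
  have sub: "- extension x \<le> dpp_op (\<lambda>y. - extension y) x" if "x \<in> \<Omega>" for x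
    using extension_domain[OF that] unfolding dpp_op_uminus by simp
  obtain v s c where v: "strict_subsolution \<Omega> v s c" "\<And>y. \<bar>v y - - extension y\<bar> \<le> \<eta>"
    using strict_subsolution_exists[where w="\<lambda>y. - extension y", OF m b domain_borel order_refl sub \<eta>] by blast
  define \<sigma>\<^sub>I\<^sub>I where "\<sigma>\<^sub>I\<^sub>I = (\<lambda>(n::nat) h. s (h n) :: 'a)"
  have \<sigma>\<^sub>I\<^sub>I: "\<sigma>\<^sub>I\<^sub>I \<in> strategies X \<epsilon>"
    unfolding \<sigma>\<^sub>I\<^sub>I_def using v(1) by (intro markov_strategy) (auto simp: strict_subsolution_def)
  have "payoff_value \<tau> \<sigma>\<^sub>I \<sigma>\<^sub>I\<^sub>I \<le> u x\<^sub>0 + 2 * \<eta>"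
    if \<tau>: "\<tau> \<in> admissible_times \<Omega> \<epsilon>\<^sub>0 x\<^sub>0" and \<sigma>\<^sub>I: "\<sigma>\<^sub>I \<in> strategies X \<epsilon>" for \<tau> \<sigma>\<^sub>I
  proof -
    interpret play \<Omega> \<epsilon>\<^sub>0 \<epsilon> \<alpha> \<beta> x\<^sub>0 \<tau> \<sigma>\<^sub>I \<sigma>\<^sub>I\<^sub>I by (rule play[OF \<tau> \<sigma>\<^sub>I \<sigma>\<^sub>I\<^sub>I])
    obtain E where E: "\<And>y. \<bar>v y\<bar> \<le> E" using v(1) by (auto simp: strict_subsolution_def)
    have "v x\<^sub>0 - \<eta> \<le> expected_payoff X \<epsilon> \<alpha> \<beta> (\<lambda>x. - G x) x\<^sub>0 \<tau> \<sigma>\<^sub>I \<sigma>\<^sub>I\<^sub>I"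
    proof (rule drift_lower_bound)
      show "v \<in> borel_measurable borel" "0 < c" using v(1) by (auto simp: strict_subsolution_def)
      show "\<bar>v y\<bar> \<le> E" for y by (rule E)
      show "(\<lambda>x. - G x) \<in> borel_measurable (borel_on X)" using G_measurable by simp
      show "\<bar>- G x\<bar> \<le> C" if "x \<in> X" for x using G_bound[OF that] by simp
    next
      fix n h assume h: "h \<in> space (PiM {..n} state)" "h \<notin> stopped n"
      have "h n \<in> \<Omega>" by (rule unstopped_in_domain[OF h])
      moreover have "\<sigma>\<^sub>I n h \<in> ball (h n) \<epsilon>" using strategy_I_ball[OF h(1)] by simp
      ultimately have "v (h n) + c \<le> \<alpha> / 2 * v (\<sigma>\<^sub>I\<^sub>I n h) + \<alpha> / 2 * v (\<sigma>\<^sub>I n h) + \<beta> * ball_mean v (h n)"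
        using v(1) unfolding \<sigma>\<^sub>I\<^sub>I_def strict_subsolution_def by blast
      then show "v (h n) + c \<le> \<alpha> / 2 * v (\<sigma>\<^sub>I n h) + \<alpha> / 2 * v (\<sigma>\<^sub>I\<^sub>I n h) + \<beta> * ball_mean v (h n)"
        by simp
    next
      fix \<omega> n assume "\<omega> \<in> paths X x\<^sub>0" "\<tau> \<omega> = enat n"
      then have "\<omega> n \<in> X" by (intro path_in_arena)
      then have "G (\<omega> n) \<le> extension (\<omega> n)"
        using arena_cases[of "\<omega> n"] extension_strip[of "\<omega> n"] G_domain[of "\<omega> n"] extension_domain[of "\<omega> n"] by auto
      with v(2)[of "\<omega> n"] show "v (\<omega> n) \<le> - G (\<omega> n) + \<eta>" by linarith
    qed
    moreover have "extension x\<^sub>0 = u x\<^sub>0" using x0_arena by (simp add: extension_def)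
    ultimately show ?thesis using v(2)[of x\<^sub>0] unfolding expected_payoff_uminus by linarith
  qed
  with \<sigma>\<^sub>I\<^sub>I show ?thesis by blast
qed

lemma values_eq: "value_I \<Omega> \<epsilon>\<^sub>0 \<epsilon> \<alpha> \<beta> G x\<^sub>0 = u x\<^sub>0" "value_II \<Omega> \<epsilon>\<^sub>0 \<epsilon> \<alpha> \<beta> G x\<^sub>0 = u x\<^sub>0"
proof -
  let ?A = "admissible_times \<Omega> \<epsilon>\<^sub>0 x\<^sub>0 \<times> strategies X \<epsilon>"
  let ?f = "\<lambda>p. payoff_value (fst p) (snd p)"
  have 1: "\<bar>?f p q\<bar> \<le> C" if "p \<in> ?A" "q \<in> strategies X \<epsilon>" for p q
    using that by (intro payoff_value_bound) auto
  have 2: "\<exists>p\<in>?A. \<forall>q\<in>strategies X \<epsilon>. u x\<^sub>0 - 2 * \<eta> \<le> ?f p q" if "0 < \<eta>" for \<eta>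
    using player_I_guarantee[OF that] by force
  have 3: "\<exists>q\<in>strategies X \<epsilon>. \<forall>p\<in>?A. ?f p q \<le> u x\<^sub>0 + 2 * \<eta>" if "0 < \<eta>" for \<eta>
    using player_II_guarantee[OF that] by force
  show "value_I \<Omega> \<epsilon>\<^sub>0 \<epsilon> \<alpha> \<beta> G x\<^sub>0 = u x\<^sub>0" "value_II \<Omega> \<epsilon>\<^sub>0 \<epsilon> \<alpha> \<beta> G x\<^sub>0 = u x\<^sub>0"
    unfolding value_I_def value_II_def case_prod_beta'
    using sup_inf_value[where f="?f", OF 1 2 3] by simp_all
qed

end

theorem theorem1p3:
  fixes \<Omega> :: "'a::euclidean_space set"
    and \<epsilon>\<^sub>0 \<epsilon> \<alpha> \<beta> :: real
    and F \<Psi> G :: "'a \<Rightarrow> real"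
  assumes "open \<Omega>" and "bounded \<Omega>" and "lipschitz_boundary \<Omega>"
    and "0 < \<epsilon>\<^sub>0" and "\<epsilon>\<^sub>0 < 1" and "0 < \<epsilon>" and "\<epsilon> \<le> \<epsilon>\<^sub>0"
    and "\<alpha> \<ge> 0" and "\<beta> \<ge> 0" and "\<alpha> + \<beta> = 1"
    and "F \<in> borel_measurable (borel_on (outer_strip \<Omega> \<epsilon>\<^sub>0))"
    and "bounded (F ` outer_strip \<Omega> \<epsilon>\<^sub>0)"
    and "\<Psi> \<in> borel_measurable borel" and "bounded (range \<Psi>)"
    and "\<forall>x\<in>outer_strip \<Omega> \<epsilon>\<^sub>0. \<Psi> x \<le> F x"
    and "\<forall>x\<in>arena \<Omega> \<epsilon>\<^sub>0. G x = indicat_real (outer_strip \<Omega> \<epsilon>\<^sub>0) x * F x + indicat_real \<Omega> x * \<Psi> x"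
  shows "(\<exists>u. dpp_solution \<Omega> \<epsilon>\<^sub>0 \<epsilon> \<alpha> \<beta> F \<Psi> u) \<and>
    (\<forall>u. dpp_solution \<Omega> \<epsilon>\<^sub>0 \<epsilon> \<alpha> \<beta> F \<Psi> u \<longrightarrow>
      (\<forall>x\<in>\<Omega>. value_I \<Omega> \<epsilon>\<^sub>0 \<epsilon> \<alpha> \<beta> G x = u x \<and> u x = value_II \<Omega> \<epsilon>\<^sub>0 \<epsilon> \<alpha> \<beta> G x))"
proof (cases "\<Omega> = {}")
  case True
  have "dpp_solution \<Omega> \<epsilon>\<^sub>0 \<epsilon> \<alpha> \<beta> F \<Psi> F"
    using assms(11,12) by (simp add: dpp_solution_def arena_def True)
  then show ?thesis using True by auto
next
  case False
  obtain C\<^sub>F where CF: "\<And>x. x \<in> outer_strip \<Omega> \<epsilon>\<^sub>0 \<Longrightarrow> \<bar>F x\<bar> \<le> C\<^sub>F"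
    using assms(12) unfolding bounded_iff by (metis imageI real_norm_def)
  obtain C\<^sub>\<Psi> where CP: "\<And>x. \<bar>\<Psi> x\<bar> \<le> C\<^sub>\<Psi>"
    using assms(14) unfolding bounded_iff by (metis rangeI real_norm_def)
  interpret obstacle_problem \<Omega> \<epsilon>\<^sub>0 \<epsilon> \<alpha> \<beta> F \<Psi> "max C\<^sub>F C\<^sub>\<Psi>"
  proof
    show "\<bar>F x\<bar> \<le> max C\<^sub>F C\<^sub>\<Psi>" if "x \<in> outer_strip \<Omega> \<epsilon>\<^sub>0" for x
      using CF[OF that] by simp
    show "\<bar>\<Psi> x\<bar> \<le> max C\<^sub>F C\<^sub>\<Psi>" for x using CP[of x] by simp
  qed (use assms False in auto)
  have "value_I \<Omega> \<epsilon>\<^sub>0 \<epsilon> \<alpha> \<beta> G x = u x \<and> u x = value_II \<Omega> \<epsilon>\<^sub>0 \<epsilon> \<alpha> \<beta> G x"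
    if "dpp_solution \<Omega> \<epsilon>\<^sub>0 \<epsilon> \<alpha> \<beta> F \<Psi> u" "x \<in> \<Omega>" for u x
  proof -
    interpret obstacle_game \<Omega> \<epsilon>\<^sub>0 \<epsilon> \<alpha> \<beta> F \<Psi> "max C\<^sub>F C\<^sub>\<Psi>" G u x
      by unfold_locales (use assms that in auto)
    show ?thesis using values_eq by simp
  qed
  with dpp_solution_exists show ?thesis by blast
qed

end
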